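(* Let $(X_1,X_2,X_3,X_4)$ be a mean zero Gaussian vector with $4\times4$ positive definite covariance matrix $\Sigma$. For $a>0$ let $Q=I-(I+a\Sigma)^{-1}$, with $2\times 2$ blocks $Q_{ij}$, $i,j=1,2$, and let $q_{ij}$ and $v_1=(v_{11},v_{21})$ (all depending on $a$) be the quantities associated with $Q$ as described in the context. (i) For each $a>0$: one has $$\operatorname{trace}\, Q_{11}^{k_1}Q_{12}Q_{22}^{m_1}Q_{21}Q_{11}^{k_2}\cdots Q_{11}^{k_d}Q_{12}Q_{22}^{m_d}Q_{21}Q_{11}^{k_{d+1}}\ge 0$$ for all $d\in\mathbb{N}_0$ and all $k_1,\dots,k_{d+1},m_1,\dots,m_d\in\mathbb{N}_0$ if and only if $$v_{11}q_{13}(v_{11}q_{13}+v_{21}q_{23})\ge 0.$$ In particular, $(X_1^2+X_2^2,\,X_3^2+X_4^2)$ is infinitely divisible if the latter inequality is satisfied for all sufficiently large $a$. (ii) For each $a>0$ and any $k,m\in\mathbb{N}_0$ such that at least one of the inequalities $k\le 2$, $m\le 2$, $k+m\le 7$ is satisfied, the sum $$\sum \operatorname{trace}\, Q_{11}^{k_1}Q_{12}Q_{22}^{m_1}Q_{21}Q_{11}^{k_2}\cdots Q_{11}^{k_d}Q_{12}Q_{22}^{m_d}Q_{21}Q_{11}^{k_{d+1}}+\sum \operatorname{trace}\, Q_{22}^{m_1}Q_{21}Q_{11}^{k_1}Q_{12}Q_{22}^{m_2}\cdots Q_{22}^{m_d}Q_{21}Q_{11}^{k_d}Q_{12}Q_{22}^{m_{d+1}}$$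 is non-negative, where the first sum is over all $d\in\mathbb{N}_0$ and $k_1,\dots,k_{d+1},m_1,\dots,m_d\in\mathbb{N}_0$ with $k_1+\dots+k_{d+1}+d=k$ and $m_1+\dots+m_d+d=m$, and the second sum is over all $d\in\mathbb{N}_0$ and $m_1,\dots,m_{d+1},k_1,\dots,k_d\in\mathbb{N}_0$ with $m_1+\dots+m_{d+1}+d=m$ and $k_1+\dots+k_d+d=k$.
   Context: $\mathbb{N}_0=\{0,1,2,\dots\}$; the zeroth power of a square matrix is the identity. For $d=0$ the products in the two kinds of traces are interpreted as $Q_{11}^{k_1}$ and $Q_{22}^{m_1}$, respectively. A random vector is infinitely divisible if for every $n\in\mathbb{N}$ it has the same distribution as a sum of $n$ i.i.d. random vectors. A $(2,2)$-signature matrix is a $4\times 4$ matrix of the form $\begin{pmatrix} U_1 & 0 \\ 0 & U_2 \end{pmatrix}$ with $U_1,U_2$ orthogonal $2\times2$ matrices. Convention: for a symmetric $2\times 2$ matrix, "the eigenvector associated with the largest eigenvalue" is a (nonzero) eigenvector for its largest eigenvalue; if the matrix is a multiple of the identity, this eigenvector is fixed to be $(1,0)$. Setting: $Q$ is positive definite with $2\times2$ blocks $Q_{11},Q_{12},Q_{21}=Q_{12}^t,Q_{22}$. Let $W=\begin{pmatrix} W_1 & 0 \\ 0 & W_2 \end{pmatrix}$ be a $(2,2)$-signature matrix such that $$W^tQW=\begin{pmatrix} W_1^tQ_{11}W_1 & W_1^tQ_{12}W_2 \\ W_2^tQ_{21}W_1 & W_2^tQ_{22}W_2 \end{pmatrix}=\begin{pmatrix}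 q_{11} & 0 & q_{13} & q_{14} \\ 0 & q_{22} & q_{23} & q_{24} \\ q_{13} & q_{23} & q_{33} & 0 \\ q_{14} & q_{24} & 0 & q_{44} \end{pmatrix},\qquad q_{11}\ge q_{22}>0,\; q_{33}\ge q_{44}>0$$ (such $W$ exists). Thus $q_{ij}$ is the $(i,j)$ entry of $W^tQW$, not of $Q$. Let $v_1=(v_{11},v_{21})$ be the eigenvector of $W_1^tQ_{12}Q_{21}W_1$ associated with the largest eigenvalue. If $q_{11}=q_{22}$ (so that any orthogonal $W_1$ gives the desired form) or $q_{33}=q_{44}$ (so that any orthogonal $W_2$ gives the desired form), one may always choose $W_1$ or $W_2$ such that $v_{11}q_{13}(v_{11}q_{13}+v_{21}q_{23})\ge0$, and in that case $W$ is fixed to be such a choice. *)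

theory Defs
  imports "HOL-Probability.Probability"
begin

section \<open>Matrices and their \<open>2 \<times> 2\<close> blocks\<close>

definition pos_def :: "real^'n^'n \<Rightarrow> bool" where
  "pos_def A \<longleftrightarrow> transpose A = A \<and> (\<forall>x. x \<noteq> 0 \<longrightarrow> 0 < x \<bullet> (A *v x))"

text \<open>The operation \<open>^\<close> on \<^typ>\<open>real^'n^'n\<close> is the componentwise power, not the matrix power.\<close>
primrec mat_pow :: "real^'n^'n \<Rightarrow> nat \<Rightarrow> real^'n^'n" where
  "mat_pow A 0 = mat 1"
| "mat_pow A (Suc k) = A ** mat_pow A k"

definition lo :: "2 \<Rightarrow> 4" where "lo i = (if i = 1 then 1 else 2)"
definition hi :: "2 \<Rightarrow> 4" where "hi i = (if i = 1 then 3 else 4)"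

definition block11 :: "real^4^4 \<Rightarrow> real^2^2" where "block11 A = (\<chi> i j. A $ lo i $ lo j)"
definition block12 :: "real^4^4 \<Rightarrow> real^2^2" where "block12 A = (\<chi> i j. A $ lo i $ hi j)"
definition block21 :: "real^4^4 \<Rightarrow> real^2^2" where "block21 A = (\<chi> i j. A $ hi i $ lo j)"
definition block22 :: "real^4^4 \<Rightarrow> real^2^2" where "block22 A = (\<chi> i j. A $ hi i $ hi j)"

definition signature22 :: "real^4^4 \<Rightarrow> bool" where
  "signature22 W \<longleftrightarrow> orthogonal_matrix (block11 W) \<and> block12 W = 0 \<and>
     block21 W = 0 \<and> orthogonal_matrix (block22 W)"

text \<open>The eigenvector is determined only up to a nonzero factor (and fixed to be \<open>(1,0)\<close> for
  multiples of the identity), hence a predicate.\<close>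
definition top_eigenvector :: "real^2^2 \<Rightarrow> real^2 \<Rightarrow> bool" where
  "top_eigenvector A v \<longleftrightarrow> v \<noteq> 0 \<and>
     (\<exists>l. A *v v = l *\<^sub>R v \<and> (\<forall>\<mu> w. w \<noteq> 0 \<and> A *v w = \<mu> *\<^sub>R w \<longrightarrow> \<mu> \<le> l)) \<and>
     ((\<exists>c. A = mat c) \<longrightarrow> v = vector [1, 0])"

definition conj_by :: "real^4^4 \<Rightarrow> real^4^4 \<Rightarrow> real^4^4" where
  "conj_by W Q = transpose W ** Q ** W"

definition sign_condition :: "real^4^4 \<Rightarrow> real^4^4 \<Rightarrow> real^2 \<Rightarrow> bool" where
  "sign_condition Q W v \<longleftrightarrow>
     (let q = conj_by W Q
      in v$1 * q$1$3 * (v$1 * q$1$3 + v$2 * q$2$3) \<ge> 0)"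

text \<open>\<open>admissible Q W v\<close>: \<open>W\<close> and \<open>v\<close> are a legitimate choice of signature matrix and eigenvector
  for \<open>Q\<close>. The last conjunct is the additional convention on the choice of \<open>W\<close> when a diagonal
  block of \<open>W\<^sup>t Q W\<close> is a multiple of the identity.\<close>
definition admissible :: "real^4^4 \<Rightarrow> real^4^4 \<Rightarrow> real^2 \<Rightarrow> bool" where
  "admissible Q W v \<longleftrightarrow>
     (let q = conj_by W Q; W1 = block11 W in
        signature22 W \<and>
        q$1$2 = 0 \<and> q$2$1 = 0 \<and> q$3$4 = 0 \<and> q$4$3 = 0 \<and>
        q$1$1 \<ge> q$2$2 \<and> q$2$2 > 0 \<and> q$3$3 \<ge> q$4$4 \<and> q$4$4 > 0 \<and>
        top_eigenvector (transpose W1 ** block12 Q ** block21 Q ** W1) v \<and>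
        (q$1$1 = q$2$2 \<or> q$3$3 = q$4$4 \<longrightarrow> sign_condition Q W v))"

definition Qmat :: "real^4^4 \<Rightarrow> real \<Rightarrow> real^4^4" where
  "Qmat \<Sigma> a = mat 1 - matrix_inv (mat 1 + a *\<^sub>R \<Sigma>)"


section \<open>Alternating products\<close>

text \<open>\<open>alt_prod A B C D k m d\<close> is
  \<open>A\<^bsup>k 0\<^esup> B C\<^bsup>m 0\<^esup> D A\<^bsup>k 1\<^esup> \<dots> A\<^bsup>k (d-1)\<^esup> B C\<^bsup>m (d-1)\<^esup> D A\<^bsup>k d\<^esup>\<close>; exponents are indexed from \<open>0\<close>.\<close>
primrec alt_prod :: "real^2^2 \<Rightarrow> real^2^2 \<Rightarrow> real^2^2 \<Rightarrow> real^2^2 \<Rightarrow>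
    (nat \<Rightarrow> nat) \<Rightarrow> (nat \<Rightarrow> nat) \<Rightarrow> nat \<Rightarrow> real^2^2" where
  "alt_prod A B C D k m 0 = mat_pow A (k 0)"
| "alt_prod A B C D k m (Suc d) =
     alt_prod A B C D k m d ** B ** mat_pow C (m d) ** D ** mat_pow A (k (Suc d))"

definition exponents :: "nat \<Rightarrow> nat \<Rightarrow> (nat \<times> nat list \<times> nat list) set" where
  "exponents k m = {(d, ks, ms). length ks = d + 1 \<and> length ms = d \<and>
     sum_list ks + d = k \<and> sum_list ms + d = m}"

definition trace_sum :: "real^2^2 \<Rightarrow> real^2^2 \<Rightarrow> real^2^2 \<Rightarrow> real^2^2 \<Rightarrow> nat \<Rightarrow> nat \<Rightarrow> real" where
  "trace_sum A B C D k m =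
     (\<Sum>(d, ks, ms)\<in>exponents k m. trace (alt_prod A B C D ((!) ks) ((!) ms) d))"

lemma finite_exponents: "finite (exponents k m)"
proof (rule finite_subset)
  let ?L = "{xs. set xs \<subseteq> {..k + m} \<and> length xs \<le> k + 1}"
  show "exponents k m \<subseteq> {..k} \<times> ?L \<times> ?L"
    by (auto simp: exponents_def dest!: member_le_sum_list)
  have "finite ?L" by (rule finite_lists_length_le) simp
  then show "finite ({..k} \<times> ?L \<times> ?L)" by simp
qed


section \<open>Gaussian vectors and infinite divisibility\<close>

definition gaussian_vector :: "'a measure \<Rightarrow> ('a \<Rightarrow> real^'n) \<Rightarrow> bool" where
  "gaussian_vector M X \<longleftrightarrow> X \<in> borel_measurable M \<and>
     (\<forall>c. (\<exists>\<mu>. AE \<omega> in M. c \<bullet> X \<omega> = \<mu>) \<or>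
          (\<exists>\<mu> \<sigma>. 0 < \<sigma> \<and> distributed M lborel (\<lambda>\<omega>. c \<bullet> X \<omega>) (\<lambda>x. ennreal (normal_density \<mu> \<sigma> x))))"

definition mean_vector :: "'a measure \<Rightarrow> ('a \<Rightarrow> real^'n) \<Rightarrow> real^'n" where
  "mean_vector M X = (\<chi> i. \<integral>\<omega>. X \<omega> $ i \<partial>M)"

definition covariance_matrix :: "'a measure \<Rightarrow> ('a \<Rightarrow> real^'n) \<Rightarrow> real^'n^'n" where
  "covariance_matrix M X =
     (\<chi> i j. \<integral>\<omega>. (X \<omega> $ i - mean_vector M X $ i) * (X \<omega> $ j - mean_vector M X $ j) \<partial>M)"

text \<open>The i.i.d. vectors may live on any probability space; fixing the type of its points to be
  \<^typ>\<open>nat \<Rightarrow> 'b\<close> is no restriction, since products of copies of the common law have this type.\<close>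
definition infinitely_divisible :: "'a measure \<Rightarrow> ('a \<Rightarrow> 'b::euclidean_space) \<Rightarrow> bool" where
  "infinitely_divisible M Y \<longleftrightarrow> (\<forall>n::nat. n \<ge> 1 \<longrightarrow> (\<exists>(N :: (nat \<Rightarrow> 'b) measure) Z.
     prob_space N \<and>
     prob_space.indep_vars N (\<lambda>_. borel) Z {..<n} \<and>
     (\<forall>i<n. \<forall>j<n. distr N borel (Z i) = distr N borel (Z j)) \<and>
     distr M borel Y = distr N borel (\<lambda>\<omega>. \<Sum>i<n. Z i \<omega>)))"


section \<open>Existence of admissible choices\<close>

text \<open>Not needed to state anything: it shows that quantification over \<^const>\<open>admissible\<close> choices
  is never vacuous.\<close>

lemma symmetric_diagonalisable:
  fixes A :: "real^2^2"
  assumes "transpose A = A"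
  obtains R where "orthogonal_matrix R"
    "(transpose R ** A ** R)$1$2 = 0" "(transpose R ** A ** R)$2$1 = 0"
    "(transpose R ** A ** R)$2$2 \<le> (transpose R ** A ** R)$1$1"
proof -
  define p q r where "p = A$1$1" and "q = A$1$2" and "r = A$2$2"
  have q': "A$2$1 = q"
    using arg_cong[OF assms, of "\<lambda>B. B$1$2"] by (simp add: transpose_def q_def)
  define D where "D = sqrt ((p - r)\<^sup>2 + (2*q)\<^sup>2)"
  obtain t where t: "p - r = D * cos t" "2*q = D * sin t"
  proof (cases "D = 0")
    case True
    then have "(p - r)\<^sup>2 + (2*q)\<^sup>2 = 0"
      by (simp only: D_def real_sqrt_eq_zero_cancel_iff)
    then have "p - r = 0 \<and> 2*q = 0"
      by (simp only: sum_power2_eq_zero_iff)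
    then show ?thesis using that[of 0] True by simp
  next
    case False
    then have "((p - r)/D)\<^sup>2 + ((2*q)/D)\<^sup>2 = 1"
      by (simp add: power_divide add_divide_distrib[symmetric]) (auto simp: D_def)
    then obtain t where "(p - r)/D = cos t" "(2*q)/D = sin t"
      by (metis sincos_total_2pi)
    then show ?thesis using that[of t] False by (simp add: field_simps)
  qed
  define c s where "c = cos (t/2)" and "s = sin (t/2)"
  have cs: "c\<^sup>2 + s\<^sup>2 = 1" by (simp add: c_def s_def)
  have t': "cos t = c\<^sup>2 - s\<^sup>2" "sin t = 2 * s * c"
    using cos_double[of "t/2"] sin_double[of "t/2"] by (simp_all add: c_def s_def)
  define R :: "real^2^2" where "R = vector [vector [c, -s], vector [s, c]]"
  have R: "R$1$1 = c" "R$1$2 = -s" "R$2$1 = s" "R$2$2 = c" by (simp_all add: R_def)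
  let ?B = "transpose R ** A ** R"
  have B: "?B$1$1 = c*c*p + 2*c* s*q + s* s*r" "?B$1$2 = q*(c*c - s* s) - c* s*(p-r)"
    "?B$2$1 = q*(c*c - s* s) - c* s*(p-r)" "?B$2$2 = s* s*p - 2*c* s*q + c*c*r"
    by (simp_all add: matrix_matrix_mult_def transpose_def sum_2 R q' p_def q_def r_def algebra_simps)
  have o: "orthogonal_matrix R"
    using cs by (simp add: orthogonal_matrix vec_eq_iff forall_2 matrix_matrix_mult_def transpose_def
        sum_2 R mat_def power2_eq_square algebra_simps)
  have q2: "q = D * (s * c)" using t(2) t'(2) by simp
  have z: "q*(c*c - s* s) - c* s*(p-r) = 0"
    unfolding t(1) t'(1) by (subst q2) (simp add: power2_eq_square algebra_simps)
  have "?B$1$1 - ?B$2$2 = (p - r) * (c\<^sup>2 - s\<^sup>2) + (2*q) * (2 * s * c)"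
    unfolding B by (simp add: power2_eq_square algebra_simps)
  also have "\<dots> = D * ((cos t)\<^sup>2 + (sin t)\<^sup>2)"
    unfolding t'[symmetric] t by (simp only: power2_eq_square algebra_simps)
  also have "\<dots> \<ge> 0" by (simp add: D_def)
  finally show ?thesis using that[OF o] B z by simp
qed

lemma top_eigenvector_exists:
  assumes "transpose A = A"
  shows "\<exists>v. top_eigenvector A v"
proof -
  obtain R where R: "orthogonal_matrix R"
    "(transpose R ** A ** R)$1$2 = 0" "(transpose R ** A ** R)$2$1 = 0"
    "(transpose R ** A ** R)$2$2 \<le> (transpose R ** A ** R)$1$1"
    using symmetric_diagonalisable[OF assms] .
  let ?B = "transpose R ** A ** R"
  let ?l = "?B$1$1"
  have RR: "R ** transpose R = mat 1" "transpose R ** R = mat 1"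
    using R(1) by (simp_all add: orthogonal_matrix_def)
  have AR: "A ** R = R ** ?B"
    by (metis RR(1) matrix_mul_assoc matrix_mul_lid)
  define e where "e = (vector [1,0] :: real^2)"
  have e: "e$1 = 1" "e$2 = 0" by (simp_all add: e_def)
  have Be: "?B *v e = ?l *\<^sub>R e"
    using R by (simp add: vec_eq_iff forall_2 matrix_vector_mult_def sum_2 e)
  have "A *v (R *v e) = R *v (?B *v e)"
    by (simp add: AR matrix_vector_mul_assoc)
  then have ev: "A *v (R *v e) = ?l *\<^sub>R (R *v e)"
    unfolding Be by (simp add: matrix_vector_mult_scaleR)
  have nz: "R *v e \<noteq> 0"
  proof
    assume "R *v e = 0"
    then have "transpose R *v (R *v e) = 0" by simp
    then have "e = 0" by (simp add: matrix_vector_mul_assoc RR)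
    then show False using e by (simp add: vec_eq_iff forall_2)
  qed
  have max: "\<mu> \<le> ?l" if "w \<noteq> 0" "A *v w = \<mu> *\<^sub>R w" for \<mu> w
  proof -
    define u where "u = transpose R *v w"
    have w: "w = R *v u" by (simp add: u_def matrix_vector_mul_assoc RR del: transpose_matrix_vector)
    have "u \<noteq> 0" using that(1) w by auto
    have "?B *v u = transpose R *v (A *v w)"
      by (simp add: w matrix_vector_mul_assoc matrix_mul_assoc del: transpose_matrix_vector)
    then have "?B *v u = \<mu> *\<^sub>R u"
      unfolding that(2) by (simp add: matrix_vector_mult_scaleR u_def del: transpose_matrix_vector)
    then have "?B$1$1 * u$1 = \<mu> * u$1" "?B$2$2 * u$2 = \<mu> * u$2"
      using R by (auto simp add: vec_eq_iff forall_2 matrix_vector_mult_def sum_2)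
    then show ?thesis using \<open>u \<noteq> 0\<close> R(4) by (auto simp: vec_eq_iff forall_2)
  qed
  show ?thesis
  proof (cases "\<exists>c. A = mat c")
    case True
    then obtain c where c: "A = mat c" by blast
    have m: "A *v x = c *\<^sub>R x" for x
      by (simp add: c vec_eq_iff forall_2 matrix_vector_mult_def sum_2 mat_def)
    have "e \<noteq> 0" using e by (auto simp: vec_eq_iff forall_2)
    then have "top_eigenvector A e"
      unfolding top_eigenvector_def by (auto simp: m e_def)
    then show ?thesis ..
  next
    case False
    then show ?thesis unfolding top_eigenvector_def using ev nz max by blast
  qed
qed


lemma top_eigenvector_diagonal:
  assumes B: "B$1$2 = 0" "B$2$1 = 0" "B$2$2 \<le> B$1$1"
  shows "top_eigenvector B (vector [1, 0])"
proof -
  define e where "e = (vector [1, 0] :: real^2)"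
  have e: "e$1 = 1" "e$2 = 0" by (simp_all add: e_def)
  have "e \<noteq> 0" using e by (auto simp: vec_eq_iff forall_2)
  moreover have "B *v e = B$1$1 *\<^sub>R e"
    using B by (simp add: vec_eq_iff forall_2 matrix_vector_mult_def sum_2 e)
  moreover have "\<mu> \<le> B$1$1" if "w \<noteq> 0" "B *v w = \<mu> *\<^sub>R w" for \<mu> w
  proof -
    have "B$1$1 * w$1 = \<mu> * w$1" "B$2$2 * w$2 = \<mu> * w$2"
      using that(2) B by (auto simp: vec_eq_iff forall_2 matrix_vector_mult_def sum_2)
    then show ?thesis using that(1) B(3) by (auto simp: vec_eq_iff forall_2)
  qed
  ultimately show ?thesis unfolding top_eigenvector_def e_def by blast
qed

lemma vector_4:
  fixes w :: "'a::zero"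
  shows "(vector [w, x, y, z] :: 'a^4)$1 = w" "(vector [w, x, y, z] :: 'a^4)$2 = x"
    "(vector [w, x, y, z] :: 'a^4)$3 = y" "(vector [w, x, y, z] :: 'a^4)$4 = z"
  by (simp_all add: vector_def)

lemma rotation_killing_entry:
  fixes x y :: real
  obtains R :: "real^2^2" where "orthogonal_matrix R" "x * R$1$1 + y * R$2$1 = 0"
proof -
  obtain c s :: real where cs: "c\<^sup>2 + s\<^sup>2 = 1" "x * c + y * s = 0"
  proof (cases "x\<^sup>2 + y\<^sup>2 = 0")
    case True
    then show ?thesis using that[of 1 0] by (simp add: sum_power2_eq_zero_iff)
  next
    case False
    let ?d = "sqrt (x\<^sup>2 + y\<^sup>2)"
    have "(y/?d)\<^sup>2 + (-x/?d)\<^sup>2 = 1"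
      using False by (simp add: power_divide add_divide_distrib[symmetric] add.commute)
    then show ?thesis using that[of "y/?d" "-x/?d"] by simp
  qed
  define R :: "real^2^2" where "R = vector [vector [c, -s], vector [s, c]]"
  have R: "R$1$1 = c" "R$1$2 = -s" "R$2$1 = s" "R$2$2 = c" by (simp_all add: R_def)
  have "orthogonal_matrix R"
    using cs(1) by (simp add: orthogonal_matrix vec_eq_iff forall_2 matrix_matrix_mult_def
        transpose_def sum_2 R mat_def power2_eq_square algebra_simps)
  then show ?thesis using that[of R] cs(2) R by simp
qed

lemma admissible_exists:
  assumes "pos_def Q"
  shows "\<exists>W v. admissible Q W v"
proof -
  have ne: "(1::4) \<noteq> 2" "(1::4) \<noteq> 3" "(1::4) \<noteq> 4" "(2::4) \<noteq> 3" "(2::4) \<noteq> 4" "(3::4) \<noteq> 4"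
    by auto
  have sQ: "Q$i$j = Q$j$i" for i j
  proof -
    have "transpose Q $ i $ j = Q $ i $ j" using assms by (simp add: pos_def_def)
    then show ?thesis by (simp add: transpose_def)
  qed
  have s1: "transpose (block11 Q) = block11 Q" and s2: "transpose (block22 Q) = block22 Q"
    using sQ by (auto simp: vec_eq_iff transpose_def block11_def block22_def)
  let ?P = "block12 Q ** block21 Q"
  have s12: "transpose (block12 Q) = block21 Q" "transpose (block21 Q) = block12 Q"
    using sQ by (auto simp: vec_eq_iff transpose_def block12_def block21_def)
  have sP: "transpose (transpose R ** ?P ** R) = transpose R ** ?P ** R" for R
    by (simp add: matrix_transpose_mul s12 matrix_mul_assoc)
  obtain R1 where R1: "orthogonal_matrix R1"
    "(transpose R1 ** block11 Q ** R1)$1$2 = 0" "(transpose R1 ** block11 Q ** R1)$2$1 = 0"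
    "(transpose R1 ** block11 Q ** R1)$2$2 \<le> (transpose R1 ** block11 Q ** R1)$1$1"
    using symmetric_diagonalisable[OF s1] .
  obtain R2 where R2: "orthogonal_matrix R2"
    "(transpose R2 ** block22 Q ** R2)$1$2 = 0" "(transpose R2 ** block22 Q ** R2)$2$1 = 0"
    "(transpose R2 ** block22 Q ** R2)$2$2 \<le> (transpose R2 ** block22 Q ** R2)$1$1"
    using symmetric_diagonalisable[OF s2] .
  define BD :: "real^2^2 \<Rightarrow> real^2^2 \<Rightarrow> real^4^4" where
    "BD U V = vector [vector [U$1$1, U$1$2, 0, 0], vector [U$2$1, U$2$2, 0, 0],
                  vector [0, 0, V$1$1, V$1$2], vector [0, 0, V$2$1, V$2$2]]" for U V
  have BD: "block11 (BD U V) = U" "block22 (BD U V) = V" "block12 (BD U V) = 0" "block21 (BD U V) = 0" for U V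
    by (simp_all add: BD_def vec_eq_iff forall_2 block11_def block12_def block21_def block22_def
        lo_def hi_def vector_4)
  have cb: "conj_by (BD U V) Q $ lo i $ lo j = (transpose U ** block11 Q ** U)$i$j"
           "conj_by (BD U V) Q $ lo i $ hi j = (transpose U ** block12 Q ** V)$i$j"
           "conj_by (BD U V) Q $ hi i $ hi j = (transpose V ** block22 Q ** V)$i$j" for U V i j
    using exhaust_2[of i] exhaust_2[of j]
    by (auto simp: conj_by_def BD_def matrix_matrix_mult_def transpose_def sum_4 sum_2
        block11_def block12_def block22_def lo_def hi_def vector_4)
  have cb': "conj_by (BD U V) Q $ 1 $ 1 = (transpose U ** block11 Q ** U)$1$1"
    "conj_by (BD U V) Q $ 1 $ 2 = (transpose U ** block11 Q ** U)$1$2"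
    "conj_by (BD U V) Q $ 2 $ 1 = (transpose U ** block11 Q ** U)$2$1"
    "conj_by (BD U V) Q $ 2 $ 2 = (transpose U ** block11 Q ** U)$2$2"
    "conj_by (BD U V) Q $ 1 $ 3 = (transpose U ** block12 Q ** V)$1$1"
    "conj_by (BD U V) Q $ 2 $ 3 = (transpose U ** block12 Q ** V)$2$1"
    "conj_by (BD U V) Q $ 3 $ 3 = (transpose V ** block22 Q ** V)$1$1"
    "conj_by (BD U V) Q $ 3 $ 4 = (transpose V ** block22 Q ** V)$1$2"
    "conj_by (BD U V) Q $ 4 $ 3 = (transpose V ** block22 Q ** V)$2$1"
    "conj_by (BD U V) Q $ 4 $ 4 = (transpose V ** block22 Q ** V)$2$2" for U V
    using cb(1)[of U V 1 1] cb(1)[of U V 1 2] cb(1)[of U V 2 1] cb(1)[of U V 2 2]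
      cb(2)[of U V 1 1] cb(2)[of U V 2 1]
      cb(3)[of U V 1 1] cb(3)[of U V 1 2] cb(3)[of U V 2 1] cb(3)[of U V 2 2]
    by (simp_all add: lo_def hi_def)
  have pos: "conj_by W Q $ i $ i > 0" if W: "orthogonal_matrix W" for W i
  proof -
    have "W *v axis i 1 \<noteq> 0"
    proof
      assume "W *v axis i 1 = 0"
      then have "transpose W *v (W *v axis i 1) = 0" by (simp del: transpose_matrix_vector)
      then have "(axis i 1 :: real^4) = 0"
        using W by (simp add: matrix_vector_mul_assoc orthogonal_matrix del: transpose_matrix_vector)
      then show False by simp
    qed
    then have "0 < (W *v axis i 1) \<bullet> (Q *v (W *v axis i 1))"
      using assms by (simp add: pos_def_def)
    also have "\<dots> = axis i 1 \<bullet> (transpose W *v (Q *v (W *v axis i 1)))"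
      unfolding transpose_matrix_vector by (metis dot_lmul_matrix inner_commute)
    also have "\<dots> = conj_by W Q $ i $ i"
      by (simp add: conj_by_def matrix_vector_mul_assoc matrix_mul_assoc inner_axis' 
          matrix_vector_mult_basis column_def matrix_vector_mult_def[of "_ ** _"]
          matrix_matrix_mult_def[of "_ ** _"] del: transpose_matrix_vector)
    finally show ?thesis .
  qed
  have oBD: "orthogonal_matrix (BD U V)" if "orthogonal_matrix U" "orthogonal_matrix V" for U V
    using that
    by (simp add: orthogonal_matrix vec_eq_iff forall_2 forall_4 BD_def matrix_matrix_mult_def
        transpose_def sum_4 sum_2 vector_4 mat_def)
  have main: "admissible Q (BD U V) v"
    if "orthogonal_matrix U" "orthogonal_matrix V"
      "(transpose U ** block11 Q ** U)$1$2 = 0" "(transpose U ** block11 Q ** U)$2$1 = 0"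
      "(transpose U ** block11 Q ** U)$2$2 \<le> (transpose U ** block11 Q ** U)$1$1"
      "(transpose V ** block22 Q ** V)$1$2 = 0" "(transpose V ** block22 Q ** V)$2$1 = 0"
      "(transpose V ** block22 Q ** V)$2$2 \<le> (transpose V ** block22 Q ** V)$1$1"
      "top_eigenvector (transpose U ** ?P ** U) v"
      "(transpose U ** block11 Q ** U)$1$1 = (transpose U ** block11 Q ** U)$2$2 \<or>
       (transpose V ** block22 Q ** V)$1$1 = (transpose V ** block22 Q ** V)$2$2 \<longrightarrow>
         sign_condition Q (BD U V) v" for U V v
    using that pos[OF oBD[OF that(1,2)], of 2] pos[OF oBD[OF that(1,2)], of 4]
    by (simp add: admissible_def signature22_def BD cb' Let_def matrix_mul_assoc)
  have scalar: "transpose R ** A ** R = A"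
    if "orthogonal_matrix R" "orthogonal_matrix S" and B: "transpose S ** A ** S = mat c" for A R S :: "real^2^2" and c
  proof -
    have SS: "S ** transpose S = mat 1" "R ** transpose R = mat 1" "transpose R ** R = mat 1"
      using that by (simp_all add: orthogonal_matrix_def)
    have cm: "X ** mat c = c *\<^sub>R X" "mat c ** X = c *\<^sub>R X" for X :: "real^2^2"
      by (simp_all add: vec_eq_iff forall_2 matrix_matrix_mult_def sum_2 mat_def)
    have sc: "(c *\<^sub>R X) ** Y = c *\<^sub>R (X ** Y)" for X Y :: "real^2^2"
      by (simp add: vec_eq_iff forall_2 matrix_matrix_mult_def sum_2 algebra_simps)
    have "A = (S ** transpose S) ** A ** (S ** transpose S)" by (simp add: SS)
    also have "\<dots> = S ** (transpose S ** A ** S) ** transpose S" by (simp add: matrix_mul_assoc)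
    also have "\<dots> = mat c"
      unfolding B cm sc SS by (simp add: vec_eq_iff mat_def)
    finally have A: "A = mat c" .
    show ?thesis unfolding A cm sc SS by (simp add: vec_eq_iff mat_def)
  qed
  have mat2: "A = mat (A$1$1)" if "A$1$1 = A$2$2" "A$1$2 = 0" "A$2$1 = 0" for A :: "real^2^2"
    using that by (simp add: vec_eq_iff forall_2 mat_def)
  show ?thesis
  proof (cases "(transpose R1 ** block11 Q ** R1)$1$1 = (transpose R1 ** block11 Q ** R1)$2$2")
    case True
    have m: "transpose R1 ** block11 Q ** R1 = mat ((transpose R1 ** block11 Q ** R1)$1$1)"
      using True R1 by (intro mat2) simp_all
    obtain S where S: "orthogonal_matrix S"
      "(transpose S ** ?P ** S)$1$2 = 0" "(transpose S ** ?P ** S)$2$1 = 0"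
      "(transpose S ** ?P ** S)$2$2 \<le> (transpose S ** ?P ** S)$1$1"
      using symmetric_diagonalisable sP[of "mat 1"] by (metis matrix_mul_lid matrix_mul_rid transpose_mat)
    have eqm: "transpose S ** block11 Q ** S = transpose R1 ** block11 Q ** R1"
      using scalar[OF S(1) R1(1) m] scalar[OF R1(1) R1(1) m] by simp
    define e :: "real^2" where "e = vector [1, 0]"
    have e: "e$1 = 1" "e$2 = 0" by (simp_all add: e_def)
    have te: "top_eigenvector (transpose S ** ?P ** S) e"
      unfolding e_def using S by (intro top_eigenvector_diagonal) simp_all
    have "sign_condition Q (BD S R2) e"
      by (simp add: sign_condition_def e Let_def)
    then show ?thesis using main[OF S(1) R2(1) _ _ _ R2(2-4) te] R1 unfolding eqm by blast
  next
    case False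
    note neq = False
    obtain v where v: "top_eigenvector (transpose R1 ** ?P ** R1) v"
      using top_eigenvector_exists[OF sP] by blast
    show ?thesis
    proof (cases "(transpose R2 ** block22 Q ** R2)$1$1 = (transpose R2 ** block22 Q ** R2)$2$2")
      case True
      have m: "transpose R2 ** block22 Q ** R2 = mat ((transpose R2 ** block22 Q ** R2)$1$1)"
        using True R2 by (intro mat2) simp_all
      let ?N = "transpose R1 ** block12 Q"
      obtain S :: "real^2^2" where S: "orthogonal_matrix S" "?N$1$1 * S$1$1 + ?N$1$2 * S$2$1 = 0"
        using rotation_killing_entry .
      have eqm: "transpose S ** block22 Q ** S = transpose R2 ** block22 Q ** R2"
        using scalar[OF S(1) R2(1) m] scalar[OF R2(1) R2(1) m] by simp
      have "(?N ** S)$1$1 = 0"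
        using S(2) by (simp add: matrix_matrix_mult_def[of ?N] sum_2)
      then have "sign_condition Q (BD R1 S) v"
        by (simp add: sign_condition_def Let_def cb')
      then show ?thesis using main[OF R1(1) S(1) R1(2-4) _ _ _ v] R2 unfolding eqm by blast
    next
      case False
      then show ?thesis using main[OF R1(1) R2(1) R1(2-4) R2(2-4) v] neq by blast
    qed
  qed
qed


lemma pos_def_Qmat:
  assumes "pos_def \<Sigma>" "a > 0"
  shows "pos_def (Qmat \<Sigma> a)"
proof -
  define N where "N = mat 1 + a *\<^sub>R \<Sigma>"
  have Qm: "Qmat \<Sigma> a = mat 1 - matrix_inv N"
    by (simp add: Qmat_def N_def)
  have N: "N *v x = x + a *\<^sub>R (\<Sigma> *v x)" for x
    by (simp add: N_def matrix_vector_mult_add_rdistrib scaleR_matrix_vector_assoc)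
  have pos: "x \<bullet> (\<Sigma> *v x) > 0" if "x \<noteq> 0" for x
    using assms that by (simp add: pos_def_def)
  have "x = 0" if "N *v x = 0" for x
  proof (rule ccontr)
    assume "x \<noteq> 0"
    have "0 = x \<bullet> (N *v x)" using that by simp
    also have "\<dots> = x \<bullet> x + a * (x \<bullet> (\<Sigma> *v x))" by (simp add: N inner_add_right)
    also have "\<dots> > 0" using pos[OF \<open>x \<noteq> 0\<close>] \<open>x \<noteq> 0\<close> assms(2) by (simp add: add_pos_pos)
    finally show False by simp
  qed
  then have inv: "invertible N"
    using invertible_left_inverse matrix_left_invertible_ker by blast
  have R: "N ** matrix_inv N = mat 1" "matrix_inv N ** N = mat 1"
    using someI_ex[OF inv[unfolded invertible_def]] by (simp_all add: matrix_inv_def)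
  have tN: "transpose N = N"
    using assms(1) by (simp add: N_def pos_def_def transpose_def vec_eq_iff mat_def)
  have "transpose (matrix_inv N) ** N = mat 1"
    by (metis R(1) tN matrix_transpose_mul transpose_mat)
  then have "transpose (matrix_inv N) = matrix_inv N"
    by (metis R(1) matrix_mul_assoc matrix_mul_lid matrix_mul_rid)
  then have t: "transpose (Qmat \<Sigma> a) = Qmat \<Sigma> a"
    unfolding Qm by (auto simp: transpose_def vec_eq_iff mat_def)
  have "x \<bullet> (Qmat \<Sigma> a *v x) > 0" if "x \<noteq> 0" for x
  proof -
    define y where "y = matrix_inv N *v x"
    have x: "x = N *v y" by (simp add: y_def matrix_vector_mul_assoc R)
    then have "y \<noteq> 0" using that by auto
    have "Qmat \<Sigma> a *v x = a *\<^sub>R (\<Sigma> *v y)"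
    proof -
      have "Qmat \<Sigma> a *v x = x - y" by (simp add: Qm matrix_vector_mult_diff_rdistrib y_def)
      also have "\<dots> = a *\<^sub>R (\<Sigma> *v y)" using x N[of y] by simp
      finally show ?thesis .
    qed
    then have "x \<bullet> (Qmat \<Sigma> a *v x) = a * (y \<bullet> (\<Sigma> *v y)) + a * a * ((\<Sigma> *v y) \<bullet> (\<Sigma> *v y))"
      using x N[of y] by (simp add: inner_add_left algebra_simps)
    then show ?thesis using pos[OF \<open>y \<noteq> 0\<close>] assms(2) by (simp add: add_pos_nonneg)
  qed
  with t show ?thesis by (simp add: pos_def_def)
qed


corollary admissible_Qmat_exists:
  assumes "pos_def \<Sigma>" "a > 0"
  shows "\<exists>W v. admissible (Qmat \<Sigma> a) W v"
  using admissible_exists[OF pos_def_Qmat[OF assms]] .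

end

theory Submission
  imports Defs
begin

text \<open>
  Rotating each of the two coordinate planes separately changes neither the traces nor the random
  vector \<open>(X\<^sub>1\<^sup>2 + X\<^sub>2\<^sup>2, X\<^sub>3\<^sup>2 + X\<^sub>4\<^sup>2)\<close>. In suitable coordinates the diagonal blocks of \<open>Q\<close> are therefore
  \<open>A = diag(a1, a2)\<close> and \<open>C = diag(c1, c2)\<close> with positive \<open>a1 \<ge> a2\<close> and \<open>c1 \<ge> c2\<close>, and everything depends on
  the signs in the off-diagonal block \<open>B\<close> with rows \<open>(b1, b2)\<close> and \<open>(b3, b4)\<close>.

  The pivot is the condition \<open>aligned\<close>: one of \<open>b1 b3 (B B\<^sup>t)\<^bsub>12\<^esub>\<close> and \<open>b1 b2 (B\<^sup>t B)\<^bsub>12\<^esub>\<close> is nonnegative. It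
  ensures that the off-diagonal entries of the matrices \<open>B C\<^sup>m B\<^sup>t\<close>, or those of the matrices \<open>B\<^sup>t A\<^sup>k B\<close>, have
  one sign for all exponents. Up to flipping a basis vector every trace is then the trace of a product
  of entrywise nonnegative matrices (\<open>aligned_traces_nonneg\<close>). The sign condition on the top eigenvector
  implies alignment by an estimate of the largest eigenvalue (\<open>eigenvector_sign_imp_aligned\<close>).
  Conversely, the traces of \<open>A\<^sup>n B C\<^sup>n B\<^sup>t (B B\<^sup>t)\<^sup>j\<close> are governed by the sign condition as first \<open>n\<close> and then
  \<open>j\<close> tend to infinity (\<open>traces_nonneg_imp_eigenvector_sign\<close>). This proves the equivalence.

  Infinite divisibility is read off from \<open>K = \<Sigma>\<^sup>-\<^sup>1\<close>. The Laplace transform of the pair is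
  \<open>(det \<Sigma> det (K + 2 \<Lambda>)) powr (-1/2)\<close> (\<open>gaussian_vector_laplace\<close>). If the off-diagonal block of \<open>K\<close> is aligned,
  a Schur complement factors \<open>det (K + \<Lambda>)\<close> into linear functions \<open>\<kappa> + \<lambda>\<close> and three terms \<open>1 - u\<close> in which
  \<open>u\<close> is built from the functions \<open>1 / (\<kappa> + \<lambda>)\<close> by sums, products and negative powers with nonnegative
  coefficients. Hence every negative power of the determinant is the Laplace transform of a measure
  (\<open>laplace_fun_det_power\<close>), in particular the \<open>n\<close>-th root of the Laplace transform of the pair, and
  Laplace transforms determine measures (\<open>laplace_transform_unique\<close>). Alignment for \<open>K\<close> follows from the
  sign condition for large \<open>a\<close> because \<open>a (Q - I)\<close> tends to \<open>- K\<close>, multiples of the identity do not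
  affect the sign condition, and nonnegativity of traces survives limits
  (\<open>sign_condition_precision_aligned\<close>).

  For the trace sums, words with \<open>k \<le> 2\<close> or \<open>m \<le> 2\<close> give sums of squares, and in the aligned case every
  single trace is nonnegative. There remain the orders \<open>(3,3)\<close>, \<open>(3,4)\<close>, \<open>(4,3)\<close> in the misaligned case.
  There \<open>B\<close> and \<open>B B\<^sup>t B\<close> disagree in sign at most at the entry \<open>(1,1)\<close>, and the contributions of the entries
  \<open>(1,2)\<close> and \<open>(2,1)\<close> outweigh the loss (\<open>misaligned_estimates\<close>).
\<close>


section \<open>Quadratic forms and block rotations\<close>

definition mat22 :: "real \<Rightarrow> real \<Rightarrow> real \<Rightarrow> real \<Rightarrow> real^2^2" where
  "mat22 a b c d = vector [vector [a, b], vector [c, d]]"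

lemma mat22_nth [simp]:
  "mat22 a b c d $ 1 $ 1 = a" "mat22 a b c d $ 1 $ 2 = b"
  "mat22 a b c d $ 2 $ 1 = c" "mat22 a b c d $ 2 $ 2 = d"
  by (simp_all add: mat22_def)

lemma mat22_mult [simp]:
  "mat22 a b c d ** mat22 e f g h = mat22 (a*e + b*g) (a*f + b*h) (c*e + d*g) (c*f + d*h)"
  by (simp add: vec_eq_iff forall_2 matrix_matrix_mult_def sum_2)

lemma transpose_mat22 [simp]: "transpose (mat22 a b c d) = mat22 a c b d"
  by (simp add: vec_eq_iff forall_2 transpose_def)

lemma trace_mat22 [simp]: "trace (mat22 a b c d) = a + d"
  by (simp add: trace_def sum_2)

lemma mat_1_mat22: "(mat 1 :: real^2^2) = mat22 1 0 0 1"
  by (simp add: vec_eq_iff forall_2 mat_def)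

lemma mat_pow_diag [simp]: "mat_pow (mat22 a 0 0 d) k = mat22 (a ^ k) 0 0 (d ^ k)"
  by (induction k) (simp_all add: mat_1_mat22)

lemma mat_pow_add: "mat_pow A (i + j) = mat_pow A i ** mat_pow A j"
  by (induction i) (simp_all add: matrix_mul_assoc)

lemma scaleR_matrix_mult:
  "(c *\<^sub>R X) ** Y = c *\<^sub>R (X ** Y)" "X ** (c *\<^sub>R Y) = c *\<^sub>R (X ** Y)"
  for X :: "real^'n^'m" and Y :: "real^'p^'n"
  by (simp_all add: vec_eq_iff matrix_matrix_mult_def sum_distrib_left mult_ac)

lemma matrix_add_rdistrib: "((A :: real^'n^'m) + B) ** C = A ** C + B ** C"
  by (simp add: matrix_matrix_mult_def vec_eq_iff sum.distrib distrib_right)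

lemma inner_transpose_left: "x \<bullet> (transpose A *v y) = (A *v x) \<bullet> (y :: real^'n)"
  by (simp add: dot_lmul_matrix inner_commute[of x] inner_commute[of _ y])

lemma orthogonal_matrix_norm:
  fixes W :: "real^'n^'n"
  assumes "orthogonal_matrix W" shows "(W *v z) \<bullet> (W *v z) = z \<bullet> z"
proof -
  have "(W *v z) \<bullet> (W *v z) = z \<bullet> (transpose W *v (W *v z))"
    by (rule inner_transpose_left[symmetric])
  also have "\<dots> = z \<bullet> z"
    using assms by (simp only: matrix_vector_mul_assoc orthogonal_matrix matrix_vector_mul_lid)
  finally show ?thesis .
qed

lemma pos_def_nonneg: "pos_def A \<Longrightarrow> 0 \<le> x \<bullet> (A *v x)"
  by (cases "x = 0") (auto simp: pos_def_def less_imp_le)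

lemma pos_def_sym: "pos_def A \<Longrightarrow> A $ i $ j = A $ j $ i"
  by (metis (no_types, lifting) pos_def_def transpose_def vec_lambda_beta)

lemma borel_measurable_matrix_vector_mult [measurable]:
  fixes A :: "real^'n^'m"
  shows "(*v) A \<in> borel_measurable borel"
  by (intro borel_measurable_continuous_onI) (simp add: linear_continuous_on linear_linear matrix_vector_mul_linear)

lemma signature22_orthogonal:
  assumes "signature22 W" shows "orthogonal_matrix W"
proof -
  have W: "W$1$3 = 0" "W$1$4 = 0" "W$2$3 = 0" "W$2$4 = 0" "W$3$1 = 0" "W$3$2 = 0" "W$4$1 = 0" "W$4$2 = 0"
    using assms by (auto simp: signature22_def block12_def block21_def vec_eq_iff forall_2 lo_def hi_def)
  show ?thesis
    using assms by (simp add: signature22_def orthogonal_matrix vec_eq_iff forall_2 forall_4 mat_def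
        matrix_matrix_mult_def transpose_def sum_4 sum_2 block11_def block22_def lo_def hi_def W)
qed

lemma block_conj_by:
  assumes "signature22 W"
  shows "block11 (conj_by W Q) = transpose (block11 W) ** block11 Q ** block11 W"
    "block12 (conj_by W Q) = transpose (block11 W) ** block12 Q ** block22 W"
    "block21 (conj_by W Q) = transpose (block22 W) ** block21 Q ** block11 W"
    "block22 (conj_by W Q) = transpose (block22 W) ** block22 Q ** block22 W"
proof -
  have W: "W$1$3 = 0" "W$1$4 = 0" "W$2$3 = 0" "W$2$4 = 0" "W$3$1 = 0" "W$3$2 = 0" "W$4$1 = 0" "W$4$2 = 0"
    using assms by (auto simp: signature22_def block12_def block21_def vec_eq_iff forall_2 lo_def hi_def)
  note defs = vec_eq_iff forall_2 matrix_matrix_mult_def transpose_def sum_4 sum_2 lo_def hi_def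
    block11_def block12_def block21_def block22_def conj_by_def W
  show "block11 (conj_by W Q) = transpose (block11 W) ** block11 Q ** block11 W"
    "block12 (conj_by W Q) = transpose (block11 W) ** block12 Q ** block22 W"
    "block21 (conj_by W Q) = transpose (block22 W) ** block21 Q ** block11 W"
    "block22 (conj_by W Q) = transpose (block22 W) ** block22 Q ** block22 W"
    by (simp_all add: defs)
qed

lemma block_entries:
  "block11 q = mat22 (q$1$1) (q$1$2) (q$2$1) (q$2$2)"
  "block12 q = mat22 (q$1$3) (q$1$4) (q$2$3) (q$2$4)"
  "block21 q = mat22 (q$3$1) (q$3$2) (q$4$1) (q$4$2)"
  "block22 q = mat22 (q$3$3) (q$3$4) (q$4$3) (q$4$4)"
  by (simp_all add: vec_eq_iff forall_2 block11_def block12_def block21_def block22_def lo_def hi_def)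

lemma transpose_conj_by:
  assumes "transpose Q = Q" shows "transpose (conj_by W Q) = conj_by W Q"
  by (simp add: conj_by_def matrix_transpose_mul assms matrix_mul_assoc)

lemma conj_by_sym:
  assumes "transpose Q = Q" shows "conj_by W Q $ i $ j = conj_by W Q $ j $ i"
proof -
  have "transpose (conj_by W Q) $ i $ j = conj_by W Q $ i $ j"
    by (simp add: transpose_conj_by[OF assms])
  then show ?thesis by (simp add: transpose_def)
qed

lemma conj_by_quadratic_form: "z \<bullet> (conj_by W A *v z) = (W *v z) \<bullet> (A *v (W *v z))"
  by (simp only: conj_by_def matrix_vector_mul_assoc[symmetric] inner_transpose_left)

lemma conj_by_diag_entry: "conj_by W A $ i $ i = (W *v axis i 1) \<bullet> (A *v (W *v axis i 1))"
  unfolding conj_by_quadratic_form[symmetric] by (simp add: inner_axis' matrix_vector_mult_basis column_def)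

lemma conj_by_affine:
  assumes "orthogonal_matrix W"
  shows "conj_by W (c *\<^sub>R mat 1 + a *\<^sub>R Q) = c *\<^sub>R mat 1 + a *\<^sub>R conj_by W Q"
  using assms unfolding conj_by_def
  by (simp add: matrix_add_ldistrib matrix_add_rdistrib scaleR_matrix_mult orthogonal_matrix)

lemma pos_def_conj_by:
  assumes "pos_def A" "orthogonal_matrix W" shows "pos_def (conj_by W A)"
proof -
  have "W *v z \<noteq> 0" if "z \<noteq> 0" for z
    using orthogonal_matrix_norm[OF assms(2), of z] that by auto
  with assms show ?thesis
    by (simp add: pos_def_def conj_by_quadratic_form transpose_conj_by)
qed

lemma pos_def_minor:
  fixes q :: "real^4^4"
  assumes q: "pos_def q" and "0 < q$4$4"
  shows "(q$2$4)\<^sup>2 \<le> q$2$2 * q$4$4"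
proof -
  define y :: "real^4" where "y = vector [0, q$4$4, 0, - q$2$4]"
  have y: "y$1 = 0" "y$2 = q$4$4" "y$3 = 0" "y$4 = - q$2$4" by (simp_all add: y_def vector_4)
  have "0 \<le> y \<bullet> (q *v y)" by (rule pos_def_nonneg[OF q])
  also have "\<dots> = q$4$4 * (q$2$2 * q$4$4 - (q$2$4)\<^sup>2)"
    by (simp add: inner_vec_def sum_4 matrix_vector_mult_def y pos_def_sym[OF q, of 4 2]
        power2_eq_square algebra_simps)
  finally show ?thesis using assms(2) by (simp add: zero_le_mult_iff)
qed

lemma mat_pow_conj:
  assumes "orthogonal_matrix U"
  shows "mat_pow A k = U ** mat_pow (transpose U ** A ** U) k ** transpose U"
proof -
  have U: "U ** transpose U = mat 1" using assms by (simp add: orthogonal_matrix_def)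
  have U': "Z ** U ** transpose U = Z" for Z
    by (simp add: matrix_mul_assoc[symmetric] U)
  show ?thesis by (induction k) (simp_all add: U U' matrix_mul_assoc)
qed

lemma alt_prod_conj:
  assumes "orthogonal_matrix U" "orthogonal_matrix V"
  shows "alt_prod A B C D k m d =
    U ** alt_prod (transpose U ** A ** U) (transpose U ** B ** V) (transpose V ** C ** V)
      (transpose V ** D ** U) k m d ** transpose U"
proof -
  have U: "U ** transpose U = mat 1" "V ** transpose V = mat 1"
    using assms by (simp_all add: orthogonal_matrix_def)
  have U': "Z ** U ** transpose U = Z" "Z ** V ** transpose V = Z" for Z
    by (simp_all add: matrix_mul_assoc[symmetric] U)
  show ?thesis
  proof (induction d)
    case 0
    show ?case by (simp add: mat_pow_conj[OF assms(1), of A])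
  next
    case (Suc d)
    show ?case
      by (simp add: Suc mat_pow_conj[OF assms(1), of A] mat_pow_conj[OF assms(2), of C]
          matrix_mul_assoc U')
  qed
qed

lemma trace_alt_prod_conj:
  assumes "orthogonal_matrix U" "orthogonal_matrix V"
  shows "trace (alt_prod A B C D k m d) =
    trace (alt_prod (transpose U ** A ** U) (transpose U ** B ** V) (transpose V ** C ** V)
      (transpose V ** D ** U) k m d)" (is "_ = trace ?X")
proof -
  have "trace (alt_prod A B C D k m d) = trace (transpose U ** (U ** ?X))"
    by (subst alt_prod_conj[OF assms]) (rule trace_mul_sym)
  also have "\<dots> = trace ?X"
    using assms(1) by (simp add: matrix_mul_assoc orthogonal_matrix)
  finally show ?thesis .
qed

text \<open>In the coordinates chosen by an admissible \<open>W\<close> the diagonal blocks are diagonal with ordered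
  entries, and the rotations cancel inside every trace. All trace computations below take place in
  this normal form, with \<open>A = diag(a1, a2)\<close>, \<open>C = diag(c1, c2)\<close>, \<open>B\<close> with rows \<open>(b1, b2)\<close> and
  \<open>(b3, b4)\<close>, and \<open>D = B\<^sup>t\<close>.\<close>
lemma admissible_normal_form:
  assumes sym: "transpose Q = Q" and adm: "admissible Q W v"
  defines "q \<equiv> conj_by W Q"
  shows "trace (alt_prod (block11 Q) (block12 Q) (block22 Q) (block21 Q) k m d) =
      trace (alt_prod (mat22 (q$1$1) 0 0 (q$2$2)) (mat22 (q$1$3) (q$1$4) (q$2$3) (q$2$4))
        (mat22 (q$3$3) 0 0 (q$4$4)) (mat22 (q$1$3) (q$2$3) (q$1$4) (q$2$4)) k m d)"
    and "trace (alt_prod (block22 Q) (block21 Q) (block11 Q) (block12 Q) k m d) =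
      trace (alt_prod (mat22 (q$3$3) 0 0 (q$4$4)) (mat22 (q$1$3) (q$2$3) (q$1$4) (q$2$4))
        (mat22 (q$1$1) 0 0 (q$2$2)) (mat22 (q$1$3) (q$1$4) (q$2$3) (q$2$4)) k m d)"
    and "top_eigenvector (mat22 (q$1$3 * q$1$3 + q$1$4 * q$1$4) (q$1$3 * q$2$3 + q$1$4 * q$2$4)
      (q$1$3 * q$2$3 + q$1$4 * q$2$4) (q$2$3 * q$2$3 + q$2$4 * q$2$4)) v"
    and "q$1$2 = 0" "q$2$1 = 0" "q$3$4 = 0" "q$4$3 = 0"
      "q$2$2 \<le> q$1$1" "0 < q$2$2" "q$4$4 \<le> q$3$3" "0 < q$4$4"
proof -
  have W: "signature22 W" and z: "q$1$2 = 0" "q$2$1 = 0" "q$3$4 = 0" "q$4$3 = 0"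
    and "q$2$2 \<le> q$1$1" "0 < q$2$2" "q$4$4 \<le> q$3$3" "0 < q$4$4"
    and top: "top_eigenvector (transpose (block11 W) ** block12 Q ** block21 Q ** block11 W) v"
    using adm by (auto simp: admissible_def Let_def q_def)
  then show "q$1$2 = 0" "q$2$1 = 0" "q$3$4 = 0" "q$4$3 = 0"
    "q$2$2 \<le> q$1$1" "0 < q$2$2" "q$4$4 \<le> q$3$3" "0 < q$4$4" by blast+
  have o: "orthogonal_matrix (block11 W)" "orthogonal_matrix (block22 W)"
    using W by (simp_all add: signature22_def)
  have s: "q$3$1 = q$1$3" "q$3$2 = q$2$3" "q$4$1 = q$1$4" "q$4$2 = q$2$4"
    unfolding q_def by (simp_all only: conj_by_sym[OF sym])
  note blocks = block_entries[of q, unfolded s z]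
  show "trace (alt_prod (block11 Q) (block12 Q) (block22 Q) (block21 Q) k m d) =
      trace (alt_prod (mat22 (q$1$1) 0 0 (q$2$2)) (mat22 (q$1$3) (q$1$4) (q$2$3) (q$2$4))
        (mat22 (q$3$3) 0 0 (q$4$4)) (mat22 (q$1$3) (q$2$3) (q$1$4) (q$2$4)) k m d)"
    unfolding blocks[symmetric] unfolding q_def block_conj_by[OF W] by (rule trace_alt_prod_conj[OF o])
  show "trace (alt_prod (block22 Q) (block21 Q) (block11 Q) (block12 Q) k m d) =
      trace (alt_prod (mat22 (q$3$3) 0 0 (q$4$4)) (mat22 (q$1$3) (q$2$3) (q$1$4) (q$2$4))
        (mat22 (q$1$1) 0 0 (q$2$2)) (mat22 (q$1$3) (q$1$4) (q$2$3) (q$2$4)) k m d)"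
    unfolding blocks[symmetric] unfolding q_def block_conj_by[OF W] by (rule trace_alt_prod_conj[OF o(2,1)])
  have V: "block22 W ** transpose (block22 W) = mat 1" using o(2) by (simp add: orthogonal_matrix_def)
  have "transpose (block11 W) ** block12 Q ** block21 Q ** block11 W =
      transpose (block11 W) ** block12 Q ** (block22 W ** transpose (block22 W)) ** block21 Q ** block11 W"
    unfolding V by simp
  also have "\<dots> = block12 q ** block21 q"
    unfolding q_def block_conj_by[OF W] by (simp only: matrix_mul_assoc)
  finally show "top_eigenvector (mat22 (q$1$3 * q$1$3 + q$1$4 * q$1$4) (q$1$3 * q$2$3 + q$1$4 * q$2$4)
      (q$1$3 * q$2$3 + q$1$4 * q$2$4) (q$2$3 * q$2$3 + q$2$4 * q$2$4)) v"
    using top unfolding blocks by (simp add: mult.commute)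
qed


section \<open>The sign condition and aligned blocks\<close>

text \<open>The first product is \<open>b1 b3 (B B\<^sup>t)\<^bsub>12\<^esub>\<close>, the second \<open>b1 b2 (B\<^sup>t B)\<^bsub>12\<^esub>\<close>. The off-diagonal entry of
  \<open>B C\<^sup>m B\<^sup>t\<close> is \<open>b1 b3 c1\<^sup>m + b2 b4 c2\<^sup>m\<close> with \<open>c1 \<ge> c2\<close>: it starts at \<open>(B B\<^sup>t)\<^bsub>12\<^esub>\<close> for \<open>m = 0\<close>, and
  the weight of \<open>b1 b3\<close> grows with \<open>m\<close>, so that the first disjunct keeps it from changing sign. The
  second disjunct does the same for \<open>B\<^sup>t A\<^sup>k B\<close>.\<close>
definition aligned :: "real \<Rightarrow> real \<Rightarrow> real \<Rightarrow> real \<Rightarrow> bool" where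
  "aligned b1 b2 b3 b4 \<longleftrightarrow> b1 * b3 * (b1 * b3 + b2 * b4) \<ge> 0 \<or> b1 * b2 * (b1 * b2 + b3 * b4) \<ge> 0"

lemma aligned_commute: "aligned b1 b3 b2 b4 \<longleftrightarrow> aligned b1 b2 b3 b4"
  by (auto simp: aligned_def)

lemma top_eigenvector_symmetric:
  assumes "top_eigenvector (mat22 g h h g') v"
  obtains l where "g * v$1 + h * v$2 = l * v$1" "h * v$1 + g' * v$2 = l * v$2"
    "g + g' \<le> 2 * l" "(l - g) * (l - g') = h\<^sup>2" "v$1 \<noteq> 0 \<or> v$2 \<noteq> 0"
    "g + g' = 2 * l \<Longrightarrow> v$1 = 1 \<and> v$2 = 0"
proof -
  let ?G = "mat22 g h h g'"
  obtain l where l: "?G *v v = l *\<^sub>R v" and max: "\<And>\<mu> w. w \<noteq> 0 \<Longrightarrow> ?G *v w = \<mu> *\<^sub>R w \<Longrightarrow> \<mu> \<le> l"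
    and v: "v \<noteq> 0" and e: "(\<exists>c. ?G = mat c) \<Longrightarrow> v = vector [1, 0]"
    using assms unfolding top_eigenvector_def by blast
  have v': "v$1 \<noteq> 0 \<or> v$2 \<noteq> 0" using v by (auto simp: vec_eq_iff forall_2)
  have 1: "g * v$1 + h * v$2 = l * v$1" "h * v$1 + g' * v$2 = l * v$2"
    using l by (auto simp: vec_eq_iff forall_2 matrix_vector_mult_def sum_2)
  \<comment> \<open>The orthogonal vector belongs to the other eigenvalue, which the trace determines.\<close>
  define w :: "real^2" where "w = vector [- v$2, v$1]"
  have w: "w$1 = - v$2" "w$2 = v$1" by (simp_all add: w_def)
  have "?G *v w = (g + g' - l) *\<^sub>R w"
    using 1 by (simp add: vec_eq_iff forall_2 matrix_vector_mult_def sum_2 w algebra_simps)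
  moreover have "w \<noteq> 0" using v' w by (auto simp: vec_eq_iff forall_2)
  ultimately have 2: "g + g' \<le> 2 * l" using max[of w "g + g' - l"] by simp
  have 3: "(l - g) * (l - g') = h\<^sup>2"
  proof -
    have "((l - g) * (l - g') - h\<^sup>2) * v$1 = 0" "((l - g) * (l - g') - h\<^sup>2) * v$2 = 0"
      using 1 by algebra+
    then show ?thesis using v' by auto
  qed
  have 4: "v$1 = 1 \<and> v$2 = 0" if "g + g' = 2 * l"
  proof -
    have "(l - g)\<^sup>2 + h\<^sup>2 = 0" using 3 that by algebra
    then have "l = g" "h = 0" by (simp_all add: sum_power2_eq_zero_iff)
    then have "?G = mat g" using that by (simp add: vec_eq_iff forall_2 mat_def)
    then have "v = vector [1, 0]" using e by blast
    then show ?thesis by simp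
  qed
  show ?thesis using that[OF 1 2 3 v' 4] .
qed

text \<open>If \<open>B\<close> is not aligned, then all four entries are nonzero, and the signs of \<open>(B B\<^sup>t)\<^bsub>12\<^esub>\<close> and
  \<open>(B\<^sup>t B)\<^bsub>12\<^esub>\<close> are forced. The eigenvector equation expresses \<open>v$2 / v$1\<close> through the largest
  eigenvalue, whereby the sign hypothesis becomes an upper bound for that eigenvalue; the bound
  fails because the characteristic polynomial is still negative there.\<close>
lemma eigenvector_sign_imp_aligned:
  assumes top: "top_eigenvector (mat22 (b1*b1 + b2*b2) (b1*b3 + b2*b4) (b1*b3 + b2*b4) (b3*b3 + b4*b4)) v"
    and sgn: "v$1 * b1 * (v$1 * b1 + v$2 * b3) \<ge> 0"
  shows "aligned b1 b2 b3 b4"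
proof (rule ccontr)
  assume "\<not> aligned b1 b2 b3 b4"
  define g where "g = b1*b1 + b2*b2"
  define h where "h = b1*b3 + b2*b4"
  define g' where "g' = b3*b3 + b4*b4"
  define h' where "h' = b1*b2 + b3*b4"
  have n1: "b1 * b3 * h < 0" and n2: "b1 * b2 * h' < 0"
    using \<open>\<not> aligned b1 b2 b3 b4\<close> by (auto simp: aligned_def h_def h'_def)
  obtain l where e1: "g * v$1 + h * v$2 = l * v$1" and e2: "h * v$1 + g' * v$2 = l * v$2"
    and tr: "g + g' \<le> 2 * l" and det: "(l - g) * (l - g') = h\<^sup>2" and nz: "v$1 \<noteq> 0 \<or> v$2 \<noteq> 0"
    using top_eigenvector_symmetric[OF top[folded g_def h_def g'_def]] by metis
  have nonz: "b1 \<noteq> 0" "b3 \<noteq> 0" "h \<noteq> 0" "b2 \<noteq> 0" "h' \<noteq> 0" using n1 n2 by auto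
  have hpos: "h\<^sup>2 > 0" using nonz by simp
  have lg: "l - g > 0" "l - g' > 0"
  proof -
    have "0 < (l - g) * (l - g')" using det hpos by simp
    then show "l - g > 0" "l - g' > 0" using tr by (auto simp: zero_less_mult_iff)
  qed
  have v1: "v$1 \<noteq> 0" using e1 nz nonz by auto
  have v2: "v$2 = (l - g) * v$1 / h" using e1 nonz by (simp add: field_simps)
  \<comment> \<open>The sign hypothesis reads \<open>l \<le> l0\<close>; the characteristic polynomial is negative at \<open>l0\<close>,
    which therefore lies strictly below the largest eigenvalue.\<close>
  define l0 where "l0 = g - b1 * h / b3"
  have "v$1 * b1 * (v$1 * b1 + v$2 * b3) = (v$1)\<^sup>2 * (b1\<^sup>2 + b1 * b3 * (l - g) / h)"
    using nonz by (simp add: v2 field_simps power2_eq_square)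
  then have "b1\<^sup>2 + b1 * b3 * (l - g) / h \<ge> 0"
    using sgn v1 by (simp add: zero_le_mult_iff)
  then have "0 \<le> (b1\<^sup>2 + b1 * b3 * (l - g) / h) * h\<^sup>2" by simp
  also have "\<dots> = b1\<^sup>2 * h\<^sup>2 + b1 * b3 * h * (l - g)"
    using nonz by (simp add: field_simps power2_eq_square)
  also have "\<dots> = b1 * b3 * h * (l - l0)"
    using nonz by (simp add: l0_def field_simps power2_eq_square)
  finally have "0 \<le> b1 * b3 * h * (l - l0)" .
  then have le: "l \<le> l0" using n1 mult_neg_pos[of "b1 * b3 * h" "l - l0"] by linarith
  have "((l0 - g) * (l0 - g') - h\<^sup>2) * b3\<^sup>2 = h * h' * (b1 * b4 - b2 * b3)"
  proof -
    have l0: "(l0 - g) * b3 = - b1 * h" using nonz by (simp add: l0_def)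
    have "((l0 - g) * (l0 - g') - h\<^sup>2) * b3\<^sup>2 = ((l0 - g) * b3) * ((l0 - g) * b3 + (g - g') * b3) - h\<^sup>2 * b3\<^sup>2"
      by (simp add: power2_eq_square algebra_simps)
    also have "\<dots> = h * h' * (b1 * b4 - b2 * b3)"
      unfolding l0 by (simp add: g_def g'_def h_def h'_def power2_eq_square algebra_simps)
    finally show ?thesis .
  qed
  moreover have "h * h' * (b1 * b4 - b2 * b3) < 0"
  proof -
    have x: "(b1*b3) * (b1*b3 + b2*b4) < 0" using n1 by (simp add: h_def)
    have "(b1*b3)*(b2*b4) < 0"
      using x zero_le_square[of "b1*b3"] unfolding distrib_left by linarith
    moreover have "(b2*b3) * (b1*b4 - b2*b3) = (b1*b3)*(b2*b4) - (b2*b3)*(b2*b3)"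
      by (simp add: algebra_simps)
    ultimately have X: "(b2*b3) * (b1*b4 - b2*b3) < 0"
      using zero_le_square[of "b2*b3"] by linarith
    have Y: "(h * h') * (b2 * b3) > 0"
    proof -
      have "0 < (b1 * b3 * h) * (b1 * b2 * h')" using n1 n2 by (rule mult_neg_neg)
      also have "\<dots> = b1\<^sup>2 * ((h * h') * (b2 * b3))" by (simp add: power2_eq_square)
      finally show ?thesis by (simp add: zero_less_mult_iff)
    qed
    have "((h * h') * (b2 * b3)) * ((b2*b3) * (b1*b4 - b2*b3)) < 0"
      using Y X by (rule mult_pos_neg)
    then have "(b2*b3)\<^sup>2 * (h * h' * (b1*b4 - b2*b3)) < 0"
      by (simp add: power2_eq_square mult_ac)
    then show ?thesis by (simp add: mult_less_0_iff)
  qed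
  ultimately have "((l0 - g) * (l0 - g') - h\<^sup>2) * b3\<^sup>2 < 0" by simp
  then have neg: "(l0 - g) * (l0 - g') < h\<^sup>2"
    by (simp add: mult_less_0_iff)
  have "(l - g) * (l - g') \<le> (l0 - g) * (l0 - g')"
    using lg le by (intro mult_mono) auto
  then show False using neg det by simp
qed

lemma sign_condition_aligned:
  assumes "transpose Q = Q" "admissible Q W v" "sign_condition Q W v"
  defines "q \<equiv> conj_by W Q"
  shows "aligned (q$1$3) (q$1$4) (q$2$3) (q$2$4)"
  using eigenvector_sign_imp_aligned[OF admissible_normal_form(3)[OF assms(1,2)]] assms(3)
  by (simp add: sign_condition_def Let_def q_def)


section \<open>Nonnegativity of all traces\<close>

lemma common_sign:
  assumes "x * (x + y) \<ge> (0::real)"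
  obtains s :: real where "s * s = 1" "s * x \<ge> 0" "s * (x + y) \<ge> 0"
proof (cases "x > 0 \<or> x = 0 \<and> y \<ge> 0")
  case True
  then show ?thesis using that[of 1] assms by (auto simp: zero_le_mult_iff)
next
  case False
  then have "x \<le> 0" "x + y \<le> 0" using assms by (auto simp: zero_le_mult_iff)
  then show ?thesis using that[of "-1"] by simp
qed

lemma common_sign_power_sum:
  assumes "x * (x + y) \<ge> (0::real)" "0 \<le> c'" "c' \<le> c"
  shows "\<exists>s::real. s * s = 1 \<and> (\<forall>k. s * (x * c ^ k + y * c' ^ k) \<ge> 0)"
proof -
  obtain s where s: "s * s = 1" "s * x \<ge> 0" "s * (x + y) \<ge> 0"
    using common_sign[OF assms(1)] .
  have "s * (x * c ^ k + y * c' ^ k) \<ge> 0" for k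
  proof -
    have "0 \<le> (s * x) * (c ^ k - c' ^ k) + (s * (x + y)) * c' ^ k"
      using assms by (intro add_nonneg_nonneg mult_nonneg_nonneg[OF s(2)] mult_nonneg_nonneg[OF s(3)])
        (auto intro: power_mono)
    then show ?thesis by (simp add: algebra_simps)
  qed
  with s show ?thesis by blast
qed

text \<open>For \<open>s = 1\<close> or \<open>s = -1\<close>: flipping the second basis vector when \<open>s = -1\<close> makes the matrix entrywise
  nonnegative.\<close>
definition sign_pattern :: "real \<Rightarrow> real^2^2 \<Rightarrow> bool" where
  "sign_pattern s X \<longleftrightarrow> X$1$1 \<ge> 0 \<and> X$2$2 \<ge> 0 \<and> s * X$1$2 \<ge> 0 \<and> s * X$2$1 \<ge> 0"

lemma sign_pattern_mult:
  assumes "s * s = 1" "sign_pattern s X" "sign_pattern s Y"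
  shows "sign_pattern s (X ** Y)"
proof -
  have nn: "X$1$1 \<ge> 0" "X$2$2 \<ge> 0" "s * X$1$2 \<ge> 0" "s * X$2$1 \<ge> 0"
    "Y$1$1 \<ge> 0" "Y$2$2 \<ge> 0" "s * Y$1$2 \<ge> 0" "s * Y$2$1 \<ge> 0"
    using assms(2,3) by (simp_all add: sign_pattern_def)
  have off: "(s * x) * (s * y) = x * y" for x y
    using assms(1) by (metis mult.assoc mult.left_commute mult_1)
  have "0 \<le> X$1$1 * Y$1$1 + (s * X$1$2) * (s * Y$2$1)" "0 \<le> (s * X$2$1) * (s * Y$1$2) + X$2$2 * Y$2$2"
    "0 \<le> X$1$1 * (s * Y$1$2) + (s * X$1$2) * Y$2$2" "0 \<le> (s * X$2$1) * Y$1$1 + X$2$2 * (s * Y$2$1)"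
    using nn by (simp_all only: add_nonneg_nonneg mult_nonneg_nonneg)
  then show ?thesis
    unfolding off by (simp add: sign_pattern_def matrix_matrix_mult_def sum_2 algebra_simps)
qed

text \<open>For the first disjunct of alignment, the word is a product of diagonal factors \<open>A\<^sup>k\<close> and factors
  \<open>B C\<^sup>m D\<close>, which share one sign pattern. For the second disjunct, the word is rotated cyclically and
  regrouped into factors \<open>C\<^sup>m\<close> and \<open>D A\<^sup>k B\<close>.\<close>
lemma aligned_traces_nonneg:
  assumes a: "0 \<le> a2" "a2 \<le> a1" and c: "0 \<le> c2" "c2 \<le> c1" and al: "aligned b1 b2 b3 b4"
  shows "0 \<le> trace (alt_prod (mat22 a1 0 0 a2) (mat22 b1 b2 b3 b4) (mat22 c1 0 0 c2)
    (mat22 b1 b3 b2 b4) k m d)"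
proof -
  define A B C D where "A = mat22 a1 0 0 a2" and "B = mat22 b1 b2 b3 b4"
    and "C = mat22 c1 0 0 c2" and "D = mat22 b1 b3 b2 b4"
  note ABCD = A_def B_def C_def D_def
  have sA: "sign_pattern s (mat_pow A k)" and sC: "sign_pattern s (mat_pow C k)" for s k
    using a c by (simp_all add: ABCD sign_pattern_def)
  have tr: "trace X \<ge> 0" if "sign_pattern s X" for s X
    using that by (simp add: sign_pattern_def trace_def sum_2)
  consider (left) "(b1*b3) * (b1*b3 + b2*b4) \<ge> 0" | (right) "(b1*b2) * (b1*b2 + b3*b4) \<ge> 0"
    using al by (auto simp: aligned_def)
  then have "0 \<le> trace (alt_prod A B C D k m d)"
  proof cases
    case left
    obtain s where s: "s * s = 1" "\<And>k. s * (b1*b3 * c1 ^ k + b2*b4 * c2 ^ k) \<ge> 0"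
      using common_sign_power_sum[OF left c] by blast
    have M: "sign_pattern s (B ** mat_pow C k ** D)" for k
    proof -
      have "B ** mat_pow C k ** D = mat22 (b1*b1 * c1^k + b2*b2 * c2^k) (b1*b3 * c1^k + b2*b4 * c2^k)
          (b1*b3 * c1^k + b2*b4 * c2^k) (b3*b3 * c1^k + b4*b4 * c2^k)"
        by (simp add: ABCD mult_ac)
      then show ?thesis using c s(2)[of k] by (simp add: sign_pattern_def)
    qed
    have "sign_pattern s (alt_prod A B C D k m d)"
    proof (induction d)
      case (Suc d)
      have "alt_prod A B C D k m (Suc d) =
        alt_prod A B C D k m d ** (B ** mat_pow C (m d) ** D) ** mat_pow A (k (Suc d))"
        by (simp add: matrix_mul_assoc)
      then show ?case using Suc M sA s(1) by (simp add: sign_pattern_mult)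
    qed (simp add: sA)
    then show ?thesis by (rule tr)
  next
    case right
    obtain s where s: "s * s = 1" "\<And>k. s * (b1*b2 * a1 ^ k + b3*b4 * a2 ^ k) \<ge> 0"
      using common_sign_power_sum[OF right a] by blast
    have M: "sign_pattern s (D ** mat_pow A k ** B)" for k
    proof -
      have "D ** mat_pow A k ** B = mat22 (b1*b1 * a1^k + b3*b3 * a2^k) (b1*b2 * a1^k + b3*b4 * a2^k)
          (b1*b2 * a1^k + b3*b4 * a2^k) (b2*b2 * a1^k + b4*b4 * a2^k)"
        by (simp add: ABCD mult_ac)
      then show ?thesis using a s(2)[of k] by (simp add: sign_pattern_def)
    qed
    show ?thesis
    proof (cases d)
      case 0
      then show ?thesis using tr[OF sA] by simp
    next
      case (Suc e)
      \<comment> \<open>Isolating the powers of \<open>A\<close> at both ends leaves a word in \<open>C\<close> and the blocks \<open>D A\<^sup>k B\<close>; the ends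
        are joined under the trace.\<close>
      have "\<exists>X. sign_pattern s X \<and>
          alt_prod A B C D k m (Suc e) = mat_pow A (k 0) ** B ** X ** D ** mat_pow A (k (Suc e))"
      proof (induction e)
        case 0
        show ?case using sC by (intro exI[of _ "mat_pow C (m 0)"]) simp
      next
        case (Suc e)
        then obtain X where X: "sign_pattern s X"
          "alt_prod A B C D k m (Suc e) = mat_pow A (k 0) ** B ** X ** D ** mat_pow A (k (Suc e))"
          by blast
        let ?Y = "X ** (D ** mat_pow A (k (Suc e)) ** B) ** mat_pow C (m (Suc e))"
        have "sign_pattern s ?Y" using X M sC s(1) by (simp add: sign_pattern_mult)
        moreover have "alt_prod A B C D k m (Suc (Suc e)) =
            mat_pow A (k 0) ** B ** ?Y ** D ** mat_pow A (k (Suc (Suc e)))"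
          by (subst alt_prod.simps(2), subst X(2)) (simp add: matrix_mul_assoc)
        ultimately show ?case by blast
      qed
      then obtain X where X: "sign_pattern s X"
        "alt_prod A B C D k m d = mat_pow A (k 0) ** (B ** X ** D ** mat_pow A (k d))"
        unfolding Suc by (auto simp: matrix_mul_assoc)
      have "trace (alt_prod A B C D k m d) = trace ((B ** X ** D ** mat_pow A (k d)) ** mat_pow A (k 0))"
        unfolding X(2) by (rule trace_mul_sym)
      also have "\<dots> = trace (B ** (X ** (D ** mat_pow A (k d + k 0))))"
        by (simp add: mat_pow_add matrix_mul_assoc)
      also have "\<dots> = trace (X ** (D ** mat_pow A (k d + k 0) ** B))"
        by (subst trace_mul_sym) (simp add: matrix_mul_assoc)
      also have "\<dots> \<ge> 0" using X(1) M s(1) by (intro tr[of s]) (simp add: sign_pattern_mult)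
      finally show ?thesis .
    qed
  qed
  then show ?thesis by (simp add: ABCD)
qed

lemma sign_condition_traces_nonneg:
  assumes "transpose Q = Q" "admissible Q W v" "sign_condition Q W v"
  shows "0 \<le> trace (alt_prod (block11 Q) (block12 Q) (block22 Q) (block21 Q) k m d)"
    and "0 \<le> trace (alt_prod (block22 Q) (block21 Q) (block11 Q) (block12 Q) k m d)"
proof -
  note nf = admissible_normal_form[OF assms(1,2)]
  note al = sign_condition_aligned[OF assms]
  show "0 \<le> trace (alt_prod (block11 Q) (block12 Q) (block22 Q) (block21 Q) k m d)"
    unfolding nf(1) using nf(8-11) al by (intro aligned_traces_nonneg) auto
  show "0 \<le> trace (alt_prod (block22 Q) (block21 Q) (block11 Q) (block12 Q) k m d)"
    unfolding nf(2) using nf(8-11) al by (intro aligned_traces_nonneg) (auto simp: aligned_commute)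
qed

text \<open>This is the spectral decomposition of the power, applied to the first basis vector and
  multiplied by \<open>v1\<^sup>2 + v2\<^sup>2\<close> because the eigenvector need not be normalised.\<close>
lemma symmetric_power_column:
  fixes v1 v2 :: real
  assumes e: "g * v1 + h * v2 = l * v1" "h * v1 + g' * v2 = l * v2"
  defines "P \<equiv> mat_pow (mat22 g h h g')" and "l' \<equiv> g + g' - l"
  shows "(v1\<^sup>2 + v2\<^sup>2) * P j $ 1 $ 1 = l ^ j * v1\<^sup>2 + l' ^ j * v2\<^sup>2"
    and "(v1\<^sup>2 + v2\<^sup>2) * P j $ 2 $ 1 = (l ^ j - l' ^ j) * (v1 * v2)"
proof -
  have e': "g * v2 - h * v1 = l' * v2" "g' * v1 - h * v2 = l' * v1"
    using e by (simp_all add: l'_def algebra_simps)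
  have "(v1\<^sup>2 + v2\<^sup>2) * P j $ 1 $ 1 = l ^ j * v1\<^sup>2 + l' ^ j * v2\<^sup>2 \<and>
    (v1\<^sup>2 + v2\<^sup>2) * P j $ 2 $ 1 = (l ^ j - l' ^ j) * (v1 * v2)"
  proof (induction j)
    case 0
    show ?case by (simp add: P_def mat_1_mat22)
  next
    case (Suc j)
    have P: "P (Suc j) $ 1 $ 1 = g * P j $ 1 $ 1 + h * P j $ 2 $ 1"
      "P (Suc j) $ 2 $ 1 = h * P j $ 1 $ 1 + g' * P j $ 2 $ 1"
      by (simp_all add: P_def matrix_matrix_mult_def sum_2)
    let ?N = "v1\<^sup>2 + v2\<^sup>2" and ?p = "P j $ 1 $ 1" and ?r = "P j $ 2 $ 1"
    have "?N * P (Suc j) $ 1 $ 1 = g * (?N * ?p) + h * (?N * ?r)"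
      by (simp add: P algebra_simps)
    also have "\<dots> = l ^ j * v1 * (g * v1 + h * v2) + l' ^ j * v2 * (g * v2 - h * v1)"
      unfolding Suc[THEN conjunct1] Suc[THEN conjunct2] by (simp add: power2_eq_square algebra_simps)
    also have "\<dots> = l ^ Suc j * v1\<^sup>2 + l' ^ Suc j * v2\<^sup>2"
      unfolding e e' by (simp add: power2_eq_square)
    finally have 1: "?N * P (Suc j) $ 1 $ 1 = l ^ Suc j * v1\<^sup>2 + l' ^ Suc j * v2\<^sup>2" .
    have "?N * P (Suc j) $ 2 $ 1 = h * (?N * ?p) + g' * (?N * ?r)"
      by (simp add: P algebra_simps)
    also have "\<dots> = l ^ j * v1 * (h * v1 + g' * v2) - l' ^ j * v2 * (g' * v1 - h * v2)"
      unfolding Suc[THEN conjunct1] Suc[THEN conjunct2] by (simp add: power2_eq_square algebra_simps)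
    also have "\<dots> = (l ^ Suc j - l' ^ Suc j) * (v1 * v2)"
      unfolding e e' by (simp add: algebra_simps)
    finally show ?case using 1 by blast
  qed
  then show "(v1\<^sup>2 + v2\<^sup>2) * P j $ 1 $ 1 = l ^ j * v1\<^sup>2 + l' ^ j * v2\<^sup>2"
    "(v1\<^sup>2 + v2\<^sup>2) * P j $ 2 $ 1 = (l ^ j - l' ^ j) * (v1 * v2)" by blast+
qed

lemma alt_prod_spike:
  "alt_prod A B C D (\<lambda>i. if i = 0 then n else 0) (\<lambda>i. if i = 0 then n else 0) (Suc j) =
    mat_pow A n ** B ** mat_pow C n ** D ** mat_pow (B ** D) j"
proof (induction j)
  case (Suc j)
  have "mat_pow (B ** D) (Suc j) = mat_pow (B ** D) j ** (B ** D)"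
    using mat_pow_add[of "B ** D" j 1] by simp
  with Suc show ?case by (simp add: matrix_mul_assoc)
qed simp

lemma nonneg_leading_coefficient:
  fixes p r x y :: real
  assumes nn: "\<And>j::nat. 0 \<le> p * x ^ j + r * y ^ j" and xy: "0 \<le> y" "y < x"
  shows "0 \<le> p"
proof -
  have "(\<lambda>j. p + r * (y / x) ^ j) \<longlonglongrightarrow> p + r * 0"
    using xy by (intro tendsto_intros LIMSEQ_power_zero) simp
  moreover have "0 \<le> p + r * (y / x) ^ j" for j
  proof -
    have "0 \<le> (p * x ^ j + r * y ^ j) / x ^ j" using nn[of j] xy by simp
    also have "\<dots> = p + r * (y / x) ^ j" using xy by (simp add: power_divide add_divide_distrib)
    finally show ?thesis .
  qed
  ultimately have "0 \<le> p + r * 0" by (intro LIMSEQ_le_const) blast+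
  then show ?thesis by simp
qed

text \<open>In the words \<open>A\<^sup>n B C\<^sup>n D (B D)\<^sup>j\<close> the limit \<open>n \<rightarrow> \<infinity>\<close> isolates the entry \<open>(1,1)\<close> of \<open>B\<close> and of
  \<open>D (B D)\<^sup>j\<close>, and then \<open>j \<rightarrow> \<infinity>\<close> isolates the top eigenvector of \<open>B D\<close>; what remains is the sign
  condition. If \<open>B D\<close> is a multiple of the identity, the eigenvector is \<open>(1, 0)\<close> by convention and the
  condition is trivial.\<close>
lemma traces_nonneg_imp_eigenvector_sign:
  assumes a: "0 < a2" "a2 < a1" and c: "0 < c2" "c2 < c1"
    and nn: "\<And>d k m. 0 \<le> trace (alt_prod (mat22 a1 0 0 a2) (mat22 b1 b2 b3 b4)
      (mat22 c1 0 0 c2) (mat22 b1 b3 b2 b4) k m d)"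
    and top: "top_eigenvector (mat22 (b1*b1 + b2*b2) (b1*b3 + b2*b4) (b1*b3 + b2*b4) (b3*b3 + b4*b4)) v"
  shows "v$1 * b1 * (v$1 * b1 + v$2 * b3) \<ge> 0"
proof -
  define g h g' where "g = b1*b1 + b2*b2" and "h = b1*b3 + b2*b4" and "g' = b3*b3 + b4*b4"
  define P where "P = mat_pow (mat22 g h h g')"
  obtain l where e: "g * v$1 + h * v$2 = l * v$1" "h * v$1 + g' * v$2 = l * v$2"
    and tr: "g + g' \<le> 2 * l" and det: "(l - g) * (l - g') = h\<^sup>2" and nz: "v$1 \<noteq> 0 \<or> v$2 \<noteq> 0"
    and scalar: "g + g' = 2 * l \<Longrightarrow> v$1 = 1 \<and> v$2 = 0"
    using top_eigenvector_symmetric[OF top[folded g_def h_def g'_def]] by metis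
  define l' where "l' = g + g' - l"
  \<comment> \<open>\<open>n \<rightarrow> \<infinity>\<close> in the spiked words: only the leading entries of \<open>A ^ n\<close> and \<open>C ^ n\<close> survive.\<close>
  have lead: "0 \<le> b1 * (b1 * P j $ 1 $ 1 + b3 * P j $ 2 $ 1)" for j
  proof -
    define E where "E = mat22 b1 b3 b2 b4 ** P j"
    have "mat22 b1 b2 b3 b4 ** mat22 b1 b3 b2 b4 = mat22 g h h g'"
      by (simp add: g_def h_def g'_def mult.commute)
    then have nn': "0 \<le> trace (mat_pow (mat22 a1 0 0 a2) n ** mat22 b1 b2 b3 b4 **
        mat_pow (mat22 c1 0 0 c2) n ** E)" for n
      using nn[of "\<lambda>i. if i = 0 then n else 0" "\<lambda>i. if i = 0 then n else 0" "Suc j"]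
      unfolding alt_prod_spike by (simp only: E_def P_def matrix_mul_assoc)
    have tr: "trace (mat_pow (mat22 a1 0 0 a2) n ** mat22 b1 b2 b3 b4 ** mat_pow (mat22 c1 0 0 c2) n ** E) =
        a1^n * c1^n * b1 * E$1$1 + a1^n * c2^n * b2 * E$2$1 + a2^n * c1^n * b3 * E$1$2
          + a2^n * c2^n * b4 * E$2$2" for n
      by (simp add: trace_def sum_2 matrix_matrix_mult_def[of _ E] algebra_simps)
    have "0 \<le> b1 * E$1$1 + (c2/c1)^n * b2 * E$2$1 + (a2/a1)^n * b3 * E$1$2
        + (a2/a1)^n * (c2/c1)^n * b4 * E$2$2" for n
    proof -
      have "0 \<le> (a1^n * c1^n * b1 * E$1$1 + a1^n * c2^n * b2 * E$2$1 + a2^n * c1^n * b3 * E$1$2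
          + a2^n * c2^n * b4 * E$2$2) / (a1^n * c1^n)"
        using nn'[of n] a c unfolding tr by simp
      also have "\<dots> = b1 * E$1$1 + (c2/c1)^n * b2 * E$2$1 + (a2/a1)^n * b3 * E$1$2
          + (a2/a1)^n * (c2/c1)^n * b4 * E$2$2"
        using a c by (simp add: field_simps)
      finally show ?thesis .
    qed
    moreover have "(\<lambda>n. b1 * E$1$1 + (c2/c1)^n * b2 * E$2$1 + (a2/a1)^n * b3 * E$1$2
        + (a2/a1)^n * (c2/c1)^n * b4 * E$2$2) \<longlonglongrightarrow>
        b1 * E$1$1 + 0 * b2 * E$2$1 + 0 * b3 * E$1$2 + 0 * 0 * b4 * E$2$2"
      using a c by (intro tendsto_intros LIMSEQ_power_zero) simp_all
    ultimately have "0 \<le> b1 * E$1$1 + 0 * b2 * E$2$1 + 0 * b3 * E$1$2 + 0 * 0 * b4 * E$2$2"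
      by (intro LIMSEQ_le_const) blast+
    then show ?thesis by (simp add: E_def matrix_matrix_mult_def sum_2)
  qed
  show ?thesis
  proof (cases "g + g' = 2 * l")
    case True
    then show ?thesis using scalar by simp
  next
    case False
    have "0 \<le> g + g'" by (simp add: g_def g'_def)
    \<comment> \<open>The eigenvalues of \<open>B B\<^sup>t\<close> have nonnegative sum and product, hence are nonnegative.\<close>
    have "l * l' = (b1*b4 - b2*b3)\<^sup>2"
      using det by (simp add: l'_def g_def h_def g'_def power2_eq_square algebra_simps)
    then have "0 \<le> l * l'" by simp
    then have l': "0 \<le> l'" "l' < l"
      using tr False \<open>0 \<le> g + g'\<close> by (auto simp: l'_def zero_le_mult_iff)
    have "0 \<le> (b1 * (b1 * v$1 + b3 * v$2) * v$1) * l ^ j + (b1 * (b1 * v$2 - b3 * v$1) * v$2) * l' ^ j" for j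
    proof -
      have "0 \<le> ((v$1)\<^sup>2 + (v$2)\<^sup>2) * (b1 * (b1 * P j $ 1 $ 1 + b3 * P j $ 2 $ 1))"
        using lead by simp
      also have "\<dots> = b1 * (b1 * (((v$1)\<^sup>2 + (v$2)\<^sup>2) * P j $ 1 $ 1)
          + b3 * (((v$1)\<^sup>2 + (v$2)\<^sup>2) * P j $ 2 $ 1))"
        by (simp only: algebra_simps)
      also have "\<dots> = (b1 * (b1 * v$1 + b3 * v$2) * v$1) * l ^ j
          + (b1 * (b1 * v$2 - b3 * v$1) * v$2) * l' ^ j"
        unfolding P_def symmetric_power_column[OF e] l'_def[symmetric]
        by (simp add: power2_eq_square algebra_simps)
      finally show ?thesis .
    qed
    from nonneg_leading_coefficient[OF this l'] show ?thesis by (simp add: mult_ac)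
  qed
qed

text \<open>When a diagonal block is a multiple of the identity, the limit argument is not available, but
  then admissibility itself contains the sign condition.\<close>
theorem traces_nonneg_iff_sign_condition:
  assumes "transpose Q = Q" "admissible Q W v"
  shows "(\<forall>d k m. 0 \<le> trace (alt_prod (block11 Q) (block12 Q) (block22 Q) (block21 Q) k m d))
    \<longleftrightarrow> sign_condition Q W v" (is "?L \<longleftrightarrow> ?R")
proof
  assume ?L
  define q where "q = conj_by W Q"
  note nf = admissible_normal_form[OF assms, folded q_def]
  show ?R
  proof (cases "q$1$1 = q$2$2 \<or> q$3$3 = q$4$4")
    case True
    then show ?thesis using assms(2) by (auto simp: admissible_def Let_def q_def)
  next
    case False
    have "v$1 * q$1$3 * (v$1 * q$1$3 + v$2 * q$2$3) \<ge> 0"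
    proof (rule traces_nonneg_imp_eigenvector_sign[OF _ _ _ _ _ nf(3)])
      show "0 \<le> trace (alt_prod (mat22 (q$1$1) 0 0 (q$2$2)) (mat22 (q$1$3) (q$1$4) (q$2$3) (q$2$4))
        (mat22 (q$3$3) 0 0 (q$4$4)) (mat22 (q$1$3) (q$2$3) (q$1$4) (q$2$4)) k m d)" for k m d
        unfolding nf(1)[symmetric] using \<open>?L\<close> by blast
    qed (use nf(8-11) False in auto)
    then show ?thesis by (simp add: sign_condition_def q_def Let_def)
  qed
qed (use sign_condition_traces_nonneg(1)[OF assms] in blast)


section \<open>Trace sums of low order\<close>

text \<open>The exponent tuples as explicit lists, so that trace sums of small order can be evaluated by
  rewriting.\<close>
primrec compositions :: "nat \<Rightarrow> nat \<Rightarrow> nat list list" where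
  "compositions 0 s = (if s = 0 then [[]] else [])"
| "compositions (Suc n) s = concat (map (\<lambda>i. map ((#) i) (compositions n (s - i))) [0..<Suc s])"

lemma set_compositions: "set (compositions n s) = {xs. length xs = n \<and> sum_list xs = s}"
proof (induction n arbitrary: s)
  case (Suc n)
  show ?case
  proof (intro equalityI subsetI)
    fix xs assume "xs \<in> {xs. length xs = Suc n \<and> sum_list xs = s}"
    then obtain y ys where "xs = y # ys" "length ys = n" "y + sum_list ys = s"
      by (cases xs) auto
    then show "xs \<in> set (compositions (Suc n) s)"
      by (auto simp: Suc simp del: upt_Suc intro!: bexI[of _ y])
  qed (auto simp: Suc simp del: upt_Suc)
qed auto

lemma distinct_compositions: "distinct (compositions n s)"
proof (induction n arbitrary: s)
  case (Suc n)
  have "distinct (concat (map (\<lambda>i. map ((#) i) (compositions n (s - i))) xs))" if "distinct xs" for xs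
    using that by (induction xs) (auto simp: distinct_map Suc)
  then show ?case by (simp del: upt_Suc)
qed auto

lemma trace_sum_compositions:
  "trace_sum A B C D k m = (\<Sum>d\<leftarrow>[0..<Suc (min k m)]. \<Sum>ks\<leftarrow>compositions (Suc d) (k - d).
     \<Sum>ms\<leftarrow>compositions d (m - d). trace (alt_prod A B C D ((!) ks) ((!) ms) d))"
proof -
  have *: "exponents k m = (SIGMA d:{0..<Suc (min k m)}.
      set (compositions (Suc d) (k - d)) \<times> set (compositions d (m - d)))"
    by (auto simp: exponents_def set_compositions simp del: compositions.simps upt_Suc)
  show ?thesis
    unfolding trace_sum_def *
    by (subst sum.Sigma[symmetric])
      (auto simp: sum.cartesian_product[symmetric] interv_sum_list_conv_sum_set_nat
        sum_list_distinct_conv_sum_set distinct_compositions simp del: compositions.simps upt_Suc)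
qed

text \<open>Such a word has at most two crossings from one block to the other and back, and if it has two, then
  all exponents of one kind vanish. Each trace is then visibly a sum of squares with nonnegative
  coefficients.\<close>
lemma few_crossings_trace_nonneg:
  assumes nn: "0 \<le> a1" "0 \<le> a2" "0 \<le> c1" "0 \<le> c2" and km: "k \<le> 2 \<or> m \<le> 2"
    and e: "(d, ks, ms) \<in> exponents k m"
  shows "0 \<le> trace (alt_prod (mat22 a1 0 0 a2) (mat22 b1 b2 b3 b4) (mat22 c1 0 0 c2)
    (mat22 b1 b3 b2 b4) ((!) ks) ((!) ms) d)"
proof -
  have len: "length ks = Suc d" "length ms = d" "sum_list ks + d = k" "sum_list ms + d = m"
    using e by (auto simp: exponents_def)
  then have "d \<le> 2" using km by auto
  then consider "d = 0" | "d = 1" | (two) "d = 2" by linarith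
  then show ?thesis
  proof cases
    case two
    then have "sum_list ks = 0 \<or> sum_list ms = 0" using km len by auto
    then consider "ks ! 0 = 0" "ks ! 1 = 0" "ks ! 2 = 0" | "ms ! 0 = 0" "ms ! 1 = 0"
      using len two by (auto simp: sum_list_eq_0_iff)
    then show ?thesis
    proof cases
      case 1
      have "trace (alt_prod (mat22 a1 0 0 a2) (mat22 b1 b2 b3 b4) (mat22 c1 0 0 c2)
          (mat22 b1 b3 b2 b4) ((!) ks) ((!) ms) d) =
        c1 ^ (ms!1) * c1 ^ (ms!0) * (b1*b1 + b3*b3)\<^sup>2 + c2 ^ (ms!1) * c2 ^ (ms!0) * (b2*b2 + b4*b4)\<^sup>2
        + (c1 ^ (ms!1) * c2 ^ (ms!0) + c2 ^ (ms!1) * c1 ^ (ms!0)) * (b1*b2 + b3*b4)\<^sup>2"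
        using 1 two by (simp add: numeral_2_eq_2) (simp add: power2_eq_square algebra_simps)
      also have "\<dots> \<ge> 0" using nn by simp
      finally show ?thesis .
    next
      case 2
      have "trace (alt_prod (mat22 a1 0 0 a2) (mat22 b1 b2 b3 b4) (mat22 c1 0 0 c2)
          (mat22 b1 b3 b2 b4) ((!) ks) ((!) ms) d) =
        (a1 ^ (ks!0) * a1 ^ (ks!1) * a1 ^ (ks!2)) * (b1*b1 + b2*b2)\<^sup>2
        + (a2 ^ (ks!0) * a2 ^ (ks!1) * a2 ^ (ks!2)) * (b3*b3 + b4*b4)\<^sup>2
        + (a1 ^ (ks!0) * a1 ^ (ks!2) * a2 ^ (ks!1) + a2 ^ (ks!0) * a2 ^ (ks!2) * a1 ^ (ks!1)) * (b1*b3 + b2*b4)\<^sup>2"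
        using 2 two by (simp add: numeral_2_eq_2) (simp add: power2_eq_square algebra_simps)
      also have "\<dots> \<ge> 0" using nn by simp
      finally show ?thesis .
    qed
  next
    case 2
    have "trace (alt_prod (mat22 a1 0 0 a2) (mat22 b1 b2 b3 b4) (mat22 c1 0 0 c2)
        (mat22 b1 b3 b2 b4) ((!) ks) ((!) ms) d) =
      a1 ^ (ks!0) * a1 ^ (ks!1) * (c1 ^ (ms!0) * b1\<^sup>2 + c2 ^ (ms!0) * b2\<^sup>2)
      + a2 ^ (ks!0) * a2 ^ (ks!1) * (c1 ^ (ms!0) * b3\<^sup>2 + c2 ^ (ms!0) * b4\<^sup>2)"
      using 2 by simp (simp add: power2_eq_square algebra_simps)
    also have "\<dots> \<ge> 0" using nn by simp
    finally show ?thesis .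
  qed (use nn in simp)
qed

lemma opposite_dominated:
  assumes "p * (p + q) < (0::real)" shows "p * q < 0" "- (q\<^sup>2) \<le> p * q"
proof -
  show "p * q < 0" using assms zero_le_square[of p] unfolding distrib_left by linarith
  have "0 \<le> (p + q)\<^sup>2" by simp
  also have "\<dots> = p * (p + q) + (p * q + q\<^sup>2)" by (simp add: power2_eq_square algebra_simps)
  finally show "- (q\<^sup>2) \<le> p * q" using assms by linarith
qed

text \<open>The numbers \<open>r1, \<dots>, r4\<close> are the entries of \<open>B B\<^sup>t B\<close>. In the misaligned case
  \<open>b1 b2 b3 b4 < 0\<close> while \<open>\<bar>b1 b3\<bar> < \<bar>b2 b4\<bar>\<close> and \<open>\<bar>b1 b2\<bar> < \<bar>b3 b4\<bar>\<close>. Hence \<open>B\<close> and \<open>B B\<^sup>t B\<close> can have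
  opposite signs only at the entry \<open>(1,1)\<close>, and there the size of the latter is controlled.\<close>
lemma misaligned_estimates:
  assumes "\<not> aligned b1 b2 b3 b4"
  defines "r1 \<equiv> b1 * (b1\<^sup>2 + b2\<^sup>2 + b3\<^sup>2) + b2 * b3 * b4"
    and "r2 \<equiv> b2 * (b1\<^sup>2 + b2\<^sup>2 + b4\<^sup>2) + b1 * b3 * b4"
    and "r3 \<equiv> b3 * (b1\<^sup>2 + b3\<^sup>2 + b4\<^sup>2) + b1 * b2 * b4"
    and "r4 \<equiv> b4 * (b2\<^sup>2 + b3\<^sup>2 + b4\<^sup>2) + b1 * b2 * b3"
  shows "b2 ^ 4 \<le> b2 * r2" "b3 ^ 4 \<le> b3 * r3" "0 \<le> b4 * r4"
    "0 \<le> b1 * r1 \<or> r1\<^sup>2 \<le> (b2 * b3 * b4)\<^sup>2"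
proof -
  define e where "e = b1 * b2 * b3 * b4"
  have "(b1*b3) * (b1*b3 + b2*b4) < 0" "(b1*b2) * (b1*b2 + b3*b4) < 0"
    using assms(1) by (auto simp: aligned_def)
  from opposite_dominated[OF this(1)] opposite_dominated[OF this(2)]
  have e: "e < 0" "- (b2\<^sup>2 * b4\<^sup>2) \<le> e" "- (b3\<^sup>2 * b4\<^sup>2) \<le> e"
    by (simp_all add: e_def mult_ac power_mult_distrib)
  have "b2 * r2 = b2 ^ 4 + b1\<^sup>2 * b2\<^sup>2 + (b2\<^sup>2 * b4\<^sup>2 + e)"
    by (simp add: r2_def e_def power2_eq_square power4_eq_xxxx algebra_simps)
  then show "b2 ^ 4 \<le> b2 * r2" using e by simp
  have "b3 * r3 = b3 ^ 4 + b1\<^sup>2 * b3\<^sup>2 + (b3\<^sup>2 * b4\<^sup>2 + e)"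
    by (simp add: r3_def e_def power2_eq_square power4_eq_xxxx algebra_simps)
  then show "b3 ^ 4 \<le> b3 * r3" using e by simp
  have "b4 * r4 = b4 ^ 4 + b3\<^sup>2 * b4\<^sup>2 + (b2\<^sup>2 * b4\<^sup>2 + e)"
    by (simp add: r4_def e_def power2_eq_square power4_eq_xxxx algebra_simps)
  then show "0 \<le> b4 * r4" using e by simp
  show "0 \<le> b1 * r1 \<or> r1\<^sup>2 \<le> (b2 * b3 * b4)\<^sup>2"
  proof (cases "0 \<le> b1 * r1")
    case False
    have "r1\<^sup>2 = (b2 * b3 * b4)\<^sup>2 + (b1\<^sup>2 + b2\<^sup>2 + b3\<^sup>2) * (e + b1 * r1)"
      by (simp add: r1_def e_def power2_eq_square algebra_simps)
    also have "\<dots> \<le> (b2 * b3 * b4)\<^sup>2"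
      using False e by (simp add: mult_nonneg_nonpos)
    finally show ?thesis ..
  qed simp
qed

text \<open>With \<open>P = A B C\<close> and \<open>R = B B\<^sup>t B\<close> this is \<open>3 \<bar>P\<bar>\<^sup>2 + 6 \<langle>P, R\<rangle> + \<bar>R\<bar>\<^sup>2\<close> for the Frobenius inner product.\<close>
lemma trace_sum_3_3:
  "trace_sum (mat22 a1 0 0 a2) (mat22 b1 b2 b3 b4) (mat22 c1 0 0 c2) (mat22 b1 b3 b2 b4) 3 3 =
    3 * ((a1 * c1 * b1)\<^sup>2 + (a1 * c2 * b2)\<^sup>2 + (a2 * c1 * b3)\<^sup>2 + (a2 * c2 * b4)\<^sup>2)
    + 6 * (a1 * c1 * (b1 * (b1 * (b1\<^sup>2 + b2\<^sup>2 + b3\<^sup>2) + b2 * b3 * b4))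
      + a1 * c2 * (b2 * (b2 * (b1\<^sup>2 + b2\<^sup>2 + b4\<^sup>2) + b1 * b3 * b4))
      + a2 * c1 * (b3 * (b3 * (b1\<^sup>2 + b3\<^sup>2 + b4\<^sup>2) + b1 * b2 * b4))
      + a2 * c2 * (b4 * (b4 * (b2\<^sup>2 + b3\<^sup>2 + b4\<^sup>2) + b1 * b2 * b3)))
    + (b1 * (b1\<^sup>2 + b2\<^sup>2 + b3\<^sup>2) + b2 * b3 * b4)\<^sup>2 + (b2 * (b1\<^sup>2 + b2\<^sup>2 + b4\<^sup>2) + b1 * b3 * b4)\<^sup>2
    + (b3 * (b1\<^sup>2 + b3\<^sup>2 + b4\<^sup>2) + b1 * b2 * b4)\<^sup>2 + (b4 * (b2\<^sup>2 + b3\<^sup>2 + b4\<^sup>2) + b1 * b2 * b3)\<^sup>2"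
  by (simp add: trace_sum_compositions numeral_3_eq_3) (simp add: power2_eq_square algebra_simps)

text \<open>Up to the factor \<open>3\<close>, the four groups of terms are the traces of \<open>A\<^sup>2 B C\<^sup>3 B\<^sup>t\<close>, of \<open>A B C\<^sup>2 B\<^sup>t B B\<^sup>t\<close> (twice), of
  \<open>A (B C B\<^sup>t)\<^sup>2\<close> and of \<open>C (B\<^sup>t B)\<^sup>3\<close>.\<close>
lemma trace_sum_3_4:
  "trace_sum (mat22 a1 0 0 a2) (mat22 b1 b2 b3 b4) (mat22 c1 0 0 c2) (mat22 b1 b3 b2 b4) 3 4 =
    3 * (c1 * (a1 * c1 * b1)\<^sup>2 + c2 * (a1 * c2 * b2)\<^sup>2 + c1 * (a2 * c1 * b3)\<^sup>2 + c2 * (a2 * c2 * b4)\<^sup>2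
     + 2 * (a1 * c1\<^sup>2 * (b1 * (b1 * (b1\<^sup>2 + b2\<^sup>2 + b3\<^sup>2) + b2 * b3 * b4))
      + a1 * c2\<^sup>2 * (b2 * (b2 * (b1\<^sup>2 + b2\<^sup>2 + b4\<^sup>2) + b1 * b3 * b4))
      + a2 * c1\<^sup>2 * (b3 * (b3 * (b1\<^sup>2 + b3\<^sup>2 + b4\<^sup>2) + b1 * b2 * b4))
      + a2 * c2\<^sup>2 * (b4 * (b4 * (b2\<^sup>2 + b3\<^sup>2 + b4\<^sup>2) + b1 * b2 * b3)))
     + (a1 * (b1\<^sup>2 * c1 + b2\<^sup>2 * c2)\<^sup>2 + (a1 + a2) * (b1 * b3 * c1 + b2 * b4 * c2)\<^sup>2
        + a2 * (b3\<^sup>2 * c1 + b4\<^sup>2 * c2)\<^sup>2)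
     + (c1 * (b1 * (b1\<^sup>2 + b2\<^sup>2 + b3\<^sup>2) + b2 * b3 * b4)\<^sup>2 + c2 * (b2 * (b1\<^sup>2 + b2\<^sup>2 + b4\<^sup>2) + b1 * b3 * b4)\<^sup>2
    + c1 * (b3 * (b1\<^sup>2 + b3\<^sup>2 + b4\<^sup>2) + b1 * b2 * b4)\<^sup>2 + c2 * (b4 * (b2\<^sup>2 + b3\<^sup>2 + b4\<^sup>2) + b1 * b2 * b3)\<^sup>2))"
  by (simp add: trace_sum_compositions eval_nat_numeral) (simp add: power2_eq_square algebra_simps)

text \<open>Both sums count the same cyclic words; with four letters of one kind and three of the other, such
  a word can be started at any of the four or at any of the three.\<close>
lemma trace_sum_4_3:
  "trace_sum (mat22 a1 0 0 a2) (mat22 b1 b2 b3 b4) (mat22 c1 0 0 c2) (mat22 b1 b3 b2 b4) 4 3 =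
    4 / 3 * trace_sum (mat22 c1 0 0 c2) (mat22 b1 b3 b2 b4) (mat22 a1 0 0 a2) (mat22 b1 b2 b3 b4) 3 4"
  unfolding trace_sum_3_4
  by (simp add: trace_sum_compositions eval_nat_numeral) (simp add: power2_eq_square algebra_simps)

text \<open>The loss at the entry \<open>(1,1)\<close> is at most \<open>2 (b2 b3 b4)\<^sup>2\<close>. The entries \<open>(1,2)\<close> and \<open>(2,1)\<close> gain at
  least \<open>6 b4\<^sup>2 (b2\<^sup>4 + b3\<^sup>4)\<close>, where the minor condition \<open>b4\<^sup>2 \<le> a2 c2\<close> enters.\<close>
lemma misaligned_trace_sum_3_3:
  assumes a: "0 < a2" "a2 \<le> a1" and c: "0 < c2" "c2 \<le> c1" and b: "b4\<^sup>2 \<le> a2 * c2"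
    and mis: "\<not> aligned b1 b2 b3 b4"
  shows "0 \<le> trace_sum (mat22 a1 0 0 a2) (mat22 b1 b2 b3 b4) (mat22 c1 0 0 c2) (mat22 b1 b3 b2 b4) 3 3"
proof -
  define r1 r2 r3 r4 where r_defs: "r1 = b1 * (b1\<^sup>2 + b2\<^sup>2 + b3\<^sup>2) + b2 * b3 * b4"
    "r2 = b2 * (b1\<^sup>2 + b2\<^sup>2 + b4\<^sup>2) + b1 * b3 * b4"
    "r3 = b3 * (b1\<^sup>2 + b3\<^sup>2 + b4\<^sup>2) + b1 * b2 * b4"
    "r4 = b4 * (b2\<^sup>2 + b3\<^sup>2 + b4\<^sup>2) + b1 * b2 * b3"
  note r = misaligned_estimates[OF mis, folded r_defs]
  have "b4\<^sup>2 \<le> a1 * c2" "b4\<^sup>2 \<le> a2 * c1"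
    using b a c mult_right_mono[of a2 a1 c2] mult_left_mono[of c2 c1 a2] by linarith+
  then have e23: "b4\<^sup>2 * b2 ^ 4 \<le> a1 * c2 * (b2 * r2)" "b4\<^sup>2 * b3 ^ 4 \<le> a2 * c1 * (b3 * r3)"
    using r a c by (auto intro!: mult_mono)
  have e4: "0 \<le> a2 * c2 * (b4 * r4)" using r a c by simp
  have X: "2 * (b2 * b3 * b4)\<^sup>2 \<le> b4\<^sup>2 * b2 ^ 4 + b4\<^sup>2 * b3 ^ 4"
  proof -
    have "0 \<le> (b4 * (b2\<^sup>2 - b3\<^sup>2))\<^sup>2" by simp
    then show ?thesis by (simp add: power2_eq_square power4_eq_xxxx algebra_simps)
  qed
  \<comment> \<open>Completing the square bounds the only possibly negative contribution, that of the entry \<open>(1,1)\<close>.\<close>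
  have e1: "- 2 * (b2 * b3 * b4)\<^sup>2 \<le> 3 * (a1 * c1 * b1)\<^sup>2 + 6 * (a1 * c1 * (b1 * r1)) + r1\<^sup>2"
    using r(4)
  proof
    assume "0 \<le> b1 * r1"
    then have "0 \<le> a1 * c1 * (b1 * r1)" using a c by simp
    then show ?thesis using zero_le_power2[of "b2 * b3 * b4"] zero_le_power2[of "a1 * c1 * b1"]
        zero_le_power2[of r1] by linarith
  next
    assume "r1\<^sup>2 \<le> (b2 * b3 * b4)\<^sup>2"
    have "3 * (a1 * c1 * b1)\<^sup>2 + 6 * (a1 * c1 * (b1 * r1)) + r1\<^sup>2 = 3 * (a1 * c1 * b1 + r1)\<^sup>2 - 2 * r1\<^sup>2"
      by (simp add: power2_eq_square algebra_simps)
    then show ?thesis using \<open>r1\<^sup>2 \<le> _\<close> zero_le_power2[of "a1 * c1 * b1 + r1"] by linarith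
  qed
  have combine: "0 \<le> 3 * (s1 + s2 + s3 + s4) + 6 * (e1 + e2 + e3 + e4) + q1 + q2 + q3 + q4"
    if "x2 \<le> e2" "x3 \<le> e3" "0 \<le> e4" "2 * x \<le> x2 + x3" "- 2 * x \<le> 3 * s1 + 6 * e1 + q1"
      "0 \<le> x" "0 \<le> s2" "0 \<le> s3" "0 \<le> s4" "0 \<le> q2" "0 \<le> q3" "0 \<le> q4"
    for s1 s2 s3 s4 e1 e2 e3 e4 q1 q2 q3 q4 x2 x3 x :: real
  proof -
    have "2 * x \<le> e2 + e3" using that(1,2,4) by linarith
    then have "0 \<le> (3 * s1 + 6 * e1 + q1) + 6 * (e2 + e3)"
      using that(5,6) unfolding distrib_left by linarith
    moreover have "0 \<le> 3 * (s2 + s3 + s4) + 6 * e4 + (q2 + q3 + q4)" using that by simp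
    ultimately have "0 \<le> ((3 * s1 + 6 * e1 + q1) + 6 * (e2 + e3)) + (3 * (s2 + s3 + s4) + 6 * e4 + (q2 + q3 + q4))"
      by (rule add_nonneg_nonneg)
    then show ?thesis by (simp add: algebra_simps)
  qed
  show ?thesis
    unfolding trace_sum_3_3 r_defs[symmetric] by (rule combine[OF e23 e4 X e1]) simp_all
qed

text \<open>The loss at the entry \<open>(1,1)\<close> is at most \<open>c1 (b2 b3 b4)\<^sup>2\<close>, which the entries \<open>(1,2)\<close> and \<open>(2,1)\<close>
  outweigh by the inequality of arithmetic and geometric means and \<open>b4\<^sup>2 \<le> a2 c2\<close>.\<close>
lemma misaligned_trace_sum_3_4:
  assumes a: "0 < a2" "a2 \<le> a1" and c: "0 < c2" "c2 \<le> c1" and b: "b4\<^sup>2 \<le> a2 * c2"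
    and mis: "\<not> aligned b1 b2 b3 b4"
  shows "0 \<le> trace_sum (mat22 a1 0 0 a2) (mat22 b1 b2 b3 b4) (mat22 c1 0 0 c2) (mat22 b1 b3 b2 b4) 3 4"
proof -
  define r1 r2 r3 r4 where r_defs: "r1 = b1 * (b1\<^sup>2 + b2\<^sup>2 + b3\<^sup>2) + b2 * b3 * b4"
    "r2 = b2 * (b1\<^sup>2 + b2\<^sup>2 + b4\<^sup>2) + b1 * b3 * b4"
    "r3 = b3 * (b1\<^sup>2 + b3\<^sup>2 + b4\<^sup>2) + b1 * b2 * b4"
    "r4 = b4 * (b2\<^sup>2 + b3\<^sup>2 + b4\<^sup>2) + b1 * b2 * b3"
  note r = misaligned_estimates[OF mis, folded r_defs]
  have pos: "0 < a1" "0 < c1" using a c by auto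
  have e23: "a2 * c2\<^sup>2 * b2 ^ 4 \<le> a1 * c2\<^sup>2 * (b2 * r2)" "a2 * c1\<^sup>2 * b3 ^ 4 \<le> a2 * c1\<^sup>2 * (b3 * r3)"
    using r a c by (auto intro!: mult_mono)
  have e4: "0 \<le> a2 * c2\<^sup>2 * (b4 * r4)" using r a c by simp
  have X: "c1 * (b2 * b3 * b4)\<^sup>2 \<le> a2 * c2\<^sup>2 * b2 ^ 4 + a2 * c1\<^sup>2 * b3 ^ 4"
  proof -
    have "c1 * (b2 * b3 * b4)\<^sup>2 = b4\<^sup>2 * (c1 * (b2 * b3)\<^sup>2)" by (simp add: power_mult_distrib)
    also have "\<dots> \<le> (a2 * c2) * (c1 * (b2 * b3)\<^sup>2)" using b pos by (intro mult_right_mono) auto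
    also have "\<dots> \<le> 2 * ((a2 * c2) * (c1 * (b2 * b3)\<^sup>2))"
      using a c pos by simp
    also have "\<dots> = a2 * c2\<^sup>2 * b2 ^ 4 + a2 * c1\<^sup>2 * b3 ^ 4 - a2 * (c2 * b2\<^sup>2 - c1 * b3\<^sup>2)\<^sup>2"
      by (simp add: power2_eq_square power4_eq_xxxx algebra_simps)
    also have "\<dots> \<le> a2 * c2\<^sup>2 * b2 ^ 4 + a2 * c1\<^sup>2 * b3 ^ 4" using a by simp
    finally show ?thesis .
  qed
  \<comment> \<open>Completing the square bounds the only possibly negative contribution, that of the entry \<open>(1,1)\<close>.\<close>
  have e1: "- c1 * (b2 * b3 * b4)\<^sup>2 \<le> c1 * (a1 * c1 * b1)\<^sup>2 + 2 * (a1 * c1\<^sup>2 * (b1 * r1))"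
    using r(4)
  proof
    assume "0 \<le> b1 * r1"
    then have "0 \<le> a1 * c1\<^sup>2 * (b1 * r1)" "0 \<le> c1 * (b2 * b3 * b4)\<^sup>2" "0 \<le> c1 * (a1 * c1 * b1)\<^sup>2"
      using pos by simp_all
    then show ?thesis unfolding mult_minus_left by linarith
  next
    assume "r1\<^sup>2 \<le> (b2 * b3 * b4)\<^sup>2"
    then have "c1 * r1\<^sup>2 \<le> c1 * (b2 * b3 * b4)\<^sup>2" using pos by simp
    moreover have "c1 * (a1 * c1 * b1)\<^sup>2 + 2 * (a1 * c1\<^sup>2 * (b1 * r1)) = c1 * (a1 * c1 * b1 + r1)\<^sup>2 - c1 * r1\<^sup>2"
      by (simp add: power2_eq_square algebra_simps)
    moreover have "0 \<le> c1 * (a1 * c1 * b1 + r1)\<^sup>2" using pos by simp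
    ultimately show ?thesis by linarith
  qed
  have s: "0 \<le> c2 * (a1 * c2 * b2)\<^sup>2" "0 \<le> c1 * (a2 * c1 * b3)\<^sup>2" "0 \<le> c2 * (a2 * c2 * b4)\<^sup>2"
    using c pos by simp_all
  have x: "0 \<le> c1 * (b2 * b3 * b4)\<^sup>2" using pos by simp
  have t: "0 \<le> a1 * (b1\<^sup>2 * c1 + b2\<^sup>2 * c2)\<^sup>2 + (a1 + a2) * (b1 * b3 * c1 + b2 * b4 * c2)\<^sup>2
      + a2 * (b3\<^sup>2 * c1 + b4\<^sup>2 * c2)\<^sup>2" "0 \<le> c1 * r1\<^sup>2 + c2 * r2\<^sup>2 + c1 * r3\<^sup>2 + c2 * r4\<^sup>2"
    using a c pos by simp_all
  have combine: "0 \<le> 3 * (s1 + s2 + s3 + s4 + 2 * (e1 + e2 + e3 + e4) + t + t')"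
    if "x2 \<le> e2" "x3 \<le> e3" "0 \<le> e4" "x \<le> x2 + x3" "- x \<le> s1 + 2 * e1"
      "0 \<le> s2" "0 \<le> s3" "0 \<le> s4" "0 \<le> t" "0 \<le> t'" "0 \<le> x"
    for s1 s2 s3 s4 e1 e2 e3 e4 t t' x2 x3 x :: real
  proof -
    have "x \<le> e2 + e3" using that(1,2,4) by linarith
    then have "0 \<le> (s1 + 2 * e1) + 2 * (e2 + e3)"
      using that(5,11) unfolding distrib_left by linarith
    moreover have "0 \<le> s2 + s3 + s4 + 2 * e4 + t + t'" using that by simp
    ultimately have "0 \<le> ((s1 + 2 * e1) + 2 * (e2 + e3)) + (s2 + s3 + s4 + 2 * e4 + t + t')"
      by (rule add_nonneg_nonneg)
    then show ?thesis by (simp add: algebra_simps)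
  qed
  show ?thesis
    unfolding trace_sum_3_4 r_defs[symmetric]
    by (rule combine[OF e23 e4 X e1[unfolded mult_minus_left] s t x])
qed

lemma normal_form_trace_sum_nonneg:
  assumes a: "0 < a2" "a2 \<le> a1" and c: "0 < c2" "c2 \<le> c1" and b: "b4\<^sup>2 \<le> a2 * c2"
    and km: "k \<le> 2 \<or> m \<le> 2 \<or> k + m \<le> 7"
  shows "0 \<le> trace_sum (mat22 a1 0 0 a2) (mat22 b1 b2 b3 b4) (mat22 c1 0 0 c2) (mat22 b1 b3 b2 b4) k m"
proof -
  consider (few) "k \<le> 2 \<or> m \<le> 2" | (aligned) "aligned b1 b2 b3 b4"
    | (mis) "\<not> aligned b1 b2 b3 b4" "k = 3 \<and> m = 3 \<or> k = 3 \<and> m = 4 \<or> k = 4 \<and> m = 3"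
    using km by linarith
  then show ?thesis
  proof cases
    case few
    then show ?thesis
      unfolding trace_sum_def using a c
      by (intro sum_nonneg) (auto intro!: few_crossings_trace_nonneg[of _ _ _ _ k m])
  next
    case aligned
    then show ?thesis
      unfolding trace_sum_def using a c
      by (intro sum_nonneg) (auto intro!: aligned_traces_nonneg)
  next
    case mis
    have "\<not> aligned b1 b3 b2 b4" using mis(1) by (simp add: aligned_commute)
    then show ?thesis
      using mis misaligned_trace_sum_3_3[OF a c b] misaligned_trace_sum_3_4[OF a c b]
        misaligned_trace_sum_3_4[OF c a, of b4 b1 b3 b2] b
      by (auto simp: trace_sum_4_3 mult.commute)
  qed
qed

theorem trace_sums_nonneg:
  assumes Q: "pos_def Q" and km: "k \<le> 2 \<or> m \<le> 2 \<or> k + m \<le> 7"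
  shows "0 \<le> trace_sum (block11 Q) (block12 Q) (block22 Q) (block21 Q) k m"
    and "0 \<le> trace_sum (block22 Q) (block21 Q) (block11 Q) (block12 Q) m k"
proof -
  have sym: "transpose Q = Q" using Q by (simp add: pos_def_def)
  obtain W v where adm: "admissible Q W v" using admissible_exists[OF Q] by blast
  define q where "q = conj_by W Q"
  note nf = admissible_normal_form[OF sym adm, folded q_def]
  have "orthogonal_matrix W"
    using adm by (simp add: admissible_def Let_def signature22_orthogonal)
  then have minor: "(q$2$4)\<^sup>2 \<le> q$2$2 * q$4$4"
    using pos_def_minor[OF pos_def_conj_by[OF Q]] nf(11) by (simp add: q_def)
  show "0 \<le> trace_sum (block11 Q) (block12 Q) (block22 Q) (block21 Q) k m"
    using normal_form_trace_sum_nonneg[OF nf(9,8) nf(11,10) minor km] by (simp add: trace_sum_def nf(1))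
  have "m \<le> 2 \<or> k \<le> 2 \<or> m + k \<le> 7" "(q$2$4)\<^sup>2 \<le> q$4$4 * q$2$2"
    using km minor by (auto simp: mult.commute)
  then show "0 \<le> trace_sum (block22 Q) (block21 Q) (block11 Q) (block12 Q) m k"
    using normal_form_trace_sum_nonneg[OF nf(11,10) nf(9,8), of "q$2$4" m k "q$1$3" "q$2$3" "q$1$4"]
    by (simp add: trace_sum_def nf(2))
qed


section \<open>Laplace transforms of Gaussian quadratic forms\<close>

text \<open>The columns of \<open>P\<close> form a basis that is orthonormal for the inner product \<open>x \<bullet> (S *v y)\<close>; it is
  built by the Gram--Schmidt process, one index at a time.\<close>
lemma pos_def_congruent_identity:
  fixes S :: "real^'n^'n"
  assumes S: "pos_def S"
  shows "\<exists>P :: real^'n^'n. transpose P ** S ** P = mat 1"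
proof -
  have pos: "0 < x \<bullet> (S *v x)" if "x \<noteq> 0" for x
    using S that by (simp add: pos_def_def)
  have sym: "x \<bullet> (S *v y) = y \<bullet> (S *v x)" for x y
    using S unfolding pos_def_def by (metis dot_lmul_matrix inner_commute transpose_matrix_vector)
  have "\<exists>f::'n \<Rightarrow> real^'n. \<forall>i\<in>I. \<forall>j\<in>I. f i \<bullet> (S *v f j) = (if i = j then 1 else 0)" if "finite I" for I :: "'n set"
    using that
  proof (induction I rule: finite_induct)
    case (insert k I)
    from insert.IH obtain f :: "'n \<Rightarrow> real^'n" where f: "\<And>i j. i \<in> I \<Longrightarrow> j \<in> I \<Longrightarrow> f i \<bullet> (S *v f j) = (if i = j then 1 else 0)"
      by blast
    have "dim (span (f ` I)) \<le> card (f ` I)" by (simp add: dim_le_card')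
    also have "\<dots> \<le> card I" by (rule card_image_le) simp
    also have "\<dots> < card (insert k I)" using insert by simp
    also have "\<dots> \<le> CARD('n)" by (rule card_mono) auto
    finally have "dim (span (f ` I)) < DIM(real^'n)" by simp
    then have "span (f ` I) \<noteq> UNIV" by (metis dim_UNIV less_irrefl)
    then obtain x where x: "x \<notin> span (f ` I)" by blast
    define y where "y = x - (\<Sum>i\<in>I. (f i \<bullet> (S *v x)) *\<^sub>R f i)"
    have "y \<noteq> 0"
    proof
      assume "y = 0"
      then have "x = (\<Sum>i\<in>I. (f i \<bullet> (S *v x)) *\<^sub>R f i)" by (simp add: y_def)
      also have "\<dots> \<in> span (f ` I)" by (intro span_sum span_mul span_base) simp
      finally show False using x by contradiction
    qed
    have fy: "f j \<bullet> (S *v y) = 0" if "j \<in> I" for j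
    proof -
      have "f j \<bullet> (S *v y) = f j \<bullet> (S *v x) - (\<Sum>i\<in>I. (f i \<bullet> (S *v x)) * (f j \<bullet> (S *v f i)))"
        by (simp add: y_def matrix_vector_mult_diff_distrib inner_diff_right inner_sum_right
            linear_sum[OF matrix_vector_mul_linear] matrix_vector_mult_scaleR)
      also have "(\<Sum>i\<in>I. (f i \<bullet> (S *v x)) * (f j \<bullet> (S *v f i))) = (\<Sum>i\<in>I. if i = j then f j \<bullet> (S *v x) else 0)"
        using that by (intro sum.cong) (auto simp: f)
      finally show ?thesis using that by simp
    qed
    define c where "c = sqrt (y \<bullet> (S *v y))"
    have c: "c > 0" "c * c = y \<bullet> (S *v y)" using pos[OF \<open>y \<noteq> 0\<close>] by (simp_all add: c_def)
    define g where "g = f(k := y /\<^sub>R c)"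
    have yf: "y \<bullet> (S *v f j) = 0" if "j \<in> I" for j
      using fy[OF that] by (simp only: sym[of y "f j"])
    have gg: "g k = y /\<^sub>R c" "i \<in> I \<Longrightarrow> g i = f i" for i
      using insert(2) by (auto simp: g_def)
    have "g k \<bullet> (S *v g k) = 1"
      using c(1) by (simp add: gg matrix_vector_mult_scaleR c(2)[symmetric]) (simp add: field_simps)
    moreover have "g i \<bullet> (S *v g k) = 0" "g k \<bullet> (S *v g i) = 0" if "i \<in> I" for i
      using that fy yf by (simp_all add: gg matrix_vector_mult_scaleR)
    moreover have "g i \<bullet> (S *v g j) = (if i = j then 1 else 0)" if "i \<in> I" "j \<in> I" for i j
      using that f by (simp add: gg)
    ultimately have "\<forall>i\<in>insert k I. \<forall>j\<in>insert k I. g i \<bullet> (S *v g j) = (if i = j then 1 else 0)"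
      using insert(2) by auto
    then show ?case by blast
  qed auto
  from this[of UNIV] obtain f :: "'n \<Rightarrow> real^'n" where f: "\<And>i j. f i \<bullet> (S *v f j) = (if i = j then 1 else 0)"
    by auto
  define P :: "real^'n^'n" where "P = (\<chi> r c. f c $ r)"
  have "(transpose P ** S ** P) $ i $ j = f i \<bullet> (S *v f j)" for i j
  proof -
    have "(S ** P) $ k $ j = (S *v f j) $ k" for k
      by (simp add: P_def matrix_matrix_mult_def matrix_vector_mult_def)
    moreover have "transpose P $ i $ k = f i $ k" for k
      by (simp add: P_def transpose_def)
    ultimately show ?thesis
      by (simp add: matrix_mul_assoc[symmetric] matrix_matrix_mult_def[of "transpose P" "S ** P"] inner_vec_def)
  qed
  then have "transpose P ** S ** P = mat 1" by (simp add: vec_eq_iff f mat_def)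
  then show ?thesis by blast
qed

lemma nn_integral_lborel_linear:
  fixes P :: "real^('n::{finite,wellorder})^('n::_)"
  assumes P: "det P \<noteq> 0" and f [measurable]: "f \<in> borel_measurable borel"
  shows "(\<integral>\<^sup>+z. f z \<partial>lborel) = ennreal \<bar>det P\<bar> * (\<integral>\<^sup>+y. f (P *v y) \<partial>lborel)"
proof -
  have inv: "invertible P" using P invertible_det_nz by blast
  then obtain P' where R: "P ** P' = mat 1" "P' ** P = mat 1"
    unfolding invertible_def by blast
  let ?D = "density (distr lborel borel (\<lambda>x. P *v x)) (\<lambda>_. ennreal \<bar>det P\<bar>)"
  have "lborel = ?D"
  proof (rule lborel_eqI)
    fix l u :: "real^'n::_" assume le: "\<And>b. b \<in> Basis \<Longrightarrow> l \<bullet> b \<le> u \<bullet> b"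
    have vim: "(\<lambda>x. P *v x) -` box l u = (\<lambda>x. P' *v x) ` box l u"
    proof (intro equalityI subsetI)
      fix x assume "x \<in> (\<lambda>x. P *v x) -` box l u"
      then show "x \<in> (\<lambda>x. P' *v x) ` box l u"
        by (intro image_eqI[of _ _ "P *v x"]) (simp_all add: matrix_vector_mul_assoc R)
    qed (auto simp: matrix_vector_mul_assoc R)
    have meas: "(\<lambda>x. P *v x) -` box l u \<in> sets borel"
      using measurable_sets[OF borel_measurable_matrix_vector_mult[of P], of "box l u"] by simp
    have lm: "(\<lambda>x. P' *v x) ` box l u \<in> lmeasurable"
      by (intro measurable_linear_image matrix_vector_mul_linear) simp
    have "emeasure lborel ((\<lambda>x. P *v x) -` box l u) = emeasure lebesgue ((\<lambda>x. P' *v x) ` box l u)"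
      using meas by (simp add: vim)
    also have "\<dots> = measure lebesgue ((\<lambda>x. P' *v x) ` box l u)"
      using lm by (simp add: emeasure_eq_measure2)
    also have "\<dots> = \<bar>det (P')\<bar> * measure lebesgue (box l u)"
      by (subst measure_linear_image) (simp_all add: matrix_vector_mul_linear)
    finally have e: "emeasure lborel ((\<lambda>x. P *v x) -` box l u) =
      ennreal (\<bar>det (P')\<bar> * measure lebesgue (box l u))" .
    have d1: "\<bar>det P\<bar> * \<bar>det (P')\<bar> = 1"
      using R by (metis abs_mult abs_one det_I det_mul)
    have "emeasure ?D (box l u) = ennreal \<bar>det P\<bar> * emeasure lborel ((\<lambda>x. P *v x) -` box l u)"
      by (simp add: emeasure_density nn_integral_cmult emeasure_distr)
    also have "\<dots> = ennreal (\<bar>det P\<bar> * \<bar>det (P')\<bar> * measure lebesgue (box l u))"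
      by (simp add: e ennreal_mult mult.assoc)
    also have "\<dots> = (\<Prod>b\<in>Basis. (u - l) \<bullet> b)"
      using le by (simp add: d1 measure_lborel_box_eq)
    finally show "emeasure ?D (box l u) = (\<Prod>b\<in>Basis. (u - l) \<bullet> b)" .
  qed simp
  then have "(\<integral>\<^sup>+z. f z \<partial>lborel) = (\<integral>\<^sup>+z. f z \<partial>?D)" by simp
  also have "\<dots> = ennreal \<bar>det P\<bar> * (\<integral>\<^sup>+y. f (P *v y) \<partial>lborel)"
    by (simp add: nn_integral_density nn_integral_cmult nn_integral_distr)
  finally show ?thesis .
qed

definition gauss_density :: "'a::euclidean_space \<Rightarrow> real" where
  "gauss_density z = (\<Prod>b\<in>Basis. std_normal_density (z \<bullet> b))"

lemma gauss_density_eq: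
  "gauss_density (z :: 'a::euclidean_space) = (1 / sqrt (2 * pi)) ^ DIM('a) * exp (- (z \<bullet> z) / 2)"
proof -
  have "(\<Prod>b\<in>Basis. exp (- (z \<bullet> b)\<^sup>2 / 2)) = exp (\<Sum>b\<in>Basis. - (z \<bullet> b)\<^sup>2 / 2)"
    by (simp add: exp_sum)
  also have "(\<Sum>b\<in>Basis. - (z \<bullet> b)\<^sup>2 / 2) = - (z \<bullet> z) / 2"
    by (simp add: euclidean_inner[of z z] power2_eq_square sum_divide_distrib sum_negf)
  finally show ?thesis
    by (simp add: gauss_density_def std_normal_density_def prod.distrib prod_dividef power_divide)
qed

lemma gauss_density_nonneg [simp]: "0 \<le> gauss_density z"
  by (simp add: gauss_density_def prod_nonneg)

lemma borel_measurable_gauss_density [measurable]: "gauss_density \<in> borel_measurable borel"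
  unfolding gauss_density_eq[abs_def] by measurable

lemma nn_integral_gauss_density: "(\<integral>\<^sup>+z. ennreal (gauss_density (z::'a::euclidean_space)) \<partial>lborel) = 1"
proof -
  have 1: "(\<integral>\<^sup>+x. ennreal (std_normal_density x) \<partial>lborel) = 1"
    by (subst nn_integral_eq_integral) (auto simp: )
  have "(\<integral>\<^sup>+z. ennreal (gauss_density (z::'a)) \<partial>lborel) =
    (\<integral>\<^sup>+z. (\<Prod>b\<in>Basis. ennreal (std_normal_density ((z::'a) \<bullet> b))) \<partial>lborel)"
    by (simp add: gauss_density_def prod_ennreal)
  also have "\<dots> = (\<Prod>b\<in>(Basis::'a set). \<integral>\<^sup>+x. ennreal (std_normal_density x) \<partial>lborel)"
    by (rule nn_integral_lborel_prod) auto
  finally show ?thesis using 1 by simp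
qed

lemma integrable_gauss_density: "integrable lborel (gauss_density :: 'a::euclidean_space \<Rightarrow> real)"
  by (rule integrableI_nonneg) (simp_all add: nn_integral_gauss_density)

text \<open>The substitution \<open>z = P y\<close> with \<open>P\<^sup>t S P = I\<close> turns the integrand into the standard Gaussian
  density, and \<open>\<bar>det P\<bar> = 1 / sqrt (det S)\<close>.\<close>
lemma gaussian_integral:
  fixes S :: "real^('n::{finite,wellorder})^('n::_)"
  assumes "pos_def S"
  shows "(\<integral>\<^sup>+z. ennreal ((1 / sqrt (2 * pi)) ^ CARD('n) * exp (- (z \<bullet> (S *v z)) / 2)) \<partial>lborel) = ennreal (1 / sqrt (det S))"
    and "0 < det S"
proof -
  obtain P :: "real^'n::_^'n::_" where P: "transpose P ** S ** P = mat 1"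
    using pos_def_congruent_identity[OF assms] by blast
  then have "det (transpose P ** S ** P) = 1" by simp
  then have d: "det S * (det P)\<^sup>2 = 1"
    by (simp add: det_mul power2_eq_square mult_ac)
  then have nz: "det P \<noteq> 0" by auto
  have "det S = 1 / (det P)\<^sup>2" using d nz by (simp add: field_simps)
  then show "0 < det S" using nz by simp
  have s: "1 / sqrt (det S) = \<bar>det P\<bar>"
    unfolding \<open>det S = _\<close> by (simp add: real_sqrt_divide)
  have q: "(P *v y) \<bullet> (S *v (P *v y)) = y \<bullet> y" for y
  proof -
    have "(P *v y) \<bullet> (S *v (P *v y)) = y \<bullet> (transpose P *v (S *v (P *v y)))"
      by (rule inner_transpose_left[symmetric])
    also have "\<dots> = y \<bullet> y" by (simp only: matrix_vector_mul_assoc matrix_mul_assoc P matrix_vector_mul_lid)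
    finally show ?thesis .
  qed
  have "(\<integral>\<^sup>+z. ennreal ((1 / sqrt (2 * pi)) ^ CARD('n) * exp (- (z \<bullet> (S *v z)) / 2)) \<partial>lborel) =
    ennreal \<bar>det P\<bar> * (\<integral>\<^sup>+y. ennreal (gauss_density (y::real^'n::_)) \<partial>lborel)"
    by (subst nn_integral_lborel_linear[OF nz]) (simp_all add: q gauss_density_eq)
  then show "(\<integral>\<^sup>+z. ennreal ((1 / sqrt (2 * pi)) ^ CARD('n) * exp (- (z \<bullet> (S *v z)) / 2)) \<partial>lborel) = ennreal (1 / sqrt (det S))"
    by (simp add: nn_integral_gauss_density s)
qed

lemma fourier_std_normal: "(\<integral>x. std_normal_density x *\<^sub>R iexp (t * x) \<partial>lborel) = exp (- (t\<^sup>2) / 2)"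
proof -
  have "(\<integral>x. std_normal_density x *\<^sub>R iexp (t * x) \<partial>lborel) = char std_normal_distribution t"
    unfolding char_def by (subst integral_density) auto
  then show ?thesis by (simp add: char_std_normal_distribution)
qed

lemma lborel_integral_prod:
  fixes f :: "'a::euclidean_space \<Rightarrow> real \<Rightarrow> complex"
  assumes f: "\<And>b. b \<in> Basis \<Longrightarrow> integrable lborel (f b)"
  shows "(\<integral>x. (\<Prod>b\<in>Basis. f b (x \<bullet> b)) \<partial>lborel) = (\<Prod>b\<in>Basis. \<integral>x. f b x \<partial>lborel)"
proof -
  interpret product_sigma_finite "\<lambda>_::'a. lborel :: real measure" ..
  have [measurable]: "f b \<in> borel_measurable borel" if "b \<in> Basis" for b
    using f[OF that] borel_measurable_integrable by force
  have "(\<integral>x. (\<Prod>b\<in>Basis. f b (x \<bullet> b)) \<partial>lborel) =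
      (\<integral>x. (\<Prod>b\<in>Basis. f b ((\<Sum>b\<in>Basis. x b *\<^sub>R b) \<bullet> b)) \<partial>(\<Pi>\<^sub>M b\<in>Basis. lborel))"
    by (subst lborel_eq, subst integral_distr) auto
  also have "\<dots> = (\<integral>x. (\<Prod>b\<in>Basis. f b (x b)) \<partial>(\<Pi>\<^sub>M b\<in>Basis. lborel))"
    by (intro Bochner_Integration.integral_cong prod.cong) auto
  also have "\<dots> = (\<Prod>b\<in>Basis. \<integral>x. f b x \<partial>lborel)"
    by (rule product_integral_prod) (use f in auto)
  finally show ?thesis .
qed

lemma fourier_gauss_density:
  "(\<integral>z. gauss_density z *\<^sub>R iexp (w \<bullet> z) \<partial>lborel) = exp (- (w \<bullet> w) / 2)"
proof -
  have p: "gauss_density z *\<^sub>R iexp (w \<bullet> z) =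
      (\<Prod>b\<in>Basis. std_normal_density (z \<bullet> b) *\<^sub>R iexp ((w \<bullet> b) * (z \<bullet> b)))" for z
    unfolding gauss_density_def euclidean_inner[of w z]
    by (simp add: scaleR_conv_of_real prod.distrib exp_sum sum_distrib_left)
  have "integrable lborel (\<lambda>x. std_normal_density x *\<^sub>R iexp (t * x))" for t
    by (rule Bochner_Integration.integrable_bound[of _ std_normal_density]) auto
  then have "(\<integral>z. gauss_density z *\<^sub>R iexp (w \<bullet> z) \<partial>lborel) =
      (\<Prod>b\<in>Basis. \<integral>x. std_normal_density x *\<^sub>R iexp ((w \<bullet> b) * x) \<partial>lborel)"
    unfolding p by (rule lborel_integral_prod)
  also have "\<dots> = (\<Prod>b\<in>Basis. complex_of_real (exp (- ((w \<bullet> b)\<^sup>2) / 2)))"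
    by (simp only: fourier_std_normal)
  also have "\<dots> = exp (- (w \<bullet> w) / 2)"
    by (simp add: euclidean_inner[of w w] power2_eq_square exp_sum[symmetric] sum_divide_distrib
        sum_negf exp_of_real[symmetric] of_real_prod[symmetric] del: exp_of_real of_real_prod)
  finally show ?thesis .
qed

lemma normal_second_moment_integrable: "0 < \<sigma> \<Longrightarrow> integrable lborel (\<lambda>x. normal_density \<mu> \<sigma> x * x\<^sup>2)"
proof -
  assume "0 < \<sigma>"
  then have "integrable lborel (\<lambda>x. normal_density \<mu> \<sigma> x * (x - \<mu>) ^ 2 + 2 * \<mu> * (normal_density \<mu> \<sigma> x * x)
      - \<mu>\<^sup>2 * normal_density \<mu> \<sigma> x)"
    by (intro Bochner_Integration.integrable_add Bochner_Integration.integrable_diff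
        integrable_mult_right integrable_normal_moment integrable_normal_moment_nz_1 integrable_normal_density)
  also have "(\<lambda>x. normal_density \<mu> \<sigma> x * (x - \<mu>) ^ 2 + 2 * \<mu> * (normal_density \<mu> \<sigma> x * x)
      - \<mu>\<^sup>2 * normal_density \<mu> \<sigma> x) = (\<lambda>x. normal_density \<mu> \<sigma> x * x\<^sup>2)"
    by (auto simp: fun_eq_iff power2_eq_square algebra_simps)
  finally show ?thesis .
qed

lemma gaussian_vector_moments:
  assumes "prob_space M" and X: "gaussian_vector M X"
  shows "integrable M (\<lambda>\<omega>. c \<bullet> X \<omega>)" "integrable M (\<lambda>\<omega>. (c \<bullet> X \<omega>)\<^sup>2)"
proof -
  interpret prob_space M by fact
  have [measurable]: "X \<in> borel_measurable M" using X by (simp add: gaussian_vector_def)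
  consider (const) \<mu> where "AE \<omega> in M. c \<bullet> X \<omega> = \<mu>"
    | (normal) \<mu> \<sigma> where "0 < \<sigma>" "distributed M lborel (\<lambda>\<omega>. c \<bullet> X \<omega>) (\<lambda>x. ennreal (normal_density \<mu> \<sigma> x))"
    using X unfolding gaussian_vector_def by blast
  then have "integrable M (\<lambda>\<omega>. c \<bullet> X \<omega>) \<and> integrable M (\<lambda>\<omega>. (c \<bullet> X \<omega>)\<^sup>2)"
  proof cases
    case const
    have "integrable M (\<lambda>\<omega>. c \<bullet> X \<omega>) = integrable M (\<lambda>\<omega>. \<mu>)"
      by (rule integrable_cong_AE) (use const in auto)
    moreover have "integrable M (\<lambda>\<omega>. (c \<bullet> X \<omega>)\<^sup>2) = integrable M (\<lambda>\<omega>. \<mu>\<^sup>2)"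
      by (rule integrable_cong_AE) (use const in auto)
    ultimately show ?thesis by simp
  next
    case normal
    show ?thesis
      using distributed_integrable[OF normal(2), of "\<lambda>x. x"] distributed_integrable[OF normal(2), of "\<lambda>x. x\<^sup>2"]
        integrable_normal_moment_nz_1[OF normal(1)] normal_second_moment_integrable[OF normal(1)]
      by simp
  qed
  then show "integrable M (\<lambda>\<omega>. c \<bullet> X \<omega>)" "integrable M (\<lambda>\<omega>. (c \<bullet> X \<omega>)\<^sup>2)" by blast+
qed

text \<open>A linear functional of the vector has mean \<open>0\<close> and variance \<open>c \<bullet> (\<Sigma> *v c)\<close>; the variance is positive
  for \<open>c \<noteq> 0\<close>, so the functional is not almost surely constant and must be normal.\<close>
lemma gaussian_vector_char:
  assumes P: "prob_space M" and X: "gaussian_vector M X" and mean: "mean_vector M X = 0"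
    and cov: "covariance_matrix M X = \<Sigma>" and pd: "pos_def \<Sigma>"
  shows "(\<integral>\<omega>. iexp (c \<bullet> X \<omega>) \<partial>M) = exp (- (c \<bullet> (\<Sigma> *v c)) / 2)"
proof (cases "c = 0")
  case True
  then show ?thesis by (simp add: prob_space.prob_space[OF P])
next
  case False
  interpret prob_space M by fact
  have [measurable]: "X \<in> borel_measurable M" using X by (simp add: gaussian_vector_def)
  have comp: "X \<omega> $ i = axis i 1 \<bullet> X \<omega>" for \<omega> i by (simp add: inner_axis')
  have intX: "integrable M (\<lambda>\<omega>. X \<omega> $ i)" for i
    unfolding comp by (rule gaussian_vector_moments[OF P X])
  have intXX: "integrable M (\<lambda>\<omega>. X \<omega> $ i * X \<omega> $ j)" for i j
  proof -
    have "integrable M (\<lambda>\<omega>. (((axis i 1 + axis j 1) \<bullet> X \<omega>)\<^sup>2 - (axis i 1 \<bullet> X \<omega>)\<^sup>2 - (axis j 1 \<bullet> X \<omega>)\<^sup>2) / 2)"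
      by (intro integrable_divide Bochner_Integration.integrable_diff gaussian_vector_moments[OF P X])
    also have "(\<lambda>\<omega>. (((axis i 1 + axis j 1) \<bullet> X \<omega>)\<^sup>2 - (axis i 1 \<bullet> X \<omega>)\<^sup>2 - (axis j 1 \<bullet> X \<omega>)\<^sup>2) / 2)
        = (\<lambda>\<omega>. X \<omega> $ i * X \<omega> $ j)"
      by (auto simp: fun_eq_iff inner_add_left inner_axis' power2_eq_square field_simps)
    finally show ?thesis .
  qed
  have m0: "mean_vector M X $ i = 0" for i by (simp add: mean)
  then have EX: "(\<integral>\<omega>. X \<omega> $ i \<partial>M) = 0" for i by (simp add: mean_vector_def)
  have EXX: "(\<integral>\<omega>. X \<omega> $ i * X \<omega> $ j \<partial>M) = \<Sigma> $ i $ j" for i j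
    unfolding cov[symmetric] by (simp add: covariance_matrix_def m0)
  have E1: "(\<integral>\<omega>. c \<bullet> X \<omega> \<partial>M) = 0"
    by (simp add: inner_vec_def intX EX)
  have "(\<integral>\<omega>. (c \<bullet> X \<omega>)\<^sup>2 \<partial>M) = (\<integral>\<omega>. (\<Sum>i\<in>UNIV. \<Sum>j\<in>UNIV. c$i * c$j * (X \<omega> $ i * X \<omega> $ j)) \<partial>M)"
    by (simp add: inner_vec_def power2_eq_square sum_product mult_ac)
  also have "\<dots> = (\<Sum>i\<in>UNIV. \<Sum>j\<in>UNIV. c$i * c$j * \<Sigma>$i$j)"
    by (simp add: intXX EXX)
  also have "\<dots> = c \<bullet> (\<Sigma> *v c)"
    by (simp add: inner_vec_def matrix_vector_mult_def sum_distrib_left mult_ac)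
  finally have E2: "(\<integral>\<omega>. (c \<bullet> X \<omega>)\<^sup>2 \<partial>M) = c \<bullet> (\<Sigma> *v c)" .
  have pos: "0 < c \<bullet> (\<Sigma> *v c)" using pd False by (simp add: pos_def_def)
  consider (const) \<mu> where "AE \<omega> in M. c \<bullet> X \<omega> = \<mu>"
    | (normal) \<mu> \<sigma> where "0 < \<sigma>" "distributed M lborel (\<lambda>\<omega>. c \<bullet> X \<omega>) (\<lambda>x. ennreal (normal_density \<mu> \<sigma> x))"
    using X unfolding gaussian_vector_def by blast
  then show ?thesis
  proof cases
    case const
    have "(\<integral>\<omega>. c \<bullet> X \<omega> \<partial>M) = (\<integral>\<omega>. \<mu> \<partial>M)" "(\<integral>\<omega>. (c \<bullet> X \<omega>)\<^sup>2 \<partial>M) = (\<integral>\<omega>. \<mu>\<^sup>2 \<partial>M)"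
      by (rule integral_cong_AE; use const in auto)+
    then show ?thesis using E1 E2 pos by (simp add: prob_space)
  next
    case normal
    have \<mu>: "\<mu> = 0" using normal_distributed_expectation[OF normal] E1 by simp
    have s2: "\<sigma>\<^sup>2 = c \<bullet> (\<Sigma> *v c)"
      using normal_distributed_variance[OF normal] E1 E2 by simp
    have "distributed M lborel (\<lambda>\<omega>. (c \<bullet> X \<omega> - 0) / \<sigma>) std_normal_density"
      using normal_standard_normal_convert[OF normal(1), of "\<lambda>\<omega>. c \<bullet> X \<omega>" \<mu>] normal(2) \<mu> by simp
    then have d: "distr M lborel (\<lambda>\<omega>. (c \<bullet> X \<omega> - 0) / \<sigma>) = std_normal_distribution"
      by (rule distributed_distr_eq_density)
    have "(\<integral>\<omega>. iexp (c \<bullet> X \<omega>) \<partial>M) = (\<integral>x. iexp (\<sigma> * x) \<partial>distr M lborel (\<lambda>\<omega>. (c \<bullet> X \<omega> - 0) / \<sigma>))"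
      using normal(1) by (subst integral_distr) auto
    also have "\<dots> = char std_normal_distribution \<sigma>" unfolding d char_def ..
    finally show ?thesis using s2 by (simp add: char_std_normal_distribution)
  qed
qed

definition hadamard :: "real^'n \<Rightarrow> real^'n \<Rightarrow> real^'n" where
  "hadamard d x = (\<chi> i. d$i * x$i)"

definition diag_mat :: "real^'n \<Rightarrow> real^'n^'n" where
  "diag_mat d = (\<chi> i j. if i = j then d$i else 0)"

lemma diag_mat_mult_vec: "diag_mat d *v x = hadamard d x"
  by (simp add: vec_eq_iff diag_mat_def hadamard_def matrix_vector_mult_def if_distrib[of "\<lambda>t. t * _"] cong: if_cong)

lemma transpose_diag_mat [simp]: "transpose (diag_mat d) = diag_mat d"
  by (auto simp: vec_eq_iff diag_mat_def transpose_def)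

lemma hadamard_inner: "hadamard d x \<bullet> y = hadamard d y \<bullet> x"
  by (simp add: hadamard_def inner_vec_def mult_ac)

text \<open>The law of the vector is accessible only through its linear functionals. Writing
  \<open>exp (- w \<bullet> w / 2)\<close> as the characteristic function of a standard Gaussian integral and exchanging the
  integrals reduces the quadratic functional to linear ones.\<close>
lemma gaussian_vector_laplace_det:
  fixes X :: "'a \<Rightarrow> real^'n::{finite,wellorder}"
  assumes P: "prob_space M" and X: "gaussian_vector M X" and mean: "mean_vector M X = 0"
    and cov: "covariance_matrix M X = \<Sigma>" and pd: "pos_def \<Sigma>"
  shows "(\<integral>\<omega>. exp (- (hadamard d (X \<omega>) \<bullet> hadamard d (X \<omega>)) / 2) \<partial>M) =
    1 / sqrt (det (mat 1 + diag_mat d ** \<Sigma> ** diag_mat d))"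
    and "0 < det (mat 1 + diag_mat d ** \<Sigma> ** diag_mat d)"
proof -
  interpret prob_space M by fact
  interpret pair_sigma_finite M "lborel :: (real^'n::_) measure" ..
  have [measurable]: "X \<in> borel_measurable M" using X by (simp add: gaussian_vector_def)
  define S where "S = mat 1 + diag_mat d ** \<Sigma> ** diag_mat d"
  have had_meas [measurable]: "hadamard d \<in> borel_measurable borel"
    unfolding diag_mat_mult_vec[abs_def, symmetric] by measurable
  have Sq: "z \<bullet> (S *v z) = z \<bullet> z + hadamard d z \<bullet> (\<Sigma> *v hadamard d z)" for z
  proof -
    have "S *v z = z + hadamard d (\<Sigma> *v hadamard d z)"
      by (simp add: S_def matrix_vector_mult_add_rdistrib matrix_vector_mul_assoc[symmetric] diag_mat_mult_vec)
    then show ?thesis by (simp add: inner_add_right hadamard_inner[of d z] inner_commute)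
  qed
  have S: "pos_def S"
    unfolding pos_def_def
  proof (intro conjI allI impI)
    have "transpose \<Sigma> = \<Sigma>" using pd by (simp add: pos_def_def)
    then have "transpose (diag_mat d ** \<Sigma> ** diag_mat d) = diag_mat d ** \<Sigma> ** diag_mat d"
      by (simp add: matrix_transpose_mul matrix_mul_assoc)
    then show "transpose S = S"
      by (auto simp: S_def transpose_def vec_eq_iff mat_def)
    fix z :: "real^'n::_" assume "z \<noteq> 0"
    then show "0 < z \<bullet> (S *v z)"
      unfolding Sq using pos_def_nonneg[OF pd] by (simp add: add_pos_nonneg)
  qed
  from gaussian_integral(2)[OF S] show "0 < det (mat 1 + diag_mat d ** \<Sigma> ** diag_mat d)"
    by (simp add: S_def)
  let ?f = "\<lambda>\<omega> z. gauss_density z *\<^sub>R iexp (hadamard d (X \<omega>) \<bullet> z)"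
  have int: "integrable (M \<Otimes>\<^sub>M lborel) (\<lambda>(\<omega>, z). ?f \<omega> z)"
  proof (rule Fubini_integrable)
    show "(\<lambda>(\<omega>, z). ?f \<omega> z) \<in> borel_measurable (M \<Otimes>\<^sub>M lborel)" by measurable
    show "integrable M (\<lambda>\<omega>. \<integral>z. norm (case (\<omega>, z) of (\<omega>, z) \<Rightarrow> ?f \<omega> z) \<partial>lborel)"
      by simp
    show "AE \<omega> in M. integrable lborel (\<lambda>z. case (\<omega>, z) of (\<omega>, z) \<Rightarrow> ?f \<omega> z)"
      by (intro AE_I2) (rule Bochner_Integration.integrable_bound[OF integrable_gauss_density], auto)
  qed
  \<comment> \<open>The square under the expectation is replaced by an auxiliary standard Gaussian integral over \<open>z\<close>.\<close>
  have "(\<integral>\<omega>. complex_of_real (exp (- (hadamard d (X \<omega>) \<bullet> hadamard d (X \<omega>)) / 2)) \<partial>M) =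
      (\<integral>\<omega>. (\<integral>z. ?f \<omega> z \<partial>lborel) \<partial>M)"
    by (simp only: fourier_gauss_density)
  also have "\<dots> = (\<integral>z. (\<integral>\<omega>. ?f \<omega> z \<partial>M) \<partial>lborel)"
    by (rule Fubini_integral[OF int, symmetric])
  also have "\<dots> = (\<integral>z. gauss_density z *\<^sub>R (\<integral>\<omega>. iexp (hadamard d z \<bullet> X \<omega>) \<partial>M) \<partial>lborel)"
    by (simp only: integral_scaleR_right hadamard_inner)
  also have "\<dots> = (\<integral>z. complex_of_real (gauss_density z * exp (- (hadamard d z \<bullet> (\<Sigma> *v hadamard d z)) / 2)) \<partial>lborel)"
    by (simp only: gaussian_vector_char[OF assms] scaleR_conv_of_real of_real_mult)
  also have "\<dots> = (\<integral>z. complex_of_real ((1 / sqrt (2 * pi)) ^ CARD('n) * exp (- (z \<bullet> (S *v z)) / 2)) \<partial>lborel)"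
  proof -
    have "gauss_density z * exp (- (hadamard d z \<bullet> (\<Sigma> *v hadamard d z)) / 2) =
        (1 / sqrt (2 * pi)) ^ CARD('n) * exp (- (z \<bullet> (S *v z)) / 2)" for z
      by (simp add: gauss_density_eq Sq mult.assoc exp_add[symmetric] field_simps)
    then show ?thesis by (simp only:)
  qed
  finally have "(\<integral>\<omega>. exp (- (hadamard d (X \<omega>) \<bullet> hadamard d (X \<omega>)) / 2) \<partial>M) =
      (\<integral>z. (1 / sqrt (2 * pi)) ^ CARD('n) * exp (- (z \<bullet> (S *v z)) / 2) \<partial>lborel)"
    by (simp only: integral_complex_of_real of_real_eq_iff)
  also have "\<dots> = 1 / sqrt (det S)"
  proof (rule integral_eq_nn_integral[THEN trans])
    show "(\<lambda>z. (1 / sqrt (2 * pi)) ^ CARD('n) * exp (- (z \<bullet> (S *v z)) / 2)) \<in> borel_measurable lborel"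
      by measurable
    show "enn2real (\<integral>\<^sup>+z. ennreal ((1 / sqrt (2 * pi)) ^ CARD('n) * exp (- (z \<bullet> (S *v z)) / 2)) \<partial>lborel) =
        1 / sqrt (det S)"
      unfolding gaussian_integral(1)[OF S] using gaussian_integral(2)[OF S] by simp
  qed simp
  finally show "(\<integral>\<omega>. exp (- (hadamard d (X \<omega>) \<bullet> hadamard d (X \<omega>)) / 2) \<partial>M) =
    1 / sqrt (det (mat 1 + diag_mat d ** \<Sigma> ** diag_mat d))" by (simp add: S_def)
qed

lemma tendsto_det:
  fixes A :: "'a \<Rightarrow> real^'n^'n"
  assumes "\<And>i j. ((\<lambda>t. A t $ i $ j) \<longlongrightarrow> B $ i $ j) F"
  shows "((\<lambda>t. det (A t)) \<longlongrightarrow> det B) F"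
  unfolding det_def by (intro tendsto_intros assms)

lemma det_one_plus_diag_conj:
  fixes d :: "real^'n"
  assumes K: "\<Sigma> ** K = mat 1" and d: "\<And>i. 0 \<le> d$i"
  shows "det (mat 1 + diag_mat d ** \<Sigma> ** diag_mat d) = det \<Sigma> * det (K + diag_mat (hadamard d d))"
proof -
  have nz: "det (mat 1 + diag_mat e ** \<Sigma> ** diag_mat e) = det \<Sigma> * det (K + diag_mat (hadamard e e))"
    if e: "\<And>i. e$i \<noteq> 0" for e
  proof -
    have dd: "det (diag_mat e) \<noteq> 0"
      using e by (subst det_diagonal) (auto simp: diag_mat_def)
    have ee: "diag_mat e ** diag_mat e = diag_mat (hadamard e e)"
      by (simp add: vec_eq_iff diag_mat_def hadamard_def matrix_matrix_mult_def if_distrib[of "\<lambda>t. t * _"] cong: if_cong)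
    have "diag_mat e ** \<Sigma> ** (K + diag_mat (hadamard e e)) =
        (mat 1 + diag_mat e ** \<Sigma> ** diag_mat e) ** diag_mat e"
      unfolding ee[symmetric] matrix_add_ldistrib
      by (simp add: matrix_add_rdistrib matrix_mul_assoc[symmetric] K)
    from arg_cong[OF this, of det] show ?thesis
      using dd by (simp add: det_mul mult_ac)
  qed
  \<comment> \<open>Weights that vanish are approximated by positive ones.\<close>
  let ?e = "\<lambda>n::nat. (\<chi> i. d$i + 1 / real (Suc n))"
  have lim: "(\<lambda>n. ?e n $ i) \<longlonglongrightarrow> d $ i" for i
    using tendsto_add[OF tendsto_const[of "d$i"] LIMSEQ_inverse_real_of_nat] by (simp add: inverse_eq_divide)
  have lim1: "(\<lambda>n. det (mat 1 + diag_mat (?e n) ** \<Sigma> ** diag_mat (?e n))) \<longlonglongrightarrow>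
      det (mat 1 + diag_mat d ** \<Sigma> ** diag_mat d)"
  proof (rule tendsto_det)
    have e: "(mat 1 + diag_mat e ** \<Sigma> ** diag_mat e) $ i $ j = mat 1 $ i $ j + e$i * \<Sigma>$i$j * e$j" for e i j
      by (simp add: diag_mat_def matrix_matrix_mult_def if_distrib[of "\<lambda>t. t * _"] if_distrib[of "\<lambda>t. _ * t"] cong: if_cong)
    show "(\<lambda>n. (mat 1 + diag_mat (?e n) ** \<Sigma> ** diag_mat (?e n)) $ i $ j) \<longlonglongrightarrow>
        (mat 1 + diag_mat d ** \<Sigma> ** diag_mat d) $ i $ j" for i j
      unfolding e by (intro tendsto_intros lim)
  qed
  have lim2: "(\<lambda>n. det \<Sigma> * det (K + diag_mat (hadamard (?e n) (?e n)))) \<longlonglongrightarrow>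
      det \<Sigma> * det (K + diag_mat (hadamard d d))"
  proof (intro tendsto_mult tendsto_const tendsto_det)
    have e: "(K + diag_mat (hadamard e e)) $ i $ j = K $ i $ j + (if i = j then e$i * e$i else 0)" for e i j
      by (simp add: diag_mat_def hadamard_def)
    show "(\<lambda>n. (K + diag_mat (hadamard (?e n) (?e n))) $ i $ j) \<longlonglongrightarrow>
        (K + diag_mat (hadamard d d)) $ i $ j" for i j
    proof (cases "i = j")
      case True
      then show ?thesis
        unfolding e using tendsto_add[OF tendsto_const[of "K$j$j"] tendsto_mult[OF lim[of j] lim[of j]]] by simp
    qed (simp only: e if_False tendsto_const)
  qed
  have "?e n $ i \<noteq> 0" for n i
    using d[of i] by (simp add: add_nonneg_eq_0_iff)
  then have eq: "det (mat 1 + diag_mat (?e n) ** \<Sigma> ** diag_mat (?e n)) =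
      det \<Sigma> * det (K + diag_mat (hadamard (?e n) (?e n)))" for n
    by (intro nz)
  show ?thesis using LIMSEQ_unique[OF lim1[unfolded eq] lim2] .
qed

theorem gaussian_vector_laplace:
  fixes X :: "'a \<Rightarrow> real^'n::{finite,wellorder}"
  assumes "prob_space M" "gaussian_vector M X" "mean_vector M X = 0"
    "covariance_matrix M X = \<Sigma>" "pos_def \<Sigma>" and K: "\<Sigma> ** K = mat 1" and l: "\<And>i. 0 \<le> l$i"
  shows "(\<integral>\<omega>. exp (- (\<Sum>i\<in>UNIV. l$i * (X \<omega> $ i)\<^sup>2)) \<partial>M) =
    1 / sqrt (det \<Sigma> * det (K + diag_mat (2 *\<^sub>R l)))"
    and "0 < det \<Sigma> * det (K + diag_mat (2 *\<^sub>R l))"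
proof -
  define d :: "real^'n::_" where "d = (\<chi> i. sqrt (2 * l$i))"
  have d: "0 \<le> d$i" "d$i * d$i = 2 * l$i" for i using l by (simp_all add: d_def)
  have dd: "hadamard d d = 2 *\<^sub>R l" by (simp add: vec_eq_iff hadamard_def d)
  have "- (hadamard d x \<bullet> hadamard d x) / 2 = - (\<Sum>i\<in>UNIV. l$i * (x$i)\<^sup>2)" for x
  proof -
    have "hadamard d x \<bullet> hadamard d x = (\<Sum>i\<in>UNIV. (d$i * d$i) * (x$i)\<^sup>2)"
      by (simp add: hadamard_def inner_vec_def power2_eq_square mult_ac)
    then show ?thesis by (simp add: d sum_distrib_left[symmetric] mult.assoc)
  qed
  then show "(\<integral>\<omega>. exp (- (\<Sum>i\<in>UNIV. l$i * (X \<omega> $ i)\<^sup>2)) \<partial>M) =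
    1 / sqrt (det \<Sigma> * det (K + diag_mat (2 *\<^sub>R l)))" "0 < det \<Sigma> * det (K + diag_mat (2 *\<^sub>R l))"
    using gaussian_vector_laplace_det[OF assms(1-5), of d]
    unfolding det_one_plus_diag_conj[OF K d(1)] dd by simp_all
qed


section \<open>Laplace transforms determine measures on the positive orthant\<close>

definition nonneg_vec :: "real^'n \<Rightarrow> bool" where "nonneg_vec y \<longleftrightarrow> (\<forall>i. 0 \<le> y$i)"

lemma borel_measurable_nonneg_vec [measurable]: "Measurable.pred borel (nonneg_vec :: real^'n \<Rightarrow> bool)"
  unfolding nonneg_vec_def by measurable

text \<open>Polynomial functions, generated so that integrals can be compared monomial by monomial.\<close>
inductive monomial_sum :: "(real^'n \<Rightarrow> real) \<Rightarrow> bool" where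
  monomial: "monomial_sum (\<lambda>x. c * (\<Prod>i\<in>UNIV. x$i ^ m i))"
| add: "monomial_sum f \<Longrightarrow> monomial_sum g \<Longrightarrow> monomial_sum (\<lambda>x. f x + g x)"

lemma monomial_sum_mult:
  assumes "monomial_sum f" "monomial_sum g" shows "monomial_sum (\<lambda>x. f x * g x)"
  using assms
proof (induction f)
  case (monomial c m)
  then show ?case
  proof (induction g)
    case (monomial c' m')
    have "(\<lambda>x. (c * (\<Prod>i\<in>UNIV. x$i ^ m i)) * (c' * (\<Prod>i\<in>UNIV. x$i ^ m' i))) =
        (\<lambda>x. (c * c') * (\<Prod>i\<in>UNIV. x$i ^ (m i + m' i)))"
      by (simp add: fun_eq_iff power_add prod.distrib)
    then show ?case using monomial_sum.monomial[of "c * c'" "\<lambda>i. m i + m' i"] by simp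
  next
    case (add g h)
    then show ?case by (simp add: distrib_left monomial_sum.add)
  qed
next
  case (add f h)
  then show ?case by (simp add: distrib_right monomial_sum.add)
qed

lemma monomial_sum_continuous: "monomial_sum f \<Longrightarrow> continuous_on A f"
  by (induction rule: monomial_sum.induct) (intro continuous_intros; assumption)+

lemma monomial_sum_const: "monomial_sum (\<lambda>_. c)"
  using monomial_sum.monomial[of c "\<lambda>_. 0"] by simp

lemma monomial_sum_component: "monomial_sum (\<lambda>x::real^'n. x $ j)"
proof -
  have "(\<Prod>i\<in>UNIV. x$i ^ (if i = j then 1 else 0)) = x $ j" for x :: "real^'n"
  proof -
    have "(\<Prod>i\<in>UNIV. x$i ^ (if i = j then 1 else 0)) = (\<Prod>i\<in>UNIV. if i = j then x$i else 1)"
      by (intro prod.cong) auto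
    then show ?thesis by simp
  qed
  then show ?thesis using monomial_sum.monomial[of 1 "\<lambda>i. if i = j then 1 else 0"] by simp
qed

lemma monomial_sum_dense:
  fixes S :: "(real^'n) set"
  assumes "compact S" "continuous_on S f" "0 < e"
  obtains g where "monomial_sum g" "\<And>x. x \<in> S \<Longrightarrow> \<bar>f x - g x\<bar> < e"
proof -
  interpret function_ring_on "Collect monomial_sum" S
  proof
    fix x y :: "real^'n" assume "x \<noteq> y"
    then obtain j where "x $ j \<noteq> y $ j" by (auto simp: vec_eq_iff)
    then show "\<exists>f\<in>Collect monomial_sum. f x \<noteq> f y"
      using monomial_sum_component by (intro bexI[of _ "\<lambda>x. x $ j"]) auto
  qed (use assms(1) in \<open>auto intro: monomial_sum_continuous monomial_sum.add monomial_sum_mult monomial_sum_const\<close>)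
  obtain g where "g \<in> Collect monomial_sum" "\<forall>x\<in>S. \<bar>f x - g x\<bar> < e"
    using Stone_Weierstrass_basic[OF assms(2,3)] by blast
  with that show ?thesis by blast
qed

text \<open>This maps the positive orthant into the unit cube, and Laplace transforms at integer points into
  moments.\<close>
definition exp_vec :: "real^'n \<Rightarrow> real^'n" where "exp_vec y = (\<chi> i. exp (- y$i))"

lemma exp_vec_measurable [measurable]: "exp_vec \<in> borel_measurable borel"
  unfolding exp_vec_def[abs_def] by (intro borel_measurable_continuous_onI continuous_intros)

lemma monomial_exp_vec:
  "(\<Prod>i\<in>UNIV. exp_vec y $ i ^ m i) = exp (- ((\<chi> i. real (m i)) \<bullet> y))"
  by (simp add: exp_vec_def exp_of_nat_mult[symmetric] exp_sum[symmetric] inner_vec_def sum_negf[symmetric]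
      del: sum_negf)

text \<open>Equal Laplace transforms give equal moments on the unit cube, and polynomials are uniformly
  dense there by the Stone--Weierstrass theorem.\<close>
lemma integral_eq_of_laplace_eq:
  fixes \<mu> \<nu> :: "(real^'n) measure" and f :: "real^'n \<Rightarrow> real"
  assumes \<mu>: "finite_measure \<mu>" "sets \<mu> = sets borel" "AE y in \<mu>. nonneg_vec y"
    and \<nu>: "finite_measure \<nu>" "sets \<nu> = sets borel" "AE y in \<nu>. nonneg_vec y"
    and eq: "\<And>l. nonneg_vec l \<Longrightarrow>
      (\<integral>\<^sup>+y. ennreal (exp (- (l \<bullet> y))) \<partial>\<mu>) = (\<integral>\<^sup>+y. ennreal (exp (- (l \<bullet> y))) \<partial>\<nu>)"
    and f: "continuous_on UNIV f"
  shows "(\<integral>y. f (exp_vec y) \<partial>\<mu>) = (\<integral>y. f (exp_vec y) \<partial>\<nu>)"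
proof -
  interpret \<mu>: finite_measure \<mu> by fact
  interpret \<nu>: finite_measure \<nu> by fact
  note [measurable_cong] = \<mu>(2) \<nu>(2)
  have [measurable]: "f \<in> borel_measurable borel" using f by (rule borel_measurable_continuous_onI)
  let ?S = "cbox (0::real^'n) (\<chi> i. 1)"
  have S: "exp_vec y \<in> ?S" if "nonneg_vec y" for y
    using that by (auto simp: exp_vec_def nonneg_vec_def mem_box_cart)
  have g_meas: "g \<in> borel_measurable borel" if "monomial_sum g" for g :: "real^'n \<Rightarrow> real"
    using monomial_sum_continuous[OF that] by (rule borel_measurable_continuous_onI)
  have bdd: "\<exists>B. \<forall>x\<in>?S. norm (g x) \<le> B" if "continuous_on ?S g" for g :: "real^'n \<Rightarrow> real"
    using compact_imp_bounded[OF compact_continuous_image[OF that]] by (auto simp: bounded_iff)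
  have int: "integrable \<mu> (\<lambda>y. g (exp_vec y))" "integrable \<nu> (\<lambda>y. g (exp_vec y))"
    if g: "continuous_on UNIV g" for g :: "real^'n \<Rightarrow> real"
  proof -
    have [measurable]: "g \<in> borel_measurable borel" using g by (rule borel_measurable_continuous_onI)
    obtain B where B: "\<forall>x\<in>?S. norm (g x) \<le> B"
      using bdd[OF continuous_on_subset[OF g]] by blast
    show "integrable \<mu> (\<lambda>y. g (exp_vec y))"
      by (rule \<mu>.integrable_const_bound[of _ B]) (use \<mu>(3) B S in \<open>auto elim!: eventually_mono\<close>)
    show "integrable \<nu> (\<lambda>y. g (exp_vec y))"
      by (rule \<nu>.integrable_const_bound[of _ B]) (use \<nu>(3) B S in \<open>auto elim!: eventually_mono\<close>)
  qed
  have mono_eq: "(\<integral>y. g (exp_vec y) \<partial>\<mu>) = (\<integral>y. g (exp_vec y) \<partial>\<nu>)" if "monomial_sum g" for g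
    using that
  proof induction
    case (monomial c m)
    have "nonneg_vec (\<chi> i. real (m i))" by (simp add: nonneg_vec_def)
    then have "(\<integral>y. exp (- ((\<chi> i. real (m i)) \<bullet> y)) \<partial>\<mu>) = (\<integral>y. exp (- ((\<chi> i. real (m i)) \<bullet> y)) \<partial>\<nu>)"
      by (simp add: integral_eq_nn_integral eq)
    then show ?case by (simp add: monomial_exp_vec)
  next
    case (add g h)
    then show ?case
      using int[OF monomial_sum_continuous[OF add(1)]] int[OF monomial_sum_continuous[OF add(2)]] by simp
  qed
  have "\<bar>(\<integral>y. f (exp_vec y) \<partial>\<mu>) - (\<integral>y. f (exp_vec y) \<partial>\<nu>)\<bar> \<le> e" if "0 < e" for e
  proof -
    define c where "c = measure \<mu> (space \<mu>) + measure \<nu> (space \<nu>) + 1"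
    have c: "0 < c" by (simp add: c_def add_nonneg_pos)
    obtain g where g: "monomial_sum g" "\<And>x. x \<in> ?S \<Longrightarrow> \<bar>f x - g x\<bar> < e / c"
      using monomial_sum_dense[of ?S f "e / c"] continuous_on_subset[OF f] \<open>0 < e\<close> c by auto
    note gc = monomial_sum_continuous[OF g(1), of UNIV]
    have "\<bar>(\<integral>y. f (exp_vec y) \<partial>\<mu>) - (\<integral>y. g (exp_vec y) \<partial>\<mu>)\<bar> = \<bar>\<integral>y. f (exp_vec y) - g (exp_vec y) \<partial>\<mu>\<bar>"
      using int[OF f] int[OF gc] by simp
    also have "\<dots> \<le> (\<integral>y. \<bar>f (exp_vec y) - g (exp_vec y)\<bar> \<partial>\<mu>)" by (rule integral_abs_bound)
    also have "\<dots> \<le> (\<integral>y. e / c \<partial>\<mu>)"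
      by (intro integral_mono_AE integrable_abs Bochner_Integration.integrable_diff int f gc)
        (use \<mu>(3) g S in \<open>auto elim!: eventually_mono intro: less_imp_le\<close>)
    finally have 1: "\<bar>(\<integral>y. f (exp_vec y) \<partial>\<mu>) - (\<integral>y. g (exp_vec y) \<partial>\<mu>)\<bar> \<le> e / c * measure \<mu> (space \<mu>)"
      by (simp add: mult.commute)
    have "\<bar>(\<integral>y. f (exp_vec y) \<partial>\<nu>) - (\<integral>y. g (exp_vec y) \<partial>\<nu>)\<bar> = \<bar>\<integral>y. f (exp_vec y) - g (exp_vec y) \<partial>\<nu>\<bar>"
      using int[OF f] int[OF gc] by simp
    also have "\<dots> \<le> (\<integral>y. \<bar>f (exp_vec y) - g (exp_vec y)\<bar> \<partial>\<nu>)" by (rule integral_abs_bound)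
    also have "\<dots> \<le> (\<integral>y. e / c \<partial>\<nu>)"
      by (intro integral_mono_AE integrable_abs Bochner_Integration.integrable_diff int f gc)
        (use \<nu>(3) g S in \<open>auto elim!: eventually_mono intro: less_imp_le\<close>)
    finally have 2: "\<bar>(\<integral>y. f (exp_vec y) \<partial>\<nu>) - (\<integral>y. g (exp_vec y) \<partial>\<nu>)\<bar> \<le> e / c * measure \<nu> (space \<nu>)"
      by (simp add: mult.commute)
    have "\<bar>(\<integral>y. f (exp_vec y) \<partial>\<mu>) - (\<integral>y. f (exp_vec y) \<partial>\<nu>)\<bar> \<le>
        e / c * measure \<mu> (space \<mu>) + e / c * measure \<nu> (space \<nu>)"
      using 1 2 mono_eq[OF g(1)] by linarith
    also have "\<dots> = e / c * (c - 1)" by (simp add: c_def distrib_left)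
    also have "\<dots> \<le> e" using c \<open>0 < e\<close> by (simp add: field_simps)
    finally show ?thesis .
  qed
  then show ?thesis by (metis abs_ge_zero abs_le_zero_iff dense_ge eq_iff_diff_eq_0)
qed

theorem laplace_transform_unique:
  fixes \<mu> \<nu> :: "(real^'n) measure"
  assumes \<mu>: "finite_measure \<mu>" "sets \<mu> = sets borel" "AE y in \<mu>. nonneg_vec y"
    and \<nu>: "finite_measure \<nu>" "sets \<nu> = sets borel" "AE y in \<nu>. nonneg_vec y"
    and eq: "\<And>l. nonneg_vec l \<Longrightarrow>
      (\<integral>\<^sup>+y. ennreal (exp (- (l \<bullet> y))) \<partial>\<mu>) = (\<integral>\<^sup>+y. ennreal (exp (- (l \<bullet> y))) \<partial>\<nu>)"
  shows "\<mu> = \<nu>"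
proof -
  interpret \<mu>: finite_measure \<mu> by fact
  interpret \<nu>: finite_measure \<nu> by fact
  note [measurable_cong] = \<mu>(2) \<nu>(2)
  let ?\<mu> = "distr \<mu> borel exp_vec" and ?\<nu> = "distr \<nu> borel exp_vec"
  interpret \<mu>': finite_measure ?\<mu> by (rule \<mu>.finite_measure_distr) measurable
  interpret \<nu>': finite_measure ?\<nu> by (rule \<nu>.finite_measure_distr) measurable
  have closed_eq: "emeasure ?\<mu> F = emeasure ?\<nu> F" if "closed F" for F
  proof (cases "F = {}")
    case False
    \<comment> \<open>Continuous approximations from above of the indicator function of \<open>F\<close>.\<close>
    define f where "f k x = max 0 (1 - real k * infdist x F)" for k :: nat and x :: "real^'n"
    have f_cont: "continuous_on UNIV (f k)" for k
      unfolding f_def by (intro continuous_intros)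
    have [measurable]: "f k \<in> borel_measurable borel" for k
      using f_cont by (rule borel_measurable_continuous_onI)
    have lim: "(\<lambda>k. f k x) \<longlonglongrightarrow> indicator F x" for x
    proof (cases "x \<in> F")
      case True
      then show ?thesis by (simp add: f_def)
    next
      case x: False
      have "infdist x F \<noteq> 0" using x \<open>closed F\<close> False in_closed_iff_infdist_zero by blast
      then have "0 < infdist x F" using infdist_nonneg[of x F] by linarith
      then obtain N where N: "1 < real N * infdist x F" using reals_Archimedean3 by blast
      have "f k x = 0" if "N \<le> k" for k
      proof -
        have "real N * infdist x F \<le> real k * infdist x F"
          using that by (intro mult_right_mono) (auto simp: infdist_nonneg)
        then show ?thesis using N by (simp add: f_def)
      qed
      then have "eventually (\<lambda>k. f k x = indicator F x) sequentially"
        using x by (auto simp: eventually_sequentially)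
      then show ?thesis by (rule tendsto_eventually)
    qed
    have bound: "norm (f k x) \<le> 1" for k x by (simp add: f_def infdist_nonneg)
    have [measurable]: "F \<in> sets borel" using that by simp
    have lim_\<mu>: "(\<lambda>k. \<integral>x. f k x \<partial>?\<mu>) \<longlonglongrightarrow> (\<integral>x. indicator F x \<partial>?\<mu>)"
      by (rule integral_dominated_convergence[where w = "\<lambda>_. 1"]) (use lim bound in auto)
    have lim_\<nu>: "(\<lambda>k. \<integral>x. f k x \<partial>?\<nu>) \<longlonglongrightarrow> (\<integral>x. indicator F x \<partial>?\<nu>)"
      by (rule integral_dominated_convergence[where w = "\<lambda>_. 1"]) (use lim bound in auto)
    have "(\<integral>x. f k x \<partial>?\<mu>) = (\<integral>x. f k x \<partial>?\<nu>)" for k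
      using integral_eq_of_laplace_eq[OF assms f_cont, of k] by (simp add: integral_distr)
    from LIMSEQ_unique[OF lim_\<mu>[unfolded this] lim_\<nu>]
    show ?thesis by (simp add: \<mu>'.emeasure_eq_measure \<nu>'.emeasure_eq_measure)
  qed simp
  have sets_borel: "sets (borel :: (real^'n) measure) = sigma_sets UNIV (Collect closed)"
    by (subst borel_eq_closed) simp
  have "?\<mu> = ?\<nu>"
  proof (rule measure_eqI_generator_eq[of "Collect closed" UNIV _ _ "\<lambda>_. UNIV"])
    show "Int_stable (Collect closed)" by (auto simp: Int_stable_def)
  qed (auto simp: closed_eq sets_borel)
  moreover define h where "h x = (\<chi> i. - ln (x $ i))" for x :: "real^'n"
  have h: "h (exp_vec y) = y" for y by (simp add: h_def exp_vec_def vec_eq_iff)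
  have [measurable]: "h \<in> borel_measurable borel"
    unfolding h_def[abs_def]
    by (subst borel_measurable_euclidean_space) (auto simp: Basis_vec_def inner_axis)
  have "distr ?\<mu> borel h = \<mu>" "distr ?\<nu> borel h = \<nu>"
    using \<mu>(2) \<nu>(2) by (simp_all add: distr_distr comp_def h distr_id2)
  ultimately show ?thesis by metis
qed


section \<open>Closure properties of Laplace transforms\<close>

text \<open>Laplace transforms of finite measures on the positive orthant; the value at \<open>0\<close> is the total mass.
  Outside the orthant nothing is claimed about \<open>\<psi>\<close>.\<close>
definition laplace_fun :: "(real^'n \<Rightarrow> real) \<Rightarrow> bool" where
  "laplace_fun \<psi> \<longleftrightarrow> (\<exists>\<mu>. sets \<mu> = sets borel \<and> (AE y in \<mu>. nonneg_vec y) \<and>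
     (\<forall>l. nonneg_vec l \<longrightarrow> 0 \<le> \<psi> l \<and> (\<integral>\<^sup>+y. ennreal (exp (- (l \<bullet> y))) \<partial>\<mu>) = ennreal (\<psi> l)))"

lemma laplace_funE:
  assumes "laplace_fun \<psi>"
  obtains \<mu> where "finite_measure \<mu>" "sets \<mu> = sets borel" "AE y in \<mu>. nonneg_vec y"
    "\<And>l. nonneg_vec l \<Longrightarrow> 0 \<le> \<psi> l"
    "\<And>l. nonneg_vec l \<Longrightarrow> (\<integral>\<^sup>+y. ennreal (exp (- (l \<bullet> y))) \<partial>\<mu>) = ennreal (\<psi> l)"
proof -
  obtain \<mu> where \<mu>: "sets \<mu> = sets borel" "AE y in \<mu>. nonneg_vec y"
    "\<And>l. nonneg_vec l \<Longrightarrow> 0 \<le> \<psi> l"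
    "\<And>l. nonneg_vec l \<Longrightarrow> (\<integral>\<^sup>+y. ennreal (exp (- (l \<bullet> y))) \<partial>\<mu>) = ennreal (\<psi> l)"
    using assms unfolding laplace_fun_def by blast
  have "emeasure \<mu> (space \<mu>) = ennreal (\<psi> 0)"
    using \<mu>(4)[of 0] by (simp add: nonneg_vec_def)
  then have "finite_measure \<mu>" by (intro finite_measureI) simp
  with \<mu> that show ?thesis by blast
qed

lemma laplace_fun_cong:
  assumes "laplace_fun \<phi>" "\<And>l. nonneg_vec l \<Longrightarrow> \<phi> l = \<psi> l" shows "laplace_fun \<psi>"
  using assms unfolding laplace_fun_def by metis

lemma laplace_fun_nonneg: "laplace_fun \<psi> \<Longrightarrow> nonneg_vec l \<Longrightarrow> 0 \<le> \<psi> l"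
  unfolding laplace_fun_def by blast

lemma laplace_fun_le_zero:
  assumes "laplace_fun \<psi>" "nonneg_vec l" shows "\<psi> l \<le> \<psi> 0"
proof -
  obtain \<mu> where \<mu>: "AE y in \<mu>. nonneg_vec y" "\<And>l. nonneg_vec l \<Longrightarrow> 0 \<le> \<psi> l"
    "\<And>l. nonneg_vec l \<Longrightarrow> (\<integral>\<^sup>+y. ennreal (exp (- (l \<bullet> y))) \<partial>\<mu>) = ennreal (\<psi> l)"
    using laplace_funE[OF assms(1)] by metis
  have 0: "nonneg_vec (0::real^'a)" by (simp add: nonneg_vec_def)
  have "AE y in \<mu>. ennreal (exp (- (l \<bullet> y))) \<le> ennreal (exp (- (0 \<bullet> y)))"
    using \<mu>(1) by eventually_elim
      (use assms(2) in \<open>auto simp: nonneg_vec_def inner_vec_def intro!: sum_nonneg\<close>)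
  then have "(\<integral>\<^sup>+y. ennreal (exp (- (l \<bullet> y))) \<partial>\<mu>) \<le> (\<integral>\<^sup>+y. ennreal (exp (- (0 \<bullet> y))) \<partial>\<mu>)"
    by (rule nn_integral_mono_AE)
  then show ?thesis using \<mu>(2)[OF 0] by (simp only: \<mu>(3)[OF assms(2)] \<mu>(3)[OF 0] ennreal_le_iff)
qed

lemma laplace_fun_one: "laplace_fun (\<lambda>_. 1)"
  unfolding laplace_fun_def
  by (intro exI[of _ "return borel 0"]) (auto simp: nn_integral_return AE_return nonneg_vec_def)

lemma laplace_fun_cmult:
  assumes "laplace_fun \<psi>" "0 \<le> c" shows "laplace_fun (\<lambda>l. c * \<psi> l)"
proof -
  obtain \<mu> where \<mu>: "sets \<mu> = sets borel" "AE y in \<mu>. nonneg_vec y" "\<And>l. nonneg_vec l \<Longrightarrow> 0 \<le> \<psi> l"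
    "\<And>l. nonneg_vec l \<Longrightarrow> (\<integral>\<^sup>+y. ennreal (exp (- (l \<bullet> y))) \<partial>\<mu>) = ennreal (\<psi> l)"
    using laplace_funE[OF assms(1)] by metis
  note [measurable_cong] = \<mu>(1)
  have "AE y in density \<mu> (\<lambda>_. ennreal c). nonneg_vec y"
    using \<mu>(2) by (subst AE_density) auto
  with \<mu> show ?thesis
    unfolding laplace_fun_def using assms(2)
    by (intro exI[of _ "density \<mu> (\<lambda>_. ennreal c)"])
      (auto simp: nn_integral_density nn_integral_cmult ennreal_mult)
qed

text \<open>Products of Laplace transforms belong to convolutions.\<close>
lemma laplace_fun_mult:
  assumes "laplace_fun \<phi>" "laplace_fun \<psi>" shows "laplace_fun (\<lambda>l. \<phi> l * \<psi> l)"
proof -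
  obtain \<mu> where \<mu>: "finite_measure \<mu>" "sets \<mu> = sets borel" "AE y in \<mu>. nonneg_vec y"
    "\<And>l. nonneg_vec l \<Longrightarrow> 0 \<le> \<phi> l"
    "\<And>l. nonneg_vec l \<Longrightarrow> (\<integral>\<^sup>+y. ennreal (exp (- (l \<bullet> y))) \<partial>\<mu>) = ennreal (\<phi> l)"
    using laplace_funE[OF assms(1)] by metis
  obtain \<nu> where \<nu>: "finite_measure \<nu>" "sets \<nu> = sets borel" "AE y in \<nu>. nonneg_vec y"
    "\<And>l. nonneg_vec l \<Longrightarrow> 0 \<le> \<psi> l"
    "\<And>l. nonneg_vec l \<Longrightarrow> (\<integral>\<^sup>+y. ennreal (exp (- (l \<bullet> y))) \<partial>\<nu>) = ennreal (\<psi> l)"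
    using laplace_funE[OF assms(2)] by metis
  interpret \<mu>: finite_measure \<mu> by fact
  interpret \<nu>: finite_measure \<nu> by fact
  interpret pair_sigma_finite \<mu> \<nu> ..
  note [measurable_cong] = \<mu>(2) \<nu>(2)
  let ?\<rho> = "distr (\<mu> \<Otimes>\<^sub>M \<nu>) borel (\<lambda>(x, y). x + y)"
  have "AE x in \<mu>. AE y in \<nu>. nonneg_vec (x + y)"
    using \<mu>(3)
  proof eventually_elim
    case (elim x)
    show ?case using \<nu>(3) by eventually_elim (use elim in \<open>simp add: nonneg_vec_def\<close>)
  qed
  then have "AE z in \<mu> \<Otimes>\<^sub>M \<nu>. nonneg_vec (case z of (x, y) \<Rightarrow> x + y)"
    by (intro AE_pair_measure) (auto simp: split_beta')
  then have ae: "AE y in ?\<rho>. nonneg_vec y"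
    by (subst AE_distr_iff) auto
  have "(\<integral>\<^sup>+z. ennreal (exp (- (l \<bullet> z))) \<partial>?\<rho>) = ennreal (\<phi> l * \<psi> l)" if l: "nonneg_vec l" for l
  proof -
    have "(\<integral>\<^sup>+z. ennreal (exp (- (l \<bullet> z))) \<partial>?\<rho>) =
        (\<integral>\<^sup>+x. \<integral>\<^sup>+y. ennreal (exp (- (l \<bullet> x))) * ennreal (exp (- (l \<bullet> y))) \<partial>\<nu> \<partial>\<mu>)"
      by (simp add: nn_integral_distr \<nu>.nn_integral_fst[symmetric] inner_add_right exp_add exp_diff
          ennreal_mult[symmetric] exp_minus divide_inverse)
    also have "\<dots> = ennreal (\<phi> l) * ennreal (\<psi> l)"
      by (simp add: nn_integral_cmult nn_integral_multc \<mu>(5)[OF l] \<nu>(5)[OF l])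
    finally show ?thesis by (simp add: ennreal_mult \<mu>(4)[OF l] \<nu>(4)[OF l])
  qed
  with ae \<mu>(4) \<nu>(4) show ?thesis unfolding laplace_fun_def by (intro exI[of _ ?\<rho>]) auto
qed

lemma laplace_fun_power: "laplace_fun \<psi> \<Longrightarrow> laplace_fun (\<lambda>l. \<psi> l ^ k)"
  by (induction k) (auto intro: laplace_fun_one laplace_fun_mult)

definition countable_sum_measure :: "(nat \<Rightarrow> 'a measure) \<Rightarrow> 'a measure \<Rightarrow> 'a measure" where
  "countable_sum_measure \<mu> B = measure_of (space B) (sets B) (\<lambda>A. \<Sum>k. emeasure (\<mu> k) A)"

lemma sets_countable_sum_measure [simp, measurable_cong]: "sets (countable_sum_measure \<mu> B) = sets B"
  by (simp add: countable_sum_measure_def)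

lemma emeasure_countable_sum_measure:
  assumes "\<And>k. sets (\<mu> k) = sets B" "A \<in> sets B"
  shows "emeasure (countable_sum_measure \<mu> B) A = (\<Sum>k. emeasure (\<mu> k) A)"
  unfolding countable_sum_measure_def
proof (rule emeasure_measure_of_sigma)
  show "countably_additive (sets B) (\<lambda>A. \<Sum>k. emeasure (\<mu> k) A)"
  proof (rule countably_additiveI)
    fix A :: "nat \<Rightarrow> 'a set" assume A: "range A \<subseteq> sets B" "disjoint_family A" "(\<Union>i. A i) \<in> sets B"
    have "(\<Sum>i. \<Sum>k. emeasure (\<mu> k) (A i)) = (\<Sum>k. \<Sum>i. emeasure (\<mu> k) (A i))"
      using nn_integral_suminf[of "\<lambda>k i. emeasure (\<mu> k) (A i)" "count_space UNIV"]
      by (simp add: nn_integral_count_space_nat)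
    also have "\<dots> = (\<Sum>k. emeasure (\<mu> k) (\<Union>i. A i))"
      using A assms(1) by (intro arg_cong[of _ _ suminf] ext suminf_emeasure) auto
    finally show "(\<Sum>i. \<Sum>k. emeasure (\<mu> k) (A i)) = (\<Sum>k. emeasure (\<mu> k) (\<Union>i. A i))" .
  qed
qed (use assms in \<open>auto simp: positive_def sets.sigma_algebra_axioms\<close>)

lemma nn_integral_countable_sum_measure:
  assumes sets: "\<And>k. sets (\<mu> k) = sets B" and f: "f \<in> borel_measurable B"
  shows "(\<integral>\<^sup>+x. f x \<partial>countable_sum_measure \<mu> B) = (\<Sum>k. \<integral>\<^sup>+x. f x \<partial>\<mu> k)"
  using f
proof (induction rule: borel_measurable_induct)
  case (cong f g)
  have sp: "space (\<mu> k) = space B" "space (countable_sum_measure \<mu> B) = space B" for k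
    using sets sets_eq_imp_space_eq by (metis sets_countable_sum_measure)+
  have "(\<integral>\<^sup>+x. f x \<partial>\<mu> k) = (\<integral>\<^sup>+x. g x \<partial>\<mu> k)" for k
    by (rule nn_integral_cong) (use cong sp in auto)
  moreover have "(\<integral>\<^sup>+x. f x \<partial>countable_sum_measure \<mu> B) = (\<integral>\<^sup>+x. g x \<partial>countable_sum_measure \<mu> B)"
    by (rule nn_integral_cong) (use cong sp in auto)
  ultimately show ?case using cong by simp
next
  case (set A)
  then show ?case using sets by (simp add: emeasure_countable_sum_measure)
next
  case (mult u c)
  have "u \<in> borel_measurable (\<mu> k)" for k using mult sets by (simp cong: measurable_cong_sets)
  then show ?case using mult by (simp add: nn_integral_cmult)
next
  case (add u v)
  have "u \<in> borel_measurable (\<mu> k)" "v \<in> borel_measurable (\<mu> k)" for k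
    using add sets by (simp_all cong: measurable_cong_sets)
  then show ?case using add by (simp add: nn_integral_add suminf_add[symmetric])
next
  case (seq U)
  have [measurable]: "U i \<in> borel_measurable (\<mu> k)" for i k
    using seq sets by (simp cong: measurable_cong_sets)
  have "(\<integral>\<^sup>+x. (SUP i. U i) x \<partial>countable_sum_measure \<mu> B) = (SUP i. \<integral>\<^sup>+x. U i x \<partial>countable_sum_measure \<mu> B)"
    unfolding SUP_apply using seq by (intro nn_integral_monotone_convergence_SUP) (auto simp: incseq_def le_fun_def)
  also have "\<dots> = (SUP i. \<Sum>k. \<integral>\<^sup>+x. U i x \<partial>\<mu> k)" using seq by simp
  also have "\<dots> = (\<Sum>k. SUP i. \<integral>\<^sup>+x. U i x \<partial>\<mu> k)"
    using seq(3) by (intro ennreal_suminf_SUP_eq[symmetric]) (auto simp: incseq_def le_fun_def intro!: nn_integral_mono)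
  also have "\<dots> = (\<Sum>k. \<integral>\<^sup>+x. (SUP i. U i) x \<partial>\<mu> k)"
    unfolding SUP_apply using seq by (subst nn_integral_monotone_convergence_SUP) (auto simp: incseq_def le_fun_def)
  finally show ?case .
qed

lemma laplace_fun_sums:
  assumes \<phi>: "\<And>k. laplace_fun (\<phi> k)" and s: "\<And>l. nonneg_vec l \<Longrightarrow> (\<lambda>k. \<phi> k l) sums \<psi> l"
  shows "laplace_fun \<psi>"
proof -
  have "\<forall>k. \<exists>\<mu>. sets \<mu> = sets borel \<and> (AE y in \<mu>. nonneg_vec y) \<and>
     (\<forall>l. nonneg_vec l \<longrightarrow> 0 \<le> \<phi> k l \<and> (\<integral>\<^sup>+y. ennreal (exp (- (l \<bullet> y))) \<partial>\<mu>) = ennreal (\<phi> k l))"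
    using \<phi> unfolding laplace_fun_def by blast
  then obtain \<mu> where \<mu>: "\<And>k. sets (\<mu> k) = sets borel" "\<And>k. AE y in \<mu> k. nonneg_vec y"
    "\<And>k l. nonneg_vec l \<Longrightarrow> 0 \<le> \<phi> k l"
    "\<And>k l. nonneg_vec l \<Longrightarrow> (\<integral>\<^sup>+y. ennreal (exp (- (l \<bullet> y))) \<partial>\<mu> k) = ennreal (\<phi> k l)"
    by metis
  let ?\<mu> = "countable_sum_measure \<mu> borel"
  have "{y. \<not> nonneg_vec y} \<in> null_sets (\<mu> k)" for k
    using \<mu>(2)[of k] \<mu>(1)[of k] sets_eq_imp_space_eq[OF \<mu>(1)[of k]] by (subst (asm) AE_iff_null) auto
  then have "emeasure ?\<mu> {y. \<not> nonneg_vec y} = 0"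
    by (subst emeasure_countable_sum_measure) (auto simp: \<mu>(1) null_sets_def)
  then have "AE y in ?\<mu>. nonneg_vec y"
    by (intro AE_I[of _ _ "{y. \<not> nonneg_vec y}"]) auto
  moreover have "(\<integral>\<^sup>+y. ennreal (exp (- (l \<bullet> y))) \<partial>?\<mu>) = ennreal (\<psi> l)" if l: "nonneg_vec l" for l
    using s[OF l] \<mu>(3)[OF l]
    by (simp add: nn_integral_countable_sum_measure \<mu>(1) \<mu>(4)[OF l] suminf_ennreal2 sums_iff)
  moreover have "0 \<le> \<psi> l" if l: "nonneg_vec l" for l
    using s[OF l] \<mu>(3)[OF l] by (metis sums_iff suminf_nonneg)
  ultimately show ?thesis unfolding laplace_fun_def by (intro exI[of _ ?\<mu>]) auto
qed

lemma laplace_fun_add: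
  assumes "laplace_fun \<phi>" "laplace_fun \<psi>" shows "laplace_fun (\<lambda>l. \<phi> l + \<psi> l)"
proof (rule laplace_fun_sums)
  have z: "laplace_fun (\<lambda>_::real^'a. 0)" using laplace_fun_cmult[OF laplace_fun_one, of 0] by simp
  show "laplace_fun ((\<lambda>k. if k = 0 then \<phi> else if k = 1 then \<psi> else (\<lambda>_. 0)) k)" for k :: nat
    using assms z by simp
  show "(\<lambda>k. (if k = 0 then \<phi> else if k = 1 then \<psi> else (\<lambda>_. 0)) l) sums (\<phi> l + \<psi> l)" for l
    using sums_finite[of "{0, 1}" "\<lambda>k. (if k = 0 then \<phi> else if k = 1 then \<psi> else (\<lambda>_. 0)) l"] by simp
qed

lemma laplace_fun_scale:
  assumes "laplace_fun \<psi>" "0 \<le> c" shows "laplace_fun (\<lambda>l. \<psi> (c *\<^sub>R l))"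
proof -
  obtain \<mu> where \<mu>: "sets \<mu> = sets borel" "AE y in \<mu>. nonneg_vec y" "\<And>l. nonneg_vec l \<Longrightarrow> 0 \<le> \<psi> l"
    "\<And>l. nonneg_vec l \<Longrightarrow> (\<integral>\<^sup>+y. ennreal (exp (- (l \<bullet> y))) \<partial>\<mu>) = ennreal (\<psi> l)"
    using laplace_funE[OF assms(1)] by metis
  note [measurable_cong] = \<mu>(1)
  have "AE y in \<mu>. nonneg_vec (c *\<^sub>R y)"
    using \<mu>(2) by eventually_elim (use assms(2) in \<open>simp add: nonneg_vec_def\<close>)
  then have "AE y in distr \<mu> borel (\<lambda>y. c *\<^sub>R y). nonneg_vec y" by (subst AE_distr_iff) auto
  moreover have "0 \<le> \<psi> (c *\<^sub>R l) \<and>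
      (\<integral>\<^sup>+y. ennreal (exp (- (l \<bullet> y))) \<partial>distr \<mu> borel (\<lambda>y. c *\<^sub>R y)) = ennreal (\<psi> (c *\<^sub>R l))"
    if "nonneg_vec l" for l
    using \<mu>(3,4)[of "c *\<^sub>R l"] that assms(2) by (simp add: nn_integral_distr nonneg_vec_def)
  ultimately show ?thesis unfolding laplace_fun_def by (intro exI[of _ "distr \<mu> borel (\<lambda>y. c *\<^sub>R y)"]) auto
qed

text \<open>The binomial series of \<open>(1 - u) powr (- \<theta>)\<close> has nonnegative coefficients, and it converges on the
  whole orthant since Laplace transforms are largest at \<open>0\<close>.\<close>
lemma laplace_fun_negative_binomial:
  assumes u: "laplace_fun u" "u 0 < 1" and "0 < \<theta>"
  shows "laplace_fun (\<lambda>l. (1 - u l) powr (- \<theta>))"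
proof (rule laplace_fun_sums)
  show "laplace_fun (\<lambda>l. (pochhammer \<theta> k / fact k) * u l ^ k)" for k
    using assms by (intro laplace_fun_cmult laplace_fun_power) (auto intro!: pochhammer_nonneg divide_nonneg_nonneg)
  fix l :: "real^'a" assume l: "nonneg_vec l"
  have "\<bar>- u l\<bar> < 1"
    using laplace_fun_nonneg[OF u(1) l] laplace_fun_le_zero[OF u(1) l] u(2) by simp
  from gen_binomial_real[OF this, of "- \<theta>"]
  have "(\<lambda>k. (- \<theta> gchoose k) * (- u l) ^ k) sums (1 - u l) powr (- \<theta>)" by simp
  also have "(\<lambda>k. (- \<theta> gchoose k) * (- u l) ^ k) = (\<lambda>k. (pochhammer \<theta> k / fact k) * u l ^ k)"
  proof
    fix k
    have "(- \<theta> gchoose k) * (- u l) ^ k = ((-1) ^ k * (-1) ^ k) * (pochhammer \<theta> k / fact k) * u l ^ k"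
      by (simp add: gbinomial_pochhammer power_minus[of "u l"])
    then show "(- \<theta> gchoose k) * (- u l) ^ k = (pochhammer \<theta> k / fact k) * u l ^ k"
      by (simp add: power_mult_distrib[symmetric])
  qed
  finally show "(\<lambda>k. (pochhammer \<theta> k / fact k) * u l ^ k) sums (1 - u l) powr (- \<theta>)" .
qed

text \<open>This is the Laplace transform of a multiple of the gamma distribution with shape \<open>\<theta>\<close> and rate \<open>\<kappa>\<close>,
  placed on the coordinate axis \<open>i\<close>.\<close>
lemma laplace_fun_gamma:
  assumes "0 < \<kappa>" "0 < \<theta>"
  shows "laplace_fun (\<lambda>l. (\<kappa> + l $ i) powr (- \<theta>))"
proof -
  define g where "g s = ennreal (indicator {0..} s * s powr (\<theta> - 1) * exp (- \<kappa> * s) / Gamma \<theta>)" for s :: real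
  have [measurable]: "g \<in> borel_measurable borel" unfolding g_def by measurable
  have [measurable]: "(\<lambda>s::real. s *\<^sub>R axis i 1 :: real^'a) \<in> borel_measurable borel"
    by (intro borel_measurable_continuous_onI continuous_intros)
  let ?\<mu> = "distr (density lborel g) borel (\<lambda>s. s *\<^sub>R axis i 1) :: (real^'a) measure"
  have "AE s in density lborel g. nonneg_vec (s *\<^sub>R axis i 1 :: real^'a)"
    by (subst AE_density) (auto intro!: AE_I2 simp: g_def nonneg_vec_def axis_def split: split_indicator_asm if_splits)
  then have "AE y in ?\<mu>. nonneg_vec y" by (subst AE_distr_iff) auto
  moreover have "(\<integral>\<^sup>+y. ennreal (exp (- (l \<bullet> y))) \<partial>?\<mu>) = ennreal ((\<kappa> + l $ i) powr (- \<theta>))"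
    if "nonneg_vec l" for l
  proof -
    define c where "c = \<kappa> + l $ i"
    have c: "0 < c" using that assms by (simp add: c_def nonneg_vec_def add_pos_nonneg)
    have G: "0 < Gamma \<theta>" using assms by (simp add: Gamma_real_pos)
    have "(\<integral>\<^sup>+y. ennreal (exp (- (l \<bullet> y))) \<partial>?\<mu>) =
        (\<integral>\<^sup>+s. ennreal (indicator {0..} s * s powr (\<theta> - 1) / exp (c * s) / Gamma \<theta>) \<partial>lborel)"
      using G by (simp add: nn_integral_distr nn_integral_density g_def ennreal_mult[symmetric] c_def inner_axis
          exp_add exp_minus field_simps)
    also have "\<dots> = ennreal (1 / c) * (\<integral>\<^sup>+t. ennreal (indicator {0..} (t / c) * (t / c) powr (\<theta> - 1) / exp t / Gamma \<theta>) \<partial>lborel)"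
      using c by (subst nn_integral_real_affine[where c = "1 / c" and t = 0]) auto
    also have "(\<lambda>t. ennreal (indicator {0..} (t / c) * (t / c) powr (\<theta> - 1) / exp t / Gamma \<theta>)) =
        (\<lambda>t. ennreal (c powr (1 - \<theta>) / Gamma \<theta>) * ennreal (indicator {0..} t * t powr (\<theta> - 1) / exp t))"
      using c G by (auto simp: fun_eq_iff ennreal_mult[symmetric] powr_divide powr_diff zero_le_divide_iff
          field_simps split: split_indicator)
    also have "ennreal (1 / c) * (\<integral>\<^sup>+t. ennreal (c powr (1 - \<theta>) / Gamma \<theta>) * ennreal (indicator {0..} t * t powr (\<theta> - 1) / exp t) \<partial>lborel)
        = ennreal (1 / c) * (ennreal (c powr (1 - \<theta>) / Gamma \<theta>) * ennreal (Gamma \<theta>))"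
      by (subst nn_integral_cmult) (auto simp: Gamma_conv_nn_integral_real[OF assms(2)])
    also have "\<dots> = ennreal (c powr (- \<theta>))"
      using c G by (simp add: ennreal_mult[symmetric] powr_diff powr_minus field_simps)
    finally show ?thesis by (simp add: c_def)
  qed
  ultimately show ?thesis unfolding laplace_fun_def by (intro exI[of _ ?\<mu>]) auto
qed

lemma laplace_fun_inverse_linear:
  assumes "0 < \<kappa>" shows "laplace_fun (\<lambda>l. 1 / (\<kappa> + l $ i))"
  by (rule laplace_fun_cong[OF laplace_fun_gamma[OF assms zero_less_one, of i]])
    (use assms in \<open>auto simp: powr_minus_divide nonneg_vec_def add_pos_nonneg powr_one\<close>)


section \<open>Negative powers of the determinant\<close>

text \<open>The determinant of the symmetric matrix with diagonal blocks \<open>diag(k1, k2)\<close>, \<open>diag(k3, k4)\<close> and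
  off-diagonal block with rows \<open>(b1, b2)\<close>, \<open>(b3, b4)\<close>.\<close>
definition det_poly :: "real \<Rightarrow> real \<Rightarrow> real \<Rightarrow> real \<Rightarrow> real \<Rightarrow> real \<Rightarrow> real \<Rightarrow> real \<Rightarrow> real" where
  "det_poly k1 k2 k3 k4 b1 b2 b3 b4 = k1 * k2 * k3 * k4 - k1 * k3 * b4\<^sup>2 - k1 * k4 * b3\<^sup>2
     - k2 * k3 * b2\<^sup>2 - k2 * k4 * b1\<^sup>2 + (b1 * b4 - b2 * b3)\<^sup>2"

lemma det_poly_swap: "det_poly k3 k4 k1 k2 b1 b3 b2 b4 = det_poly k1 k2 k3 k4 b1 b2 b3 b4"
  by (simp add: det_poly_def algebra_simps)

text \<open>The second factor is the determinant of the Schur complement of the lower block.\<close>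
lemma det_poly_schur:
  fixes k1 k2 k3 k4 b1 b2 b3 b4 :: real
  assumes k: "0 < k1" "0 < k2" "0 < k3" "0 < k4"
  defines "g1 \<equiv> b1\<^sup>2 / k3 + b2\<^sup>2 / k4" and "g \<equiv> b1*b3 / k3 + b2*b4 / k4" and "g2 \<equiv> b3\<^sup>2 / k3 + b4\<^sup>2 / k4"
  shows "det_poly k1 k2 k3 k4 b1 b2 b3 b4 = k3 * k4 * ((k1 - g1) * (k2 - g2) - g\<^sup>2)"
proof -
  have "k3 * k4 * ((k1 - g1) * (k2 - g2) - g\<^sup>2) =
      k3 * k4 * k1 * k2 - k1 * (k3 * k4 * g2) - k2 * (k3 * k4 * g1) + k3 * k4 * (g1 * g2 - g\<^sup>2)"
    by (simp add: algebra_simps)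
  moreover have "k3 * k4 * g2 = k4 * b3\<^sup>2 + k3 * b4\<^sup>2" "k3 * k4 * g1 = k4 * b1\<^sup>2 + k3 * b2\<^sup>2"
    using k by (simp_all add: g1_def g2_def field_simps)
  moreover have "k3 * k4 * (g1 * g2 - g\<^sup>2) = (b1 * b4 - b2 * b3)\<^sup>2"
    using k by (simp add: g1_def g2_def g_def field_simps power2_eq_square)
  ultimately have "k3 * k4 * ((k1 - g1) * (k2 - g2) - g\<^sup>2) =
      k3 * k4 * k1 * k2 - k1 * (k4 * b3\<^sup>2 + k3 * b4\<^sup>2) - k2 * (k4 * b1\<^sup>2 + k3 * b2\<^sup>2) + (b1 * b4 - b2 * b3)\<^sup>2"
    by (simp only:)
  then show ?thesis by (simp add: det_poly_def algebra_simps)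
qed

text \<open>Taking \<open>c1 c2 c3 c4\<close> out of the determinant leaves \<open>(1 - u1) (1 - u2) - g\<^sup>2 / (c1 c2)\<close> with
  \<open>u1 = g1 / c1\<close> and \<open>u2 = g2 / c2\<close>, which equals \<open>(1 - u1) (1 - u2) (1 - w)\<close>. All of \<open>u1\<close>, \<open>u2\<close>,
  \<open>w\<close> are Laplace transforms: this is clear for \<open>g1\<close> and \<open>g2\<close>, and up to sign alignment makes
  it true of \<open>g\<close>, which enters \<open>w\<close> as a square. Negative powers of \<open>1 - u\<close> and of the linear factors
  are again Laplace transforms.\<close>
lemma laplace_fun_det_poly_power:
  fixes i j :: "'n::finite"
  assumes k: "0 < k1" "0 < k2" "0 < k3" "k3 \<le> k4" and \<theta>: "0 < \<theta>"
    and al: "(b1*b3) * (b1*b3 + b2*b4) \<ge> 0"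
    and pd: "b1\<^sup>2 / k3 + b2\<^sup>2 / k4 < k1" "b3\<^sup>2 / k3 + b4\<^sup>2 / k4 < k2"
      "(b1*b3 / k3 + b2*b4 / k4)\<^sup>2 < (k1 - (b1\<^sup>2 / k3 + b2\<^sup>2 / k4)) * (k2 - (b3\<^sup>2 / k3 + b4\<^sup>2 / k4))"
  shows "laplace_fun (\<lambda>l. det_poly (k1 + l$i) (k2 + l$i) (k3 + l$j) (k4 + l$j) b1 b2 b3 b4 powr (- \<theta>))"
proof -
  have k4: "0 < k4" using k by simp
  obtain s where s: "s * s = 1" "s * (b1*b3) \<ge> 0" "s * (b1*b3 + b2*b4) \<ge> 0"
    using common_sign[OF al] .
  define c1 c2 c3 c4 where c_def: "c1 l = k1 + l$i" "c2 l = k2 + l$i" "c3 l = k3 + l$j" "c4 l = k4 + l$j"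
    for l :: "real^'n"
  have c: "0 < c1 l" "0 < c2 l" "0 < c3 l" "0 < c4 l" if "nonneg_vec l" for l
    using that k k4 by (simp_all add: c_def nonneg_vec_def add_pos_nonneg)
  have inv: "laplace_fun (\<lambda>l. 1 / c1 l)" "laplace_fun (\<lambda>l. 1 / c2 l)" "laplace_fun (\<lambda>l. 1 / c3 l)" "laplace_fun (\<lambda>l. 1 / c4 l)"
    unfolding c_def using k k4 by (auto intro: laplace_fun_inverse_linear)
  define g1 where "g1 l = b1\<^sup>2 / c3 l + b2\<^sup>2 / c4 l" for l
  define g2 where "g2 l = b3\<^sup>2 / c3 l + b4\<^sup>2 / c4 l" for l
  define g where "g l = b1*b3 / c3 l + b2*b4 / c4 l" for l
  have lg1: "laplace_fun g1"
    using laplace_fun_add[OF laplace_fun_cmult[OF inv(3), of "b1\<^sup>2"] laplace_fun_cmult[OF inv(4), of "b2\<^sup>2"]]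
    by (simp add: g1_def[abs_def])
  have lg2: "laplace_fun g2"
    using laplace_fun_add[OF laplace_fun_cmult[OF inv(3), of "b3\<^sup>2"] laplace_fun_cmult[OF inv(4), of "b4\<^sup>2"]]
    by (simp add: g2_def[abs_def])
  have lg: "laplace_fun (\<lambda>l. s * g l)"
  proof (rule laplace_fun_cong)
    show "laplace_fun (\<lambda>l. (s * (b1*b3 + b2*b4)) * (1 / c4 l) + (s * (b1*b3) * (k4 - k3)) * (1 / c3 l * (1 / c4 l)))"
      using k s by (intro laplace_fun_add laplace_fun_cmult laplace_fun_mult inv) auto
    fix l :: "real^'n" assume l: "nonneg_vec l"
    \<comment> \<open>The weights are nonnegative because \<open>k3 \<le> k4\<close> and \<open>s\<close> is the common sign of \<open>b1 b3\<close> and \<open>b1 b3 + b2 b4\<close>.\<close>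
    have kd: "k4 - k3 = c4 l - c3 l" by (simp add: c_def)
    show "(s * (b1*b3 + b2*b4)) * (1 / c4 l) + (s * (b1*b3) * (k4 - k3)) * (1 / c3 l * (1 / c4 l)) = s * g l"
      unfolding kd g_def using c[OF l] by (simp add: field_simps)
  qed
  define u1 where "u1 l = g1 l * (1 / c1 l)" for l
  define u2 where "u2 l = g2 l * (1 / c2 l)" for l
  have lu: "laplace_fun u1" "laplace_fun u2"
    unfolding u1_def[abs_def] u2_def[abs_def] by (intro laplace_fun_mult lg1 lg2 inv)+
  have at0: "c1 0 = k1" "c2 0 = k2" "c3 0 = k3" "c4 0 = k4" by (simp_all add: c_def)
  have u0: "u1 0 < 1" "u2 0 < 1" using pd(1,2) k by (simp_all add: u1_def u2_def g1_def g2_def at0)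
  have u: "u1 l < 1" "u2 l < 1" if "nonneg_vec l" for l
    using laplace_fun_le_zero[OF lu(1) that] laplace_fun_le_zero[OF lu(2) that] u0 by linarith+
  have z: "nonneg_vec (0 :: real^'n)" by (simp add: nonneg_vec_def)
  define w where "w l = (s * g l) * (s * g l) * (1 / c1 l * (1 / c2 l)) * ((1 - u1 l) powr (- 1) * (1 - u2 l) powr (- 1))" for l
  have lw: "laplace_fun w"
    unfolding w_def[abs_def]
    by (intro laplace_fun_mult lg inv laplace_fun_negative_binomial lu u0 zero_less_one)
  have w: "w l = (g l)\<^sup>2 / ((c1 l - g1 l) * (c2 l - g2 l))" if l: "nonneg_vec l" for l
  proof -
    have "(s * g l) * (s * g l) = (s * s) * (g l)\<^sup>2" by (simp add: power2_eq_square mult_ac)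
    moreover have "(1 - u1 l) powr (- 1) = 1 / (1 - u1 l)" "(1 - u2 l) powr (- 1) = 1 / (1 - u2 l)"
      using u[OF l] by (simp_all add: powr_minus_divide)
    moreover have "c1 l * (1 - u1 l) = c1 l - g1 l" "c2 l * (1 - u2 l) = c2 l - g2 l"
      using c[OF l] by (simp_all add: u1_def u2_def field_simps)
    moreover have "w l = (s * g l) * (s * g l) / ((c1 l * (1 - u1 l)) * (c2 l * (1 - u2 l)))"
      unfolding w_def calculation(2,3) using c[OF l] u[OF l] by (simp add: field_simps)
    ultimately show ?thesis using s(1) by simp
  qed
  have w0: "w 0 < 1"
    unfolding w[OF z] using pd by (simp add: g_def g1_def g2_def at0)
  show ?thesis
  proof (rule laplace_fun_cong)
    show "laplace_fun (\<lambda>l. c1 l powr (- \<theta>) * c2 l powr (- \<theta>) * (c3 l powr (- \<theta>) * c4 l powr (- \<theta>)) *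
        ((1 - u1 l) powr (- \<theta>) * (1 - u2 l) powr (- \<theta>) * (1 - w l) powr (- \<theta>)))"
      unfolding c_def
      by (intro laplace_fun_mult laplace_fun_gamma laplace_fun_negative_binomial lu lw u0 w0 \<theta> k k4)
    fix l :: "real^'n" assume l: "nonneg_vec l"
    have wl: "w l < 1" using laplace_fun_le_zero[OF lw l] w0 by linarith
    have cu: "c1 l * (1 - u1 l) = c1 l - g1 l" "c2 l * (1 - u2 l) = c2 l - g2 l"
      using c[OF l] by (simp_all add: u1_def u2_def field_simps)
    then have pos: "0 < c1 l - g1 l" "0 < c2 l - g2 l"
      using c[OF l] u[OF l] by (metis diff_gt_0_iff_gt mult_pos_pos)+
    have "det_poly (c1 l) (c2 l) (c3 l) (c4 l) b1 b2 b3 b4 =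
        c3 l * c4 l * ((c1 l - g1 l) * (c2 l - g2 l) - (g l)\<^sup>2)"
      using det_poly_schur[OF c[OF l]] by (simp add: g1_def g2_def g_def)
    also have "(c1 l - g1 l) * (c2 l - g2 l) - (g l)\<^sup>2 = ((c1 l - g1 l) * (c2 l - g2 l)) * (1 - w l)"
      unfolding w[OF l] using pos by (simp add: right_diff_distrib)
    also have "c3 l * c4 l * (((c1 l - g1 l) * (c2 l - g2 l)) * (1 - w l)) =
        c1 l * c2 l * (c3 l * c4 l) * ((1 - u1 l) * (1 - u2 l) * (1 - w l))"
      unfolding cu[symmetric] by (simp only: mult_ac)
    finally have "det_poly (c1 l) (c2 l) (c3 l) (c4 l) b1 b2 b3 b4 =
      c1 l * c2 l * (c3 l * c4 l) * ((1 - u1 l) * (1 - u2 l) * (1 - w l))" .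
    then show "c1 l powr (- \<theta>) * c2 l powr (- \<theta>) * (c3 l powr (- \<theta>) * c4 l powr (- \<theta>)) *
        ((1 - u1 l) powr (- \<theta>) * (1 - u2 l) powr (- \<theta>) * (1 - w l) powr (- \<theta>)) =
      det_poly (k1 + l$i) (k2 + l$i) (k3 + l$j) (k4 + l$j) b1 b2 b3 b4 powr (- \<theta>)"
      unfolding c_def[symmetric]
      using c[OF l] u[OF l] wl by (simp add: powr_mult less_imp_le)
  qed
qed

lemma det_4:
  "det (A :: real^4^4) =
    A$1$1 * (A$2$2 * (A$3$3 * A$4$4 - A$3$4 * A$4$3) - A$2$3 * (A$3$2 * A$4$4 - A$3$4 * A$4$2) + A$2$4 * (A$3$2 * A$4$3 - A$3$3 * A$4$2))
  - A$1$2 * (A$2$1 * (A$3$3 * A$4$4 - A$3$4 * A$4$3) - A$2$3 * (A$3$1 * A$4$4 - A$3$4 * A$4$1) + A$2$4 * (A$3$1 * A$4$3 - A$3$3 * A$4$1))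
  + A$1$3 * (A$2$1 * (A$3$2 * A$4$4 - A$3$4 * A$4$2) - A$2$2 * (A$3$1 * A$4$4 - A$3$4 * A$4$1) + A$2$4 * (A$3$1 * A$4$2 - A$3$2 * A$4$1))
  - A$1$4 * (A$2$1 * (A$3$2 * A$4$3 - A$3$3 * A$4$2) - A$2$2 * (A$3$1 * A$4$3 - A$3$3 * A$4$1) + A$2$3 * (A$3$1 * A$4$2 - A$3$2 * A$4$1))"
proof -
  have f1: "finite {2::4, 3, 4}" "1 \<notin> {2::4, 3, 4}" by auto
  have f2: "finite {3::4, 4}" "2 \<notin> {3::4, 4}" by auto
  have f3: "finite {4::4}" "3 \<notin> {4::4}" by auto
  show ?thesis
    unfolding det_def UNIV_4
    unfolding sum_over_permutations_insert[OF f1]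
    unfolding sum_over_permutations_insert[OF f2]
    unfolding sum_over_permutations_insert[OF f3]
    unfolding permutes_sing
    by (simp add: sign_swap_id permutation_swap_id permutation_compose sign_compose sign_id swap_id_eq)
      (simp add: algebra_simps)
qed

lemma pos_def_schur:
  fixes q :: "real^4^4"
  assumes q: "pos_def q" and z: "q$1$2 = 0" "q$3$4 = 0"
  defines "g1 \<equiv> (q$1$3)\<^sup>2 / q$3$3 + (q$1$4)\<^sup>2 / q$4$4" and "g2 \<equiv> (q$2$3)\<^sup>2 / q$3$3 + (q$2$4)\<^sup>2 / q$4$4"
    and "g \<equiv> q$1$3 * q$2$3 / q$3$3 + q$1$4 * q$2$4 / q$4$4"
  shows "0 < q$1$1" "0 < q$2$2" "0 < q$3$3" "0 < q$4$4"
    and "g1 < q$1$1" "g2 < q$2$2" "g\<^sup>2 < (q$1$1 - g1) * (q$2$2 - g2)"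
proof -
  note sym = pos_def_sym[OF q]
  have s: "q$2$1 = 0" "q$4$3 = 0" "q$3$1 = q$1$3" "q$3$2 = q$2$3" "q$4$1 = q$1$4" "q$4$2 = q$2$4"
    using z sym by metis+
  have pos: "0 < q $ i $ i" for i
  proof -
    have "0 < axis i 1 \<bullet> (q *v axis i 1)" using q by (simp add: pos_def_def)
    then show ?thesis by (simp add: inner_axis' matrix_vector_mult_basis column_def)
  qed
  then show p: "0 < q$1$1" "0 < q$2$2" "0 < q$3$3" "0 < q$4$4" by blast+
  have form: "0 < (q$1$1 - g1) * x\<^sup>2 - 2 * g * x * y + (q$2$2 - g2) * y\<^sup>2" if "x \<noteq> 0 \<or> y \<noteq> 0" for x y
  proof -
    \<comment> \<open>The last two coordinates minimise the quadratic form once the first two are given.\<close>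
    define t where "t = (vector [x, y, - (q$1$3 * x + q$2$3 * y) / q$3$3, - (q$1$4 * x + q$2$4 * y) / q$4$4] :: real^4)"
    have t: "t$1 = x" "t$2 = y" "t$3 = - (q$1$3 * x + q$2$3 * y) / q$3$3" "t$4 = - (q$1$4 * x + q$2$4 * y) / q$4$4"
      by (simp_all add: t_def vector_4)
    have c: "q$3$3 * t$3 = - (q$1$3 * x + q$2$3 * y)" "q$4$4 * t$4 = - (q$1$4 * x + q$2$4 * y)"
      using p by (simp_all add: t)
    have "t \<noteq> 0" using that t by auto
    then have "0 < t \<bullet> (q *v t)" using q by (simp add: pos_def_def)
    also have "t \<bullet> (q *v t) = q$1$1 * x\<^sup>2 + q$2$2 * y\<^sup>2
        + (2 * (q$1$3 * x + q$2$3 * y) + q$3$3 * t$3) * t$3 + (2 * (q$1$4 * x + q$2$4 * y) + q$4$4 * t$4) * t$4"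
      by (simp add: inner_vec_def matrix_vector_mult_def sum_4 s z t(1,2) power2_eq_square algebra_simps)
    also have "\<dots> = q$1$1 * x\<^sup>2 + q$2$2 * y\<^sup>2
        - (q$1$3 * x + q$2$3 * y)\<^sup>2 / q$3$3 - (q$1$4 * x + q$2$4 * y)\<^sup>2 / q$4$4"
    proof -
      have "(2 * u + - u) * (- u / c) = - (u\<^sup>2 / c)" for u c :: real by (simp add: power2_eq_square)
      then show ?thesis unfolding c by (simp only: t(3,4))
    qed
    also have "\<dots> = (q$1$1 - g1) * x\<^sup>2 - 2 * g * x * y + (q$2$2 - g2) * y\<^sup>2"
      using p by (simp add: g1_def g2_def g_def field_simps power2_eq_square)
    finally show ?thesis .
  qed
  show g1: "g1 < q$1$1" using form[of 1 0] by simp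
  show "g2 < q$2$2" using form[of 0 1] by simp
  have "0 < (q$1$1 - g1) * g\<^sup>2 - 2 * g * g * (q$1$1 - g1) + (q$2$2 - g2) * (q$1$1 - g1)\<^sup>2"
    using form[of g "q$1$1 - g1"] g1 by simp
  also have "\<dots> = (q$1$1 - g1) * ((q$1$1 - g1) * (q$2$2 - g2) - g\<^sup>2)"
    by (simp add: power2_eq_square algebra_simps)
  finally show "g\<^sup>2 < (q$1$1 - g1) * (q$2$2 - g2)"
    using g1 by (simp add: zero_less_mult_iff)
qed

definition block_weights :: "real^2 \<Rightarrow> real^4" where
  "block_weights l = vector [l$1, l$1, l$2, l$2]"

lemma block_weights_nth [simp]:
  "block_weights l $ 1 = l$1" "block_weights l $ 2 = l$1" "block_weights l $ 3 = l$2" "block_weights l $ 4 = l$2"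
  by (simp_all add: block_weights_def vector_4)

lemma det_plus_block_weights:
  assumes W: "signature22 W" and sym: "transpose K = K"
  defines "q \<equiv> conj_by W K"
  assumes z: "q$1$2 = 0" "q$3$4 = 0"
  shows "det (K + diag_mat (block_weights l)) =
    det_poly (q$1$1 + l$1) (q$2$2 + l$1) (q$3$3 + l$2) (q$4$4 + l$2) (q$1$3) (q$1$4) (q$2$3) (q$2$4)"
proof -
  have o: "orthogonal_matrix W" using W by (rule signature22_orthogonal)
  have W0: "W$1$3 = 0" "W$1$4 = 0" "W$2$3 = 0" "W$2$4 = 0" "W$3$1 = 0" "W$3$2 = 0" "W$4$1 = 0" "W$4$2 = 0"
    using W by (auto simp: signature22_def block12_def block21_def vec_eq_iff forall_2 lo_def hi_def)
  have comm: "diag_mat (block_weights l) ** W = W ** diag_mat (block_weights l)"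
    by (simp add: vec_eq_iff forall_4 matrix_matrix_mult_def diag_mat_def sum_4 W0)
  have "conj_by W (K + diag_mat (block_weights l)) =
      q + transpose W ** (diag_mat (block_weights l) ** W)"
    by (simp add: conj_by_def q_def matrix_add_ldistrib matrix_add_rdistrib matrix_mul_assoc)
  also have "\<dots> = q + diag_mat (block_weights l)"
    using o unfolding comm by (simp add: matrix_mul_assoc orthogonal_matrix)
  finally have c: "conj_by W (K + diag_mat (block_weights l)) = q + diag_mat (block_weights l)" .
  have "det W * det W = 1"
    using o by (metis det_I det_mul det_transpose orthogonal_matrix)
  then have "det (K + diag_mat (block_weights l)) = det (q + diag_mat (block_weights l))"
    unfolding c[symmetric] conj_by_def by (simp add: det_mul)
  also have "\<dots> = det_poly (q$1$1 + l$1) (q$2$2 + l$1) (q$3$3 + l$2) (q$4$4 + l$2) (q$1$3) (q$1$4) (q$2$3) (q$2$4)"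
  proof -
    have s: "q$2$1 = 0" "q$4$3 = 0" "q$3$1 = q$1$3" "q$3$2 = q$2$3" "q$4$1 = q$1$4" "q$4$2 = q$2$4"
      using z unfolding q_def by (metis conj_by_sym[OF sym])+
    show ?thesis
      unfolding det_4 det_poly_def
      by (simp add: diag_mat_def s z) (simp add: power2_eq_square algebra_simps)
  qed
  finally show ?thesis .
qed

text \<open>The two disjuncts of alignment are interchanged by exchanging the two blocks.\<close>
lemma laplace_fun_det_power:
  assumes W: "signature22 W" and K: "pos_def K"
  defines "q \<equiv> conj_by W K"
  assumes z: "q$1$2 = 0" "q$3$4 = 0" and ord: "q$1$1 \<le> q$2$2" "q$3$3 \<le> q$4$4"
    and al: "aligned (q$1$3) (q$1$4) (q$2$3) (q$2$4)" and \<theta>: "0 < \<theta>"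
  shows "laplace_fun (\<lambda>l. det (K + diag_mat (block_weights l)) powr (- \<theta>))"
proof -
  have sym: "transpose K = K" using K by (simp add: pos_def_def)
  have q: "pos_def q" unfolding q_def by (rule pos_def_conj_by[OF K signature22_orthogonal[OF W]])
  note sch = pos_def_schur[OF q z]
  have det: "det (K + diag_mat (block_weights l)) =
      det_poly (q$1$1 + l$1) (q$2$2 + l$1) (q$3$3 + l$2) (q$4$4 + l$2) (q$1$3) (q$1$4) (q$2$3) (q$2$4)" for l
    unfolding q_def by (rule det_plus_block_weights[OF W sym z[unfolded q_def]])
  consider (left) "(q$1$3 * q$2$3) * (q$1$3 * q$2$3 + q$1$4 * q$2$4) \<ge> 0"
    | (right) "(q$1$3 * q$1$4) * (q$1$3 * q$1$4 + q$2$3 * q$2$4) \<ge> 0"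
    using al by (auto simp: aligned_def)
  then show ?thesis
  proof cases
    case left
    show ?thesis
      unfolding det using sch ord by (intro laplace_fun_det_poly_power left \<theta>)
  next
    case right
    \<comment> \<open>Conjugation by \<open>S\<close> exchanges the two blocks.\<close>
    define S :: "real^4^4" where
      "S = vector [vector [0,0,1,0], vector [0,0,0,1], vector [1,0,0,0], vector [0,1,0,0]]"
    define r where "r = conj_by S q"
    have o: "orthogonal_matrix S"
      by (simp add: S_def orthogonal_matrix vec_eq_iff forall_4 matrix_matrix_mult_def transpose_def
          sum_4 vector_4 mat_def)
    have s: "q$3$1 = q$1$3" "q$3$2 = q$2$3" "q$4$1 = q$1$4" "q$4$2 = q$2$4"
      unfolding q_def by (metis conj_by_sym[OF sym])+
    have r: "r$1$1 = q$3$3" "r$2$2 = q$4$4" "r$3$3 = q$1$1" "r$4$4 = q$2$2" "r$1$2 = 0" "r$3$4 = 0"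
      "r$1$3 = q$1$3" "r$1$4 = q$2$3" "r$2$3 = q$1$4" "r$2$4 = q$2$4"
      by (simp_all add: r_def conj_by_def S_def matrix_matrix_mult_def transpose_def sum_4 vector_4 s z)
    note sch' = pos_def_schur[OF pos_def_conj_by[OF q o], folded r_def, OF r(5,6), unfolded r]
    show ?thesis
      unfolding det det_poly_swap[symmetric, of "q$1$1 + _"]
      using sch' ord by (intro laplace_fun_det_poly_power right \<theta>)
  qed
qed


section \<open>Infinite divisibility from roots of the Laplace transform\<close>

text \<open>The measure behind the \<open>n\<close>-th root is a probability measure; the coordinates of its \<open>n\<close>-fold
  product are the independent summands, and uniqueness of Laplace transforms identifies the law of
  their sum.\<close>
lemma infinitely_divisible_of_laplace_roots:
  fixes Y :: "'a \<Rightarrow> real^'n"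
  assumes "prob_space M" and Y [measurable]: "Y \<in> borel_measurable M" and Y0: "\<And>\<omega>. nonneg_vec (Y \<omega>)"
    and roots: "\<And>n::nat. 0 < n \<Longrightarrow> \<exists>\<psi>. laplace_fun \<psi> \<and>
      (\<forall>l. nonneg_vec l \<longrightarrow> \<psi> l ^ n = (\<integral>\<omega>. exp (- (l \<bullet> Y \<omega>)) \<partial>M))"
  shows "infinitely_divisible M Y"
  unfolding infinitely_divisible_def
proof (intro allI impI)
  interpret M: prob_space M by fact
  fix n :: nat assume n: "1 \<le> n"
  obtain \<psi> where \<psi>: "laplace_fun \<psi>" "\<And>l. nonneg_vec l \<Longrightarrow> \<psi> l ^ n = (\<integral>\<omega>. exp (- (l \<bullet> Y \<omega>)) \<partial>M)"
    using roots[of n] n by auto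
  obtain \<mu> where \<mu>: "finite_measure \<mu>" "sets \<mu> = sets borel" "AE y in \<mu>. nonneg_vec y"
    "\<And>l. nonneg_vec l \<Longrightarrow> 0 \<le> \<psi> l"
    "\<And>l. nonneg_vec l \<Longrightarrow> (\<integral>\<^sup>+y. ennreal (exp (- (l \<bullet> y))) \<partial>\<mu>) = ennreal (\<psi> l)"
    using laplace_funE[OF \<psi>(1)] by metis
  note [measurable_cong] = \<mu>(2)
  have z: "nonneg_vec (0 :: real^'n)" by (simp add: nonneg_vec_def)
  \<comment> \<open>At \<open>0\<close> a Laplace transform is the total mass.\<close>
  have "\<psi> 0 ^ n = 1" using \<psi>(2)[OF z] by (simp add: M.prob_space)
  then have "\<psi> 0 = 1" using \<mu>(4)[OF z] n power_eq_imp_eq_base[of "\<psi> 0" n 1] by simp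
  then have "emeasure \<mu> (space \<mu>) = 1" using \<mu>(5)[OF z] by simp
  then have P: "prob_space \<mu>" by (rule prob_spaceI)
  let ?N = "\<Pi>\<^sub>M i\<in>{..<n}. \<mu>"
  let ?Z = "\<lambda>(i::nat) (\<omega> :: nat \<Rightarrow> real^'n). \<omega> i"
  interpret N: prob_space ?N by (intro prob_space_PiM P)
  have rv: "?Z i \<in> borel_measurable ?N" if "i \<in> {..<n}" for i
    using measurable_component_singleton[OF that, of "\<lambda>_. \<mu>"] by (simp cong: measurable_cong_sets add: \<mu>(2))
  have dZ: "distr ?N borel (?Z i) = \<mu>" if "i < n" for i
  proof -
    have "distr ?N borel (?Z i) = distr ?N \<mu> (?Z i)" by (intro distr_cong) (simp_all add: \<mu>(2))
    also have "\<dots> = \<mu>" using that P by (intro distr_PiM_component) auto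
    finally show ?thesis .
  qed
  have ne: "{..<n} \<noteq> {}" using n by (auto simp: lessThan_empty_iff)
  have indep: "N.indep_vars (\<lambda>_. borel) ?Z {..<n}"
  proof (subst N.indep_vars_iff_distr_eq_PiM'[OF ne rv])
    have "distr ?N (\<Pi>\<^sub>M i\<in>{..<n}. borel) (\<lambda>x. \<lambda>i\<in>{..<n}. x i) = distr ?N ?N (\<lambda>x. x)"
      by (rule distr_cong) (auto simp: space_PiM PiE_def extensional_restrict \<mu>(2) intro!: sets_PiM_cong)
    also have "\<dots> = ?N" by (rule distr_id)
    also have "\<dots> = (\<Pi>\<^sub>M i\<in>{..<n}. distr ?N borel (?Z i))" by (intro PiM_cong) (simp_all add: dZ)
    finally show "distr ?N (\<Pi>\<^sub>M i\<in>{..<n}. borel) (\<lambda>x. \<lambda>i\<in>{..<n}. x i) = (\<Pi>\<^sub>M i\<in>{..<n}. distr ?N borel (?Z i))" .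
  qed
  have sum_meas [measurable]: "(\<lambda>\<omega>. \<Sum>i<n. ?Z i \<omega>) \<in> borel_measurable ?N"
    by (intro borel_measurable_sum rv)
  have "distr M borel Y = distr ?N borel (\<lambda>\<omega>. \<Sum>i<n. ?Z i \<omega>)"
  proof (rule laplace_transform_unique)
    show "finite_measure (distr M borel Y)" by (rule M.finite_measure_distr) measurable
    show "finite_measure (distr ?N borel (\<lambda>\<omega>. \<Sum>i<n. ?Z i \<omega>))" by (rule N.finite_measure_distr) measurable
    show "AE y in distr M borel Y. nonneg_vec y" by (subst AE_distr_iff) (auto simp: Y0)
    have "AE \<omega> in ?N. \<forall>i\<in>{..<n}. nonneg_vec (?Z i \<omega>)"
      by (intro AE_finite_allI AE_PiM_component) (use P \<mu>(3) in auto)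
    then have "AE \<omega> in ?N. nonneg_vec (\<Sum>i<n. ?Z i \<omega>)"
      by eventually_elim (auto simp: nonneg_vec_def intro!: sum_nonneg)
    then show "AE y in distr ?N borel (\<lambda>\<omega>. \<Sum>i<n. ?Z i \<omega>). nonneg_vec y"
      by (subst AE_distr_iff) auto
    fix l :: "real^'n" assume l: "nonneg_vec l"
    have "(\<integral>\<^sup>+y. ennreal (exp (- (l \<bullet> y))) \<partial>distr ?N borel (\<lambda>\<omega>. \<Sum>i<n. ?Z i \<omega>)) =
        (\<integral>\<^sup>+\<omega>. (\<Prod>i<n. ennreal (exp (- (l \<bullet> ?Z i \<omega>)))) \<partial>?N)"
      by (simp add: nn_integral_distr inner_sum_right exp_sum[symmetric] sum_negf[symmetric] prod_ennreal del: sum_negf)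
    also have "\<dots> = (\<Prod>i<n. \<integral>\<^sup>+\<omega>. ennreal (exp (- (l \<bullet> ?Z i \<omega>))) \<partial>?N)"
      by (intro N.indep_vars_nn_integral N.indep_vars_compose2[OF indep]) auto
    also have "\<dots> = (\<Prod>i<n. \<integral>\<^sup>+y. ennreal (exp (- (l \<bullet> y))) \<partial>distr ?N borel (?Z i))"
      by (intro prod.cong refl nn_integral_distr[symmetric] rv) auto
    also have "\<dots> = ennreal (\<psi> l ^ n)"
      by (simp add: dZ \<mu>(5)[OF l] ennreal_power \<mu>(4)[OF l])
    also have "\<dots> = (\<integral>\<^sup>+\<omega>. ennreal (exp (- (l \<bullet> Y \<omega>))) \<partial>M)"
    proof -
      have "0 \<le> l \<bullet> Y \<omega>" for \<omega>
        using l Y0[of \<omega>] by (auto simp: nonneg_vec_def inner_vec_def intro!: sum_nonneg)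
      then show ?thesis
        unfolding \<psi>(2)[OF l]
        by (intro nn_integral_eq_integral[symmetric] M.integrable_const_bound[of _ 1]) auto
    qed
    finally show "(\<integral>\<^sup>+y. ennreal (exp (- (l \<bullet> y))) \<partial>distr M borel Y) =
        (\<integral>\<^sup>+y. ennreal (exp (- (l \<bullet> y))) \<partial>distr ?N borel (\<lambda>\<omega>. \<Sum>i<n. ?Z i \<omega>))"
      by (simp add: nn_integral_distr)
  qed simp_all
  then show "\<exists>(N :: (nat \<Rightarrow> real^'n) measure) Z. prob_space N \<and> prob_space.indep_vars N (\<lambda>_. borel) Z {..<n} \<and>
      (\<forall>i<n. \<forall>j<n. distr N borel (Z i) = distr N borel (Z j)) \<and>
      distr M borel Y = distr N borel (\<lambda>\<omega>. \<Sum>i<n. Z i \<omega>)"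
    using N.prob_space_axioms indep dZ by (intro exI[of _ ?N] exI[of _ ?Z]) auto
qed


section \<open>From large a to the inverse covariance matrix\<close>

lemma left_inverse_eq_right_inverse:
  fixes A B C :: "real^'n^'n"
  assumes "B ** A = mat 1" "A ** C = mat 1" shows "B = C"
proof -
  have "B = B ** (A ** C)" by (simp only: assms matrix_mul_rid)
  also have "\<dots> = (B ** A) ** C" by (rule matrix_mul_assoc)
  also have "\<dots> = C" by (simp add: assms)
  finally show ?thesis .
qed

lemma pos_def_invertible:
  fixes A :: "real^'n^'n"
  assumes "pos_def A" obtains B where "A ** B = mat 1" "B ** A = mat 1" "pos_def B"
proof -
  have "x = 0" if "A *v x = 0" for x
  proof (rule ccontr)
    assume "x \<noteq> 0"
    then have "0 < x \<bullet> (A *v x)" using assms by (simp add: pos_def_def)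
    then show False using that by simp
  qed
  then have "invertible A"
    using invertible_left_inverse matrix_left_invertible_ker by blast
  then obtain B where B: "A ** B = mat 1" "B ** A = mat 1" unfolding invertible_def by blast
  have "transpose B ** transpose A = mat 1"
    by (simp add: matrix_transpose_mul[symmetric] B)
  then have "transpose B ** A = mat 1" using assms by (simp add: pos_def_def)
  then have tB: "transpose B = B" using B(1) by (rule left_inverse_eq_right_inverse)
  have "0 < x \<bullet> (B *v x)" if "x \<noteq> 0" for x
  proof -
    have x: "A *v (B *v x) = x" by (simp add: matrix_vector_mul_assoc B)
    then have "B *v x \<noteq> 0" using that by auto
    then have "0 < (B *v x) \<bullet> (A *v (B *v x))" using assms by (simp add: pos_def_def)
    then show ?thesis by (simp add: x inner_commute)
  qed
  then have "pos_def B" using tB by (simp add: pos_def_def)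
  with B that show ?thesis by blast
qed

definition entry_sum :: "real^'n^'n \<Rightarrow> real" where
  "entry_sum A = (\<Sum>i\<in>UNIV. \<Sum>j\<in>UNIV. \<bar>A$i$j\<bar>)"

lemma quadratic_form_le_entry_sum: "(x :: real^'n) \<bullet> (A *v x) \<le> entry_sum A * (x \<bullet> x)"
proof -
  have b: "\<bar>x$i\<bar> * \<bar>x$j\<bar> \<le> x \<bullet> x" for i j
    using mult_mono[OF component_le_norm_cart[of x i] component_le_norm_cart[of x j]]
    by (simp add: dot_square_norm power2_eq_square)
  have "x \<bullet> (A *v x) = (\<Sum>i\<in>UNIV. \<Sum>j\<in>UNIV. x$i * A$i$j * x$j)"
    by (simp add: inner_vec_def matrix_vector_mult_def sum_distrib_left mult.assoc)
  also have "\<dots> \<le> (\<Sum>i\<in>UNIV. \<Sum>j\<in>UNIV. \<bar>A$i$j\<bar> * (x \<bullet> x))"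
  proof (intro sum_mono)
    fix i j
    have "x$i * A$i$j * x$j \<le> \<bar>x$i * A$i$j * x$j\<bar>" by simp
    also have "\<dots> = \<bar>A$i$j\<bar> * (\<bar>x$i\<bar> * \<bar>x$j\<bar>)" by (simp add: abs_mult)
    also have "\<dots> \<le> \<bar>A$i$j\<bar> * (x \<bullet> x)" by (intro mult_left_mono b) simp
    finally show "x$i * A$i$j * x$j \<le> \<bar>A$i$j\<bar> * (x \<bullet> x)" .
  qed
  also have "\<dots> = entry_sum A * (x \<bullet> x)" by (simp add: entry_sum_def sum_distrib_right)
  finally show ?thesis .
qed

lemma pos_def_entry_bound:
  assumes "pos_def A" shows "2 * \<bar>A$i$j\<bar> \<le> A$i$i + A$j$j"
proof -
  note nn = pos_def_nonneg[OF assms] and sym = pos_def_sym[OF assms, of i j]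
  have e: "axis p 1 \<bullet> (A *v axis r 1) = A$p$r" for p r
    by (simp add: inner_axis' matrix_vector_mult_basis column_def)
  have "0 \<le> (axis i 1 + axis j 1) \<bullet> (A *v (axis i 1 + axis j 1))"
    "0 \<le> (axis i 1 - axis j 1) \<bullet> (A *v (axis i 1 - axis j 1))" by (rule nn)+
  then show ?thesis
    using sym by (simp add: matrix_vector_right_distrib matrix_vector_mult_diff_distrib inner_add_left
        inner_add_right inner_diff_left inner_diff_right e)
qed

text \<open>With \<open>R = (I + a \<Sigma>)\<^sup>-\<^sup>1\<close> one has \<open>a R = K Q = K - K R\<close>. The matrix \<open>Q = I - R\<close> is positive definite
  with diagonal entries below \<open>1\<close>, hence bounded; so \<open>R\<close> tends to \<open>0\<close> and \<open>a R\<close> to \<open>K\<close>.\<close>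
lemma scaled_resolvent_tendsto:
  fixes \<Sigma> :: "real^4^4"
  assumes S: "pos_def \<Sigma>" and K: "\<Sigma> ** K = mat 1" "K ** \<Sigma> = mat 1"
  shows "((\<lambda>a. a * matrix_inv (mat 1 + a *\<^sub>R \<Sigma>) $ i $ j) \<longlongrightarrow> K $ i $ j) at_top"
proof -
  define R where "R a = matrix_inv (mat 1 + a *\<^sub>R \<Sigma>)" for a
  have R: "a *\<^sub>R R a = K ** Qmat \<Sigma> a" and Rb: "\<bar>Qmat \<Sigma> a $ p $ r\<bar> \<le> 1" if a: "0 < a" for a p r
  proof -
    have "pos_def (mat 1 + a *\<^sub>R \<Sigma>)"
    proof -
      have "(mat 1 + a *\<^sub>R \<Sigma>) *v x = x + a *\<^sub>R (\<Sigma> *v x)" for x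
        by (simp add: matrix_vector_mult_add_rdistrib scaleR_matrix_vector_assoc)
      moreover have "transpose (mat 1 + a *\<^sub>R \<Sigma>) = mat 1 + a *\<^sub>R \<Sigma>"
        using S by (auto simp: pos_def_def transpose_def vec_eq_iff mat_def)
      ultimately show ?thesis using S a by (auto simp: pos_def_def inner_add_right intro!: add_pos_pos)
    qed
    then obtain B where B: "(mat 1 + a *\<^sub>R \<Sigma>) ** B = mat 1" "B ** (mat 1 + a *\<^sub>R \<Sigma>) = mat 1" "pos_def B"
      by (rule pos_def_invertible)
    have "invertible (mat 1 + a *\<^sub>R \<Sigma>)" using B unfolding invertible_def by blast
    then have "(mat 1 + a *\<^sub>R \<Sigma>) ** R a = mat 1 \<and> R a ** (mat 1 + a *\<^sub>R \<Sigma>) = mat 1"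
      unfolding R_def matrix_inv_def invertible_def by (rule someI_ex)
    then have NR: "(mat 1 + a *\<^sub>R \<Sigma>) ** R a = mat 1" and "R a = B"
      using left_inverse_eq_right_inverse[OF _ B(1)] by auto
    have Q: "Qmat \<Sigma> a = mat 1 - R a" by (simp add: Qmat_def R_def)
    have "a *\<^sub>R (\<Sigma> ** R a) = Qmat \<Sigma> a"
      using NR unfolding Q by (simp add: matrix_add_rdistrib scaleR_matrix_mult algebra_simps)
    then have "K ** Qmat \<Sigma> a = a *\<^sub>R (K ** (\<Sigma> ** R a))" by (simp only: scaleR_matrix_mult(2)[symmetric])
    then show "a *\<^sub>R R a = K ** Qmat \<Sigma> a" by (simp add: matrix_mul_assoc K)
    have d: "Qmat \<Sigma> a $ s $ s \<le> 1" for s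
    proof -
      have "0 < axis s 1 \<bullet> (B *v axis s 1)" using B(3) by (simp add: pos_def_def)
      then have "0 < B $ s $ s" by (simp add: inner_axis' matrix_vector_mult_basis column_def)
      then show ?thesis by (simp add: Q \<open>R a = B\<close> mat_def)
    qed
    show "\<bar>Qmat \<Sigma> a $ p $ r\<bar> \<le> 1"
      using pos_def_entry_bound[OF pos_def_Qmat[OF S a], of p r] d[of p] d[of r] by linarith
  qed
  have R0: "((\<lambda>a. R a $ p $ r) \<longlongrightarrow> 0) at_top" for p r
  proof (rule Lim_null_comparison)
    show "\<forall>\<^sub>F a in at_top. norm (R a $ p $ r) \<le> (\<Sum>k\<in>UNIV. \<bar>K $ p $ k\<bar>) / a"
      using eventually_gt_at_top[of 0]
    proof eventually_elim
      case (elim a)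
      have "a * \<bar>R a $ p $ r\<bar> = \<bar>(a *\<^sub>R R a) $ p $ r\<bar>" using elim by (simp add: abs_mult)
      also have "\<dots> = \<bar>\<Sum>k\<in>UNIV. K $ p $ k * Qmat \<Sigma> a $ k $ r\<bar>"
        unfolding R[OF elim] by (simp add: matrix_matrix_mult_def)
      also have "\<dots> \<le> (\<Sum>k\<in>UNIV. \<bar>K $ p $ k * Qmat \<Sigma> a $ k $ r\<bar>)" by (rule sum_abs)
      also have "\<dots> \<le> (\<Sum>k\<in>UNIV. \<bar>K $ p $ k\<bar>)"
        using Rb[OF elim] by (intro sum_mono) (simp add: abs_mult mult_left_le)
      finally show ?case using elim by (simp add: field_simps)
    qed
    show "((\<lambda>a. (\<Sum>k\<in>UNIV. \<bar>K $ p $ k\<bar>) / a) \<longlongrightarrow> 0) at_top"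
      by (rule tendsto_divide_0[OF tendsto_const]) (simp add: filterlim_ident filterlim_at_top_imp_at_infinity)
  qed
  have "((\<lambda>a. K $ i $ j - (\<Sum>k\<in>UNIV. K $ i $ k * R a $ k $ j)) \<longlongrightarrow> K $ i $ j - (\<Sum>k\<in>UNIV. K $ i $ k * 0)) at_top"
    by (intro tendsto_intros R0)
  moreover have "\<forall>\<^sub>F a in at_top. K $ i $ j - (\<Sum>k\<in>UNIV. K $ i $ k * R a $ k $ j) = a * R a $ i $ j"
    using eventually_gt_at_top[of 0]
  proof eventually_elim
    case (elim a)
    have "a * R a $ i $ j = (K ** Qmat \<Sigma> a) $ i $ j" by (simp add: R[OF elim, symmetric])
    also have "Qmat \<Sigma> a = mat 1 - R a" by (simp add: Qmat_def R_def)
    also have "(K ** (mat 1 - R a)) $ i $ j = (K - K ** R a) $ i $ j"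
      by (simp add: matrix_matrix_mult_def sum_subtractf right_diff_distrib mat_def
          if_distrib[of "\<lambda>t. _ * t"] cong: if_cong)
    finally show ?case by (simp add: matrix_matrix_mult_def)
  qed
  ultimately have "((\<lambda>a. a * R a $ i $ j) \<longlongrightarrow> K $ i $ j - (\<Sum>k\<in>UNIV. K $ i $ k * 0)) at_top"
    by (rule Lim_transform_eventually)
  then show ?thesis by (simp add: R_def)
qed

lemma tendsto_matrix_mult [tendsto_intros]:
  fixes A :: "'a \<Rightarrow> real^'n^'m" and B :: "'a \<Rightarrow> real^'p^'n"
  assumes "(A \<longlongrightarrow> A') F" "(B \<longlongrightarrow> B') F"
  shows "((\<lambda>t. A t ** B t) \<longlongrightarrow> A' ** B') F"
  unfolding matrix_matrix_mult_def by (intro tendsto_intros assms)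

lemma tendsto_mat_pow [tendsto_intros]:
  "(A \<longlongrightarrow> A') F \<Longrightarrow> ((\<lambda>t. mat_pow (A t) k) \<longlongrightarrow> mat_pow A' k) F"
  by (induction k) (simp_all add: tendsto_matrix_mult)

lemma tendsto_alt_prod:
  assumes "(A \<longlongrightarrow> A') F" "(B \<longlongrightarrow> B') F" "(C \<longlongrightarrow> C') F" "(D \<longlongrightarrow> D') F"
  shows "((\<lambda>t. alt_prod (A t) (B t) (C t) (D t) k m d) \<longlongrightarrow> alt_prod A' B' C' D' k m d) F"
  by (induction d) (simp_all add: tendsto_matrix_mult tendsto_mat_pow assms)

lemma traces_nonneg_closed:
  assumes T: "(T \<longlongrightarrow> T') F" and F: "F \<noteq> bot"
    and nn: "\<forall>\<^sub>F t in F. 0 \<le> trace (alt_prod (block11 (T t)) (block12 (T t)) (block22 (T t)) (block21 (T t)) k m d)"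
  shows "0 \<le> trace (alt_prod (block11 T') (block12 T') (block22 T') (block21 T') k m d)"
proof (rule tendsto_lowerbound[OF _ nn F])
  have "((\<lambda>t. alt_prod (block11 (T t)) (block12 (T t)) (block22 (T t)) (block21 (T t)) k m d) \<longlongrightarrow>
      alt_prod (block11 T') (block12 T') (block22 T') (block21 T') k m d) F"
    by (rule tendsto_alt_prod)
      (unfold block11_def block12_def block21_def block22_def, (intro tendsto_intros T)+)
  then show "((\<lambda>t. trace (alt_prod (block11 (T t)) (block12 (T t)) (block22 (T t)) (block21 (T t)) k m d)) \<longlongrightarrow>
      trace (alt_prod (block11 T') (block12 T') (block22 T') (block21 T') k m d)) F"
    unfolding trace_def by (intro tendsto_intros)
qed

lemma top_eigenvector_scale:
  assumes "top_eigenvector A v" "0 < c" shows "top_eigenvector (c *\<^sub>R A) v"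
proof -
  have ev: "(c *\<^sub>R A) *v w = c *\<^sub>R (A *v w)" for w by (simp add: scaleR_matrix_vector_assoc)
  obtain l where l: "A *v v = l *\<^sub>R v" "\<And>\<mu> w. w \<noteq> 0 \<Longrightarrow> A *v w = \<mu> *\<^sub>R w \<Longrightarrow> \<mu> \<le> l" "v \<noteq> 0"
    and sc: "\<And>d. A = mat d \<Longrightarrow> v = vector [1, 0]"
    using assms(1) unfolding top_eigenvector_def by blast
  have "\<mu> \<le> c * l" if "w \<noteq> 0" "(c *\<^sub>R A) *v w = \<mu> *\<^sub>R w" for \<mu> w
  proof -
    have "A *v w = inverse c *\<^sub>R ((c *\<^sub>R A) *v w)" using assms(2) by (simp add: ev)
    then have "A *v w = (\<mu> / c) *\<^sub>R w" unfolding that(2) by (simp add: divide_inverse mult.commute)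
    then have "\<mu> / c \<le> l" using l(2) that(1) by blast
    then show ?thesis using assms(2) by (simp add: field_simps)
  qed
  moreover have "v = vector [1, 0]" if "c *\<^sub>R A = mat d" for d
  proof (rule sc[of "d / c"])
    have "A = inverse c *\<^sub>R (c *\<^sub>R A)" using assms(2) by simp
    then show "A = mat (d / c)" unfolding that by (simp add: vec_eq_iff mat_def divide_inverse)
  qed
  ultimately show ?thesis unfolding top_eigenvector_def using l(1,3) by (auto simp: ev)
qed

text \<open>Adding a multiple of the identity and rescaling changes neither the eigenvectors of the diagonal
  blocks nor the order of their eigenvalues, and multiplies the off-diagonal block by a positive
  factor.\<close>
lemma sign_condition_affine:
  fixes a c :: real
  assumes adm: "admissible Q W v" and sgn: "sign_condition Q W v" and a: "0 < a"
  defines "T \<equiv> c *\<^sub>R mat 1 + a *\<^sub>R Q"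
  assumes pos: "0 < conj_by W T $ 2 $ 2" "0 < conj_by W T $ 4 $ 4"
  shows "admissible T W v" "sign_condition T W v"
proof -
  have W: "signature22 W" using adm by (simp add: admissible_def Let_def)
  have e: "conj_by W T $ i $ j = (if i = j then c else 0) + a * conj_by W Q $ i $ j" for i j
    unfolding T_def conj_by_affine[OF signature22_orthogonal[OF W]] by (simp add: mat_def)
  have eq: "v$1 * conj_by W T $ 1 $ 3 * (v$1 * conj_by W T $ 1 $ 3 + v$2 * conj_by W T $ 2 $ 3) =
      a\<^sup>2 * (v$1 * conj_by W Q $ 1 $ 3 * (v$1 * conj_by W Q $ 1 $ 3 + v$2 * conj_by W Q $ 2 $ 3))"
    by (simp add: e power2_eq_square algebra_simps)
  show sT: "sign_condition T W v"
    using sgn unfolding sign_condition_def Let_def eq by (rule mult_nonneg_nonneg[OF zero_le_power2])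
  have b: "block12 T = a *\<^sub>R block12 Q" "block21 T = a *\<^sub>R block21 Q"
    by (simp_all add: T_def block_entries vec_eq_iff forall_2 mat_def)
  have "transpose (block11 W) ** block12 T ** block21 T ** block11 W =
      (a * a) *\<^sub>R (transpose (block11 W) ** block12 Q ** block21 Q ** block11 W)"
    by (simp add: b scaleR_matrix_mult)
  then have "top_eigenvector (transpose (block11 W) ** block12 T ** block21 T ** block11 W) v"
    using adm a by (simp add: admissible_def Let_def top_eigenvector_scale)
  then show "admissible T W v"
    using adm pos sT a unfolding admissible_def Let_def by (simp add: e)
qed

text \<open>Since \<open>a (Q - I)\<close> tends to \<open>- K\<close>, the matrices \<open>T = (\<kappa> - a) I + a Q\<close> inherit the sign condition from
  \<open>Q\<close> and converge to \<open>\<kappa> I - K\<close>. The sign condition itself need not pass to the limit, as the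
  rotations and eigenvectors may fail to converge, but nonnegativity of all traces is a closed
  condition; for \<open>\<kappa> I - K\<close> it yields the sign condition back, and alignment is the same for \<open>K\<close> and \<open>- K\<close>.\<close>
lemma sign_condition_precision_aligned:
  assumes S: "pos_def \<Sigma>" and K: "\<Sigma> ** K = mat 1" "K ** \<Sigma> = mat 1" "pos_def K"
    and adm: "\<And>a. 0 < a \<Longrightarrow> admissible (Qmat \<Sigma> a) (W a) (v a)"
    and ev: "\<forall>\<^sub>F a in at_top. sign_condition (Qmat \<Sigma> a) (W a) (v a)"
  obtains V where "signature22 V" "conj_by V K $ 1 $ 2 = 0" "conj_by V K $ 3 $ 4 = 0"
    "conj_by V K $ 1 $ 1 \<le> conj_by V K $ 2 $ 2" "conj_by V K $ 3 $ 3 \<le> conj_by V K $ 4 $ 4"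
    "aligned (conj_by V K $ 1 $ 3) (conj_by V K $ 1 $ 4) (conj_by V K $ 2 $ 3) (conj_by V K $ 2 $ 4)"
proof -
  define R where "R a = a *\<^sub>R matrix_inv (mat 1 + a *\<^sub>R \<Sigma>)" for a
  \<comment> \<open>Large enough that \<open>\<kappa> I - K\<close> is positive definite, and \<open>\<kappa> I - R a\<close> as well once \<open>a\<close> is large.\<close>
  define \<kappa> where "\<kappa> = entry_sum K + 1"
  define T where "T a = (\<kappa> - a) *\<^sub>R mat 1 + a *\<^sub>R Qmat \<Sigma> a" for a
  define T' where "T' = \<kappa> *\<^sub>R mat 1 - K"
  have TR: "T a = \<kappa> *\<^sub>R mat 1 - R a" for a
    by (simp add: T_def R_def Qmat_def algebra_simps)
  have Rij: "((\<lambda>a. R a $ i $ j) \<longlongrightarrow> K $ i $ j) at_top" for i j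
    using scaled_resolvent_tendsto[OF S K(1,2), of i j] by (simp add: R_def)
  then have R: "(R \<longlongrightarrow> K) at_top" by (intro vec_tendstoI)
  then have T: "(T \<longlongrightarrow> T') at_top" unfolding TR[abs_def] T'_def by (intro tendsto_intros)
  have "((\<lambda>a. entry_sum (R a)) \<longlongrightarrow> entry_sum K) at_top"
    unfolding entry_sum_def by (intro tendsto_intros Rij)
  then have small: "\<forall>\<^sub>F a in at_top. entry_sum (R a) < \<kappa>"
    by (rule order_tendstoD) (simp add: \<kappa>_def)
  have dpos: "0 < conj_by U (\<kappa> *\<^sub>R mat 1 - A) $ i $ i" if U: "orthogonal_matrix U" and A: "entry_sum A < \<kappa>" for U A i
  proof -
    have u: "(U *v axis i 1) \<bullet> (U *v axis i 1) = 1"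
      by (simp add: orthogonal_matrix_norm[OF U] inner_axis_axis)
    have "(U *v axis i 1) \<bullet> (A *v (U *v axis i 1)) \<le> entry_sum A"
      using quadratic_form_le_entry_sum[of "U *v axis i 1" A] by (simp add: u)
    moreover have "conj_by U (\<kappa> *\<^sub>R mat 1 - A) $ i $ i = \<kappa> - (U *v axis i 1) \<bullet> (A *v (U *v axis i 1))"
      unfolding conj_by_diag_entry
      by (simp add: matrix_vector_mult_diff_rdistrib scaleR_matrix_vector_assoc[symmetric] inner_diff_right u)
    ultimately show ?thesis using A by linarith
  qed
  have "\<forall>\<^sub>F a in at_top. \<forall>k m d. 0 \<le> trace (alt_prod (block11 (T a)) (block12 (T a)) (block22 (T a)) (block21 (T a)) k m d)"
    using ev small eventually_gt_at_top[of 0]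
  proof eventually_elim
    case (elim a)
    have o: "orthogonal_matrix (W a)"
      using adm[OF elim(3)] by (simp add: admissible_def Let_def signature22_orthogonal)
    have pos: "0 < conj_by (W a) (T a) $ i $ i" for i
      unfolding TR by (rule dpos[OF o elim(2)])
    have sym: "transpose (T a) = T a"
      using pos_def_Qmat[OF S elim(3)] by (auto simp: T_def pos_def_def transpose_def vec_eq_iff mat_def)
    note aff = sign_condition_affine[OF adm[OF elim(3)] elim(1,3), of "\<kappa> - a", folded T_def, OF pos pos]
    show ?case using sign_condition_traces_nonneg(1)[OF sym aff] by blast
  qed
  then have nn: "0 \<le> trace (alt_prod (block11 T') (block12 T') (block22 T') (block21 T') k m d)" for k m d
    by (intro traces_nonneg_closed[OF T]) (auto elim!: eventually_mono)
  have symK: "transpose K = K" using K(3) by (simp add: pos_def_def)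
  have T'_sym: "transpose T' = T'"
    using symK by (auto simp: T'_def transpose_def vec_eq_iff mat_def)
  have "pos_def T'"
    unfolding pos_def_def
  proof (intro conjI T'_sym allI impI)
    fix x :: "real^4" assume "x \<noteq> 0"
    then have "entry_sum K * (x \<bullet> x) < \<kappa> * (x \<bullet> x)" by (simp add: \<kappa>_def)
    then show "0 < x \<bullet> (T' *v x)"
      using quadratic_form_le_entry_sum[of x K]
      by (simp add: T'_def matrix_vector_mult_diff_rdistrib scaleR_matrix_vector_assoc[symmetric] inner_diff_right)
  qed
  then obtain V w where V: "admissible T' V w" using admissible_exists by blast
  then have "sign_condition T' V w"
    using traces_nonneg_iff_sign_condition[OF T'_sym V] nn by blast
  then have al: "aligned (conj_by V T' $ 1 $ 3) (conj_by V T' $ 1 $ 4) (conj_by V T' $ 2 $ 3) (conj_by V T' $ 2 $ 4)"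
    by (rule sign_condition_aligned[OF T'_sym V])
  have sV: "signature22 V" using V by (simp add: admissible_def Let_def)
  have "T' = \<kappa> *\<^sub>R mat 1 + (-1) *\<^sub>R K" by (simp add: T'_def)
  then have e: "conj_by V T' $ i $ j = (if i = j then \<kappa> else 0) - conj_by V K $ i $ j" for i j
    using conj_by_affine[OF signature22_orthogonal[OF sV], of \<kappa> "-1" K] by (simp add: mat_def)
  note nf = admissible_normal_form[OF T'_sym V]
  show ?thesis
    by (rule that[OF sV]) (use nf(4-11) al in \<open>simp_all add: e aligned_def\<close>)
qed

text \<open>The Laplace transform of the pair is the power \<open>-1/2\<close> of \<open>det \<Sigma> det (K + 2 \<Lambda>)\<close> with \<open>\<Lambda>\<close> the diagonal
  matrix of block weights, and every negative power of the determinant is a Laplace transform.\<close>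
theorem infinitely_divisible_sums_of_squares:
  fixes X :: "'a \<Rightarrow> real^4"
  assumes P: "prob_space M" and X: "gaussian_vector M X" "mean_vector M X = 0" "covariance_matrix M X = \<Sigma>"
    and S: "pos_def \<Sigma>"
    and adm: "\<And>a. 0 < a \<Longrightarrow> admissible (Qmat \<Sigma> a) (W a) (v a)"
    and ev: "\<forall>\<^sub>F a in at_top. sign_condition (Qmat \<Sigma> a) (W a) (v a)"
  shows "infinitely_divisible M (\<lambda>\<omega>. vector [(X \<omega> $ 1)\<^sup>2 + (X \<omega> $ 2)\<^sup>2, (X \<omega> $ 3)\<^sup>2 + (X \<omega> $ 4)\<^sup>2] :: real^2)"
proof -
  let ?Y = "\<lambda>\<omega>. vector [(X \<omega> $ 1)\<^sup>2 + (X \<omega> $ 2)\<^sup>2, (X \<omega> $ 3)\<^sup>2 + (X \<omega> $ 4)\<^sup>2] :: real^2"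
  obtain K where K: "\<Sigma> ** K = mat 1" "K ** \<Sigma> = mat 1" "pos_def K" using pos_def_invertible[OF S] .
  obtain V where V: "signature22 V" "conj_by V K $ 1 $ 2 = 0" "conj_by V K $ 3 $ 4 = 0"
    "conj_by V K $ 1 $ 1 \<le> conj_by V K $ 2 $ 2" "conj_by V K $ 3 $ 3 \<le> conj_by V K $ 4 $ 4"
    "aligned (conj_by V K $ 1 $ 3) (conj_by V K $ 1 $ 4) (conj_by V K $ 2 $ 3) (conj_by V K $ 2 $ 4)"
    using sign_condition_precision_aligned[OF S K adm ev] by metis
  show ?thesis
  proof (rule infinitely_divisible_of_laplace_roots[OF P])
    have [measurable]: "X \<in> borel_measurable M" using X(1) by (simp add: gaussian_vector_def)
    have [measurable]: "(\<lambda>\<omega>. X \<omega> $ i) \<in> borel_measurable M" for i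
    proof -
      have "(\<lambda>\<omega>. X \<omega> \<bullet> axis i 1) \<in> borel_measurable M" by measurable
      then show ?thesis by (simp add: inner_axis)
    qed
    show "?Y \<in> borel_measurable M"
      by (subst borel_measurable_euclidean_space) (auto simp: Basis_vec_def inner_axis forall_2)
    show "nonneg_vec (?Y \<omega>)" for \<omega> by (simp add: nonneg_vec_def forall_2)
    fix n :: nat assume n: "0 < n"
    \<comment> \<open>The \<open>n\<close>-th root of a power \<open>-1/2\<close>.\<close>
    define \<theta> where "\<theta> = 1 / (2 * real n)"
    have \<theta>: "0 < \<theta>" using n by (simp add: \<theta>_def)
    define F where "F l = det (K + diag_mat (block_weights l))" for l
    define c where "c = det \<Sigma> powr (- \<theta>)"
    have "laplace_fun (\<lambda>l. F l powr (- \<theta>))"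
      unfolding F_def by (rule laplace_fun_det_power[OF V(1) K(3) V(2-6) \<theta>])
    then have lf: "laplace_fun (\<lambda>l. c * F (2 *\<^sub>R l) powr (- \<theta>))"
      by (intro laplace_fun_cmult laplace_fun_scale[of "\<lambda>l. F l powr (- \<theta>)"]) (simp_all add: c_def)
    have detS: "0 < det \<Sigma>" by (rule gaussian_integral(2)[OF S])
    have "(c * F (2 *\<^sub>R l) powr (- \<theta>)) ^ n = (\<integral>\<omega>. exp (- (l \<bullet> ?Y \<omega>)) \<partial>M)" if l: "nonneg_vec l" for l
    proof -
      have w: "0 \<le> block_weights l $ i" for i
        using l exhaust_4[of i] by (auto simp: nonneg_vec_def)
      have s: "2 *\<^sub>R block_weights l = block_weights (2 *\<^sub>R l)" by (simp add: vec_eq_iff forall_4)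
      note G = gaussian_vector_laplace[OF P X S K(1), of "block_weights l", OF w, unfolded s, folded F_def]
      have Fpos: "0 < F (2 *\<^sub>R l)" using G(2) detS by (simp add: zero_less_mult_iff)
      have "(c * F (2 *\<^sub>R l) powr (- \<theta>)) ^ n = ((det \<Sigma> * F (2 *\<^sub>R l)) powr (- \<theta>)) ^ n"
        using detS Fpos by (simp add: c_def powr_mult)
      also have "\<dots> = (det \<Sigma> * F (2 *\<^sub>R l)) powr (- (1 / 2))"
        using n G(2) detS Fpos by (subst powr_realpow[symmetric]) (simp_all add: powr_powr \<theta>_def)
      also have "\<dots> = 1 / sqrt (det \<Sigma> * F (2 *\<^sub>R l))"
        using G(2) by (simp add: powr_minus_divide powr_half_sqrt less_imp_le)
      also have "\<dots> = (\<integral>\<omega>. exp (- (\<Sum>i\<in>UNIV. block_weights l $ i * (X \<omega> $ i)\<^sup>2)) \<partial>M)"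
        using G(1) by simp
      also have "\<dots> = (\<integral>\<omega>. exp (- (l \<bullet> ?Y \<omega>)) \<partial>M)"
        by (simp add: sum_4 inner_vec_def sum_2 algebra_simps)
      finally show ?thesis .
    qed
    with lf show "\<exists>\<psi>. laplace_fun \<psi> \<and> (\<forall>l. nonneg_vec l \<longrightarrow> \<psi> l ^ n = (\<integral>\<omega>. exp (- (l \<bullet> ?Y \<omega>)) \<partial>M))"
      by blast
  qed
qed


section \<open>The theorem\<close>

theorem theorem2p4:
  fixes M :: "'a measure" and X :: "'a \<Rightarrow> real^4" and \<Sigma> :: "real^4^4"
  assumes "prob_space M"
    and "gaussian_vector M X"
    and "mean_vector M X = 0"
    and "covariance_matrix M X = \<Sigma>"
    and "pos_def \<Sigma>"
  shows
    "(\<forall>a>0. \<forall>W v. admissible (Qmat \<Sigma> a) W v \<longrightarrow>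
        ((\<forall>d k m. trace (alt_prod (block11 (Qmat \<Sigma> a)) (block12 (Qmat \<Sigma> a))
                                (block22 (Qmat \<Sigma> a)) (block21 (Qmat \<Sigma> a)) k m d) \<ge> 0)
         \<longleftrightarrow> sign_condition (Qmat \<Sigma> a) W v)) \<and>
     (\<forall>W v. (\<forall>a>0. admissible (Qmat \<Sigma> a) (W a) (v a)) \<and>
            (\<forall>\<^sub>F a in at_top. sign_condition (Qmat \<Sigma> a) (W a) (v a)) \<longrightarrow>
        infinitely_divisible M
          (\<lambda>\<omega>. vector [(X \<omega> $ 1)\<^sup>2 + (X \<omega> $ 2)\<^sup>2, (X \<omega> $ 3)\<^sup>2 + (X \<omega> $ 4)\<^sup>2] :: real^2)) \<and>
     (\<forall>a>0. \<forall>k m. k \<le> 2 \<or> m \<le> 2 \<or> k + m \<le> 7 \<longrightarrow>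
        trace_sum (block11 (Qmat \<Sigma> a)) (block12 (Qmat \<Sigma> a))
                  (block22 (Qmat \<Sigma> a)) (block21 (Qmat \<Sigma> a)) k m +
        trace_sum (block22 (Qmat \<Sigma> a)) (block21 (Qmat \<Sigma> a))
                  (block11 (Qmat \<Sigma> a)) (block12 (Qmat \<Sigma> a)) m k \<ge> 0)"
proof (intro conjI allI impI)
  fix a :: real and W v
  assume "0 < a" "admissible (Qmat \<Sigma> a) W v"
  then show "(\<forall>d k m. trace (alt_prod (block11 (Qmat \<Sigma> a)) (block12 (Qmat \<Sigma> a))
      (block22 (Qmat \<Sigma> a)) (block21 (Qmat \<Sigma> a)) k m d) \<ge> 0) \<longleftrightarrow> sign_condition (Qmat \<Sigma> a) W v"
    using traces_nonneg_iff_sign_condition pos_def_Qmat[OF assms(5)] by (simp add: pos_def_def)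
next
  fix W v
  assume "(\<forall>a>0. admissible (Qmat \<Sigma> a) (W a) (v a)) \<and>
    (\<forall>\<^sub>F a in at_top. sign_condition (Qmat \<Sigma> a) (W a) (v a))"
  then show "infinitely_divisible M
      (\<lambda>\<omega>. vector [(X \<omega> $ 1)\<^sup>2 + (X \<omega> $ 2)\<^sup>2, (X \<omega> $ 3)\<^sup>2 + (X \<omega> $ 4)\<^sup>2] :: real^2)"
    by (intro infinitely_divisible_sums_of_squares[OF assms]) blast+
next
  fix a :: real and k m :: nat
  assume "0 < a" "k \<le> 2 \<or> m \<le> 2 \<or> k + m \<le> 7"
  then show "0 \<le> trace_sum (block11 (Qmat \<Sigma> a)) (block12 (Qmat \<Sigma> a))
        (block22 (Qmat \<Sigma> a)) (block21 (Qmat \<Sigma> a)) k m +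
      trace_sum (block22 (Qmat \<Sigma> a)) (block21 (Qmat \<Sigma> a))
        (block11 (Qmat \<Sigma> a)) (block12 (Qmat \<Sigma> a)) m k"
    by (intro add_nonneg_nonneg trace_sums_nonneg pos_def_Qmat assms(5))
qed

end
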